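(* Let $X=\{X(t),\,t\ge 0\}$ be a simple locally finite point process. Then $X$ is a fractional Poisson process (FPP) if and only if there exist a constant $\lambda>0$ and an $\alpha$-stable subordinator $L_\alpha=\{L_\alpha(t),\,t\ge 0\}$, $0<\alpha<1$, such that, denoting by $Y_\alpha(t)=\inf\{s: L_\alpha(s)\ge t\}$ its inverse stable subordinator, the process $$M=\{M(t),\,t\ge 0\}=\{X(t)-\lambda Y_\alpha(t),\,t\ge 0\}$$ is a right-continuous martingale with respect to the filtration $\mathcal{F}_t=\sigma(X(s),\,s\le t)\vee\sigma(Y_\alpha(s),\,s\ge 0)$ and, for any $T>0$, the family $$\{M(\tau)\,:\,\tau \text{ a stopping time such that } Y_\alpha(\tau)\le T\}$$ is uniformly integrable.
   Context: All processes are defined on a complete probability space $(\Omega,\mathcal{F},\mathrm{P})$. A point process on $\mathbb{R}_+$ is identified with its counting process $X(t)$; it is simple if its jumps are of magnitude $+1$, and locally finite if it does not have infinitely many jumps in a bounded region. For $0<\alpha<1$, an $\alpha$-stable subordinator $L_\alpha$ is an increasing Lévy process (cadlag, started from $0$, with independent stationary increments) with $\mathrm{E}e^{-sL_\alpha(t)}=e^{-ts^\alpha}$, $s\ge 0$. It is a.s. strictly increasing, and its inverse $Y_\alpha$ is a.s. continuous and nondecreasing. A fractional Poisson process (FPP) with parameters $\alpha\in(0,1)$, $\lambda>0$ is a process of the form $N_\alpha(t)=N(Y_\alpha(t))$, $t\ge 0$, where $N=\{N(t),t\ge0\}$ is a homogeneous Poisson process with intensity $\lambda$, independent of the inverse $Y_\alpha$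 of an $\alpha$-stable subordinator. Stopping times are with respect to $\{\mathcal{F}_t\}$. *)

theory Defs
  imports "HOL-Probability.Probability"
begin

text \<open>
  Processes indexed by \<open>t \<ge> 0\<close> are functions \<open>real \<Rightarrow> 'w \<Rightarrow> _\<close>; their values at negative times are
  irrelevant. Path properties, and identities between processes, are required almost surely,
  outside one null set that serves all times.
\<close>

section \<open>Point processes\<close>

text \<open>
  Values in \<open>nat\<close> mean that there are finitely many points in each \<open>[0, t]\<close>, and \<open>x 0 = 0\<close> that no
  point lies at the origin. The topology of \<open>nat\<close> is discrete, so a right-continuous path is
  constant immediately after each time.
\<close>

definition counting_path :: "(real \<Rightarrow> nat) \<Rightarrow> bool" where
  "counting_path x \<longleftrightarrow>
     x 0 = 0 \<and> mono_on {0..} x \<and> (\<forall>t\<ge>0. continuous (at_right t) x)"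

definition unit_jumps :: "(real \<Rightarrow> nat) \<Rightarrow> bool" where
  "unit_jumps x \<longleftrightarrow>
     (\<forall>t>0. \<exists>l. (x \<longlongrightarrow> l) (at_left t) \<and> (x t = l \<or> x t = l + 1))"

definition locally_finite_jumps :: "(real \<Rightarrow> nat) \<Rightarrow> bool" where
  "locally_finite_jumps x \<longleftrightarrow> (\<forall>T. finite {t. 0 < t \<and> t \<le> T \<and> \<not> isCont x t})"

definition point_process :: "'w measure \<Rightarrow> (real \<Rightarrow> 'w \<Rightarrow> nat) \<Rightarrow> bool" where
  "point_process P X \<longleftrightarrow>
     (\<forall>t\<ge>0. X t \<in> measurable P (count_space UNIV)) \<and>
     (AE \<omega> in P. counting_path (\<lambda>t. X t \<omega>))"

definition simple_locally_finite_point_process ::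
  "'w measure \<Rightarrow> (real \<Rightarrow> 'w \<Rightarrow> nat) \<Rightarrow> bool" where
  "simple_locally_finite_point_process P X \<longleftrightarrow>
     point_process P X \<and>
     (AE \<omega> in P. unit_jumps (\<lambda>t. X t \<omega>)) \<and>
     (AE \<omega> in P. locally_finite_jumps (\<lambda>t. X t \<omega>))"

section \<open>Poisson processes, stable subordinators and their inverses\<close>

definition independent_increments :: "'w measure \<Rightarrow> (real \<Rightarrow> 'w \<Rightarrow> real) \<Rightarrow> bool" where
  "independent_increments P Z \<longleftrightarrow>
     (\<forall>(n::nat) (t::nat \<Rightarrow> real). 0 \<le> t 0 \<longrightarrow> (\<forall>i<n. t i \<le> t (Suc i)) \<longrightarrow>
        prob_space.indep_vars P (\<lambda>_. borel) (\<lambda>i \<omega>. Z (t (Suc i)) \<omega> - Z (t i) \<omega>) {..<n})"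

definition stationary_increments :: "'w measure \<Rightarrow> (real \<Rightarrow> 'w \<Rightarrow> real) \<Rightarrow> bool" where
  "stationary_increments P Z \<longleftrightarrow>
     (\<forall>t\<ge>0. \<forall>h\<ge>0.
        distr P borel (\<lambda>\<omega>. Z (t + h) \<omega> - Z t \<omega>) = distr P borel (\<lambda>\<omega>. Z h \<omega> - Z 0 \<omega>))"

definition cadlag_path :: "(real \<Rightarrow> real) \<Rightarrow> bool" where
  "cadlag_path x \<longleftrightarrow>
     (\<forall>t\<ge>0. continuous (at_right t) x) \<and> (\<forall>t>0. \<exists>l. (x \<longlongrightarrow> l) (at_left t))"

definition levy_process :: "'w measure \<Rightarrow> (real \<Rightarrow> 'w \<Rightarrow> real) \<Rightarrow> bool" where
  "levy_process P L \<longleftrightarrow>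
     (\<forall>t\<ge>0. L t \<in> borel_measurable P) \<and>
     (AE \<omega> in P. L 0 \<omega> = 0 \<and> cadlag_path (\<lambda>t. L t \<omega>)) \<and>
     independent_increments P L \<and> stationary_increments P L"

definition stable_subordinator ::
  "'w measure \<Rightarrow> real \<Rightarrow> (real \<Rightarrow> 'w \<Rightarrow> real) \<Rightarrow> bool" where
  "stable_subordinator P \<alpha> L \<longleftrightarrow>
     levy_process P L \<and>
     (AE \<omega> in P. mono_on {0..} (\<lambda>t. L t \<omega>)) \<and>
     (\<forall>t\<ge>0. \<forall>s\<ge>0. integral\<^sup>L P (\<lambda>\<omega>. exp (- s * L t \<omega>)) = exp (- t * s powr \<alpha>))"

definition inverse_subordinator :: "(real \<Rightarrow> 'w \<Rightarrow> real) \<Rightarrow> real \<Rightarrow> 'w \<Rightarrow> real" where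
  "inverse_subordinator L t \<omega> = Inf {s. 0 \<le> s \<and> t \<le> L s \<omega>}"

definition poisson_process :: "'w measure \<Rightarrow> real \<Rightarrow> (real \<Rightarrow> 'w \<Rightarrow> nat) \<Rightarrow> bool" where
  "poisson_process P lam N \<longleftrightarrow>
     point_process P N \<and>
     independent_increments P (\<lambda>t \<omega>. real (N t \<omega>)) \<and>
     (\<forall>s t. 0 \<le> s \<longrightarrow> s < t \<longrightarrow>
        distr P (count_space UNIV) (\<lambda>\<omega>. N t \<omega> - N s \<omega>) =
        measure_pmf (poisson_pmf (lam * (t - s))))"

definition independent_processes ::
  "'w measure \<Rightarrow> (real \<Rightarrow> 'w \<Rightarrow> real) \<Rightarrow> (real \<Rightarrow> 'w \<Rightarrow> real) \<Rightarrow> bool" where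
  "independent_processes P Z W \<longleftrightarrow>
     prob_space.indep_var P
       (PiM {0..} (\<lambda>_. borel)) (\<lambda>\<omega>. \<lambda>t\<in>{0..}. Z t \<omega>)
       (PiM {0..} (\<lambda>_. borel)) (\<lambda>\<omega>. \<lambda>t\<in>{0..}. W t \<omega>)"

text \<open>\<open>N\<close> and the subordinator live on the same probability space as \<open>X\<close>.\<close>

definition fractional_poisson_process_with ::
  "'w measure \<Rightarrow> real \<Rightarrow> real \<Rightarrow> (real \<Rightarrow> 'w \<Rightarrow> nat) \<Rightarrow> bool" where
  "fractional_poisson_process_with P \<alpha> lam X \<longleftrightarrow>
     (\<exists>N L. poisson_process P lam N \<and> stable_subordinator P \<alpha> L \<and>
        independent_processes P (\<lambda>t \<omega>. real (N t \<omega>)) (inverse_subordinator L) \<and>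
        (AE \<omega> in P. \<forall>t\<ge>0. X t \<omega> = N (inverse_subordinator L t \<omega>) \<omega>))"

definition fractional_poisson_process ::
  "'w measure \<Rightarrow> (real \<Rightarrow> 'w \<Rightarrow> nat) \<Rightarrow> bool" where
  "fractional_poisson_process P X \<longleftrightarrow>
     (\<exists>\<alpha> lam. 0 < \<alpha> \<and> \<alpha> < 1 \<and> 0 < lam \<and> fractional_poisson_process_with P \<alpha> lam X)"

section \<open>Martingales and uniform integrability\<close>

text \<open>
  Filtrations are indexed by \<open>ennreal\<close>, that is by \<open>[0, \<infinity>]\<close>, so that the stopping times of
  \<^const>\<open>stopping_time\<close> may take the value \<open>\<infinity>\<close>. The condition at time \<open>\<infinity>\<close> is vacuous for them.
\<close>

definition fpp_filtration ::
  "'w measure \<Rightarrow> (real \<Rightarrow> 'w \<Rightarrow> nat) \<Rightarrow> (real \<Rightarrow> 'w \<Rightarrow> real) \<Rightarrow> ennreal \<Rightarrow> 'w measure" where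
  "fpp_filtration P X Y t =
     sigma (space P)
       ({X s -` A \<inter> space P | s A. 0 \<le> s \<and> ennreal s \<le> t} \<union>
        {Y s -` B \<inter> space P | s B. 0 \<le> s \<and> B \<in> sets borel})"

definition martingale ::
  "'w measure \<Rightarrow> (ennreal \<Rightarrow> 'w measure) \<Rightarrow> (real \<Rightarrow> 'w \<Rightarrow> real) \<Rightarrow> bool" where
  "martingale P F Z \<longleftrightarrow>
     filtration (space P) F \<and> (\<forall>t. subalgebra P (F t)) \<and>
     (\<forall>t\<ge>0. Z t \<in> borel_measurable (F (ennreal t)) \<and> integrable P (Z t)) \<and>
     (\<forall>s t. 0 \<le> s \<longrightarrow> s \<le> t \<longrightarrow>
        (AE \<omega> in P. real_cond_exp P (F (ennreal s)) (Z t) \<omega> = Z s \<omega>))"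

definition right_continuous_process :: "'w measure \<Rightarrow> (real \<Rightarrow> 'w \<Rightarrow> real) \<Rightarrow> bool" where
  "right_continuous_process P Z \<longleftrightarrow>
     (AE \<omega> in P. \<forall>t\<ge>0. continuous (at_right t) (\<lambda>u. Z u \<omega>))"

definition uniformly_integrable :: "'w measure \<Rightarrow> ('w \<Rightarrow> real) set \<Rightarrow> bool" where
  "uniformly_integrable P H \<longleftrightarrow>
     (\<forall>f\<in>H. f \<in> borel_measurable P) \<and>
     ((\<lambda>K. SUP f\<in>H. \<integral>\<^sup>+\<omega>. ennreal \<bar>f \<omega>\<bar> * indicator {\<omega>. K < \<bar>f \<omega>\<bar>} \<omega> \<partial>P) \<longlongrightarrow> 0)
       (at_top :: real filter)"

definition stopped_value :: "(real \<Rightarrow> 'w \<Rightarrow> real) \<Rightarrow> ('w \<Rightarrow> ennreal) \<Rightarrow> 'w \<Rightarrow> real" where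
  "stopped_value Z \<tau> \<omega> = Z (enn2real (\<tau> \<omega>)) \<omega>"

text \<open>
  The stopping times with \<open>Y(\<tau>) \<le> T\<close>. Since \<open>Y(t)\<close> tends to \<open>\<infinity>\<close>, the condition entails
  that \<open>\<tau>\<close> is finite; this has to be stated because \<^const>\<open>enn2real\<close> maps \<open>\<infinity>\<close> to \<open>0\<close>.
\<close>

definition bounded_clock_stopping_times ::
  "'w measure \<Rightarrow> (ennreal \<Rightarrow> 'w measure) \<Rightarrow> (real \<Rightarrow> 'w \<Rightarrow> real) \<Rightarrow> real \<Rightarrow> ('w \<Rightarrow> ennreal) set"
  where
  "bounded_clock_stopping_times P F Y T =
     {\<tau>. stopping_time F \<tau> \<and> (AE \<omega> in P. \<tau> \<omega> < \<infinity> \<and> stopped_value Y \<tau> \<omega> \<le> T)}"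

end

theory Submission
  imports Defs
begin

text \<open>
  The clock \<open>Y\<close> is known at time \<open>0\<close>, so given \<open>Y\<close> a martingale \<open>X - \<lambda> Y\<close> makes \<open>X\<close> a Poisson process
  with deterministic cumulative intensity \<open>\<lambda> Y\<close>. This is seen on generating functions: telescoping
  \<open>z ^ (X t - X s) exp (- \<lambda> (1 - z) (Y t - Y s))\<close> along a grid, the first-order terms are centred by the
  martingale property, and the remainders vanish because \<open>X\<close> has unit jumps and \<open>Y\<close> is continuous.
  Times that depend on \<open>Y\<close> only may be treated as constants, so \<open>N u = X (L u)\<close> is a Poisson process
  independent of \<open>Y\<close>. Moreover \<open>X = N \<circ> Y\<close>, since almost surely \<open>X\<close> has no points where \<open>Y\<close> is flat.

  Conversely, given \<open>Y\<close> the increments of \<open>N \<circ> Y\<close> are Poisson increments of \<open>N\<close>; to make sense of this, \<open>Y\<close>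
  is first rounded up to dyadic values. Uniform integrability is domination:
  \<open>Y \<tau> \<le> T\<close> gives \<open>\<bar>M \<tau>\<bar> \<le> N T + \<lambda> T\<close>.
\<close>

section \<open>Counting paths and clocks along a grid\<close>

text \<open>The weights in the telescoping sum look ahead: each contains the clock after the cell
  that it multiplies. This is legitimate because every sigma-algebra of the filtration holds all of
  \<open>Y\<close>, and for the same reason conditional laws can be written as integral identities
  against weights with values in \<open>[0, 1]\<close>. The obstacle is that the martingale property
  concerns deterministic times, while \<open>L u\<close> is random and the filtration is generated
  by \<open>Y\<close> rather than by \<open>L\<close>. So \<open>L u\<close> is replaced by the
  first dyadic time at which \<open>Y\<close> has passed \<open>u\<close>. It takes countably many
  values, each on an event of the clock where the time is a constant, and it approaches
  \<open>L u\<close> from above, so right continuity yields the limit. The rounding of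
  \<open>Y\<close> in the converse serves the same two ends. Points on flat pieces of
  \<open>Y\<close> are excluded by the same limit law, applied to the times \<open>q\<close> and
  \<open>L (Y q)\<close>: the clock agrees there, so the Poisson parameter is \<open>0\<close>.
  Taking \<open>z\<close> in \<open>[0, 1)\<close> keeps the generating functions bounded, and right
  limits at \<open>0\<close> still recover all coefficients.\<close>

lemma discrete_tendsto_eventually:
  fixes f :: "'a \<Rightarrow> nat"
  assumes "(f \<longlongrightarrow> l) F"
  shows "\<forall>\<^sub>F u in F. f u = l"
  using assms by (auto simp: tendsto_discrete)

lemma counting_path_right_constant:
  assumes "counting_path x" "0 \<le> r"
  shows "\<exists>b>r. \<forall>u. r \<le> u \<and> u < b \<longrightarrow> x u = x r"
proof -
  have "(x \<longlongrightarrow> x r) (at_right r)"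
    using assms by (auto simp: counting_path_def continuous_within)
  then have "\<forall>\<^sub>F u in at_right r. x u = x r" by (rule discrete_tendsto_eventually)
  then obtain b where b: "b > r" "\<forall>y>r. y < b \<longrightarrow> x y = x r"
    unfolding eventually_at_right_field by blast
  then show ?thesis by (intro exI[of _ b]) (auto simp: le_less)
qed

text \<open>Close to \<open>r\<close> the path has only two values, its left limit and
  \<open>x r\<close>, which differ by at most one. At \<open>r = 0\<close> there is no left side,
  and right constancy suffices.\<close>

lemma counting_path_local_unit:
  assumes "counting_path x" "unit_jumps x" "0 \<le> r"
  shows "\<exists>e>0. \<forall>a b. 0 \<le> a \<longrightarrow> a \<in> ball r e \<longrightarrow> b \<in> ball r e \<longrightarrow> 0 \<le> b \<longrightarrow> x b \<le> x a + 1"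
proof -
  obtain b where b: "b > r" "\<forall>u. r \<le> u \<and> u < b \<longrightarrow> x u = x r"
    using counting_path_right_constant[OF assms(1,3)] by blast
  show ?thesis
  proof (cases "r = 0")
    case True
    show ?thesis
    proof (intro exI[of _ b] conjI allI impI)
      fix u v assume "0 \<le> u" "u \<in> ball r b" "v \<in> ball r b" "0 \<le> v"
      then have "x u = x r" "x v = x r"
        using True b(2)[rule_format, of u] b(2)[rule_format, of v] by (simp_all add: dist_real_def)
      then show "x v \<le> x u + 1" by simp
    qed (use b True in simp)
  next
    case False
    then have "r > 0" using assms(3) by simp
    then obtain l where l: "(x \<longlongrightarrow> l) (at_left r)" "x r = l \<or> x r = l + 1"
      using assms(2) unfolding unit_jumps_def by blast
    obtain c where c: "c < r" "\<forall>y>c. y < r \<longrightarrow> x y = l"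
      using discrete_tendsto_eventually[OF l(1)] unfolding eventually_at_left_field by blast
    have val: "x u = l \<or> x u = x r" if "u > c" "u < b" for u
      using b(2)[rule_format, of u] c(2)[rule_format, of u] that by (cases "u < r") simp_all
    show ?thesis
    proof (intro exI[of _ "min (b - r) (r - c)"] conjI allI impI)
      fix u v assume "u \<in> ball r (min (b - r) (r - c))" "v \<in> ball r (min (b - r) (r - c))"
      then have "u > c" "u < b" "v > c" "v < b" unfolding mem_ball dist_real_def by linarith+
      then show "x v \<le> x u + 1" using val[of u] val[of v] l(2) by auto
    qed (use b(1) c(1) in simp)
  qed
qed

text \<open>Compactness of \<open>[0, t]\<close>: \<open>e\<close> is a Lebesgue number of the cover
  by the balls of \<open>counting_path_local_unit\<close>. A grid finer than \<open>e\<close> sees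
  at most one point per cell.\<close>

lemma counting_path_uniform_unit:
  assumes "counting_path x" "unit_jumps x"
  shows "\<exists>e>0. \<forall>a b. 0 \<le> a \<longrightarrow> a \<le> b \<longrightarrow> b \<le> t \<longrightarrow> b - a < e \<longrightarrow> x b \<le> x a + 1"
proof -
  define G where "G = {ball r e | r e. \<forall>a b. 0 \<le> a \<longrightarrow> a \<in> ball r e \<longrightarrow> b \<in> ball r e \<longrightarrow> 0 \<le> b \<longrightarrow> x b \<le> x a + 1}"
  have "{0..t} \<subseteq> \<Union>G"
  proof
    fix r assume "r \<in> {0..t}"
    then obtain e where "e > 0" "\<forall>a b. 0 \<le> a \<longrightarrow> a \<in> ball r e \<longrightarrow> b \<in> ball r e \<longrightarrow> 0 \<le> b \<longrightarrow> x b \<le> x a + 1"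
      using counting_path_local_unit[OF assms, of r] by auto
    then have "ball r e \<in> G" "r \<in> ball r e" unfolding G_def by auto
    then show "r \<in> \<Union>G" by blast
  qed
  moreover have "\<And>g. g \<in> G \<Longrightarrow> open g" unfolding G_def by auto
  ultimately obtain e where e: "e > 0" "\<forall>a\<in>{0..t}. \<exists>g\<in>G. ball a e \<subseteq> g"
    using Heine_Borel_lemma[of "{0..t}" G] by (metis compact_Icc)
  show ?thesis
  proof (intro exI[of _ e] conjI allI impI e)
    fix a b assume ab: "0 \<le> a" "a \<le> b" "b \<le> t" "b - a < e"
    then have "a \<in> {0..t}" by simp
    then obtain g where g: "g \<in> G" "ball a e \<subseteq> g" using e(2) by blast
    have "a \<in> g" "b \<in> g" using g(2) ab e(1) by (auto simp: dist_real_def subset_eq)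
    moreover have "\<forall>a b. 0 \<le> a \<longrightarrow> a \<in> g \<longrightarrow> b \<in> g \<longrightarrow> 0 \<le> b \<longrightarrow> x b \<le> x a + 1"
      using g(1) unfolding G_def by auto
    ultimately show "x b \<le> x a + 1" using ab by simp
  qed
qed

text \<open>There are \<open>Suc n\<close> cells, so the mesh is a genuine quotient for every
  \<open>n\<close>.\<close>

definition grid :: "real \<Rightarrow> real \<Rightarrow> nat \<Rightarrow> nat \<Rightarrow> real" where
  "grid s t n i = s + real i * ((t - s) / real (Suc n))"

lemma grid_0 [simp]: "grid s t n 0 = s"
  by (simp add: grid_def)

lemma grid_Suc [simp]: "grid s t n (Suc n) = t"
  by (simp add: grid_def)

lemma grid_step: "grid s t n (Suc i) - grid s t n i = (t - s) / real (Suc n)"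
proof -
  have "(1 + real i) * d - real i * d = d" for d :: real by (simp add: distrib_right)
  from this[of "(t - s) / real (Suc n)"] show ?thesis by (simp add: grid_def del: of_nat_Suc) (simp only: of_nat_Suc add.commute)
qed

lemma grid_mono: "s \<le> t \<Longrightarrow> i \<le> j \<Longrightarrow> grid s t n i \<le> grid s t n j"
  unfolding grid_def by (intro add_left_mono mult_right_mono) auto

lemma grid_bounds:
  assumes "s \<le> t" "i \<le> Suc n"
  shows "s \<le> grid s t n i" "grid s t n i \<le> t"
  using grid_mono[OF assms(1), of 0 i n] grid_mono[OF assms(1,2), of n] by auto

lemma grid_mesh:
  assumes "(e::real) > 0"
  shows "\<forall>\<^sub>F n in sequentially. (t - s) / real (Suc n) < e"
proof -
  have "(\<lambda>n. (t - s) / real (Suc n)) \<longlonglongrightarrow> 0"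
    by (rule LIMSEQ_Suc[OF lim_const_over_n])
  then show ?thesis using assms by (rule order_tendstoD)
qed

text \<open>Remainder of \<open>z ^ k\<close> after the terms linear in \<open>k\<close>. It
  vanishes at \<open>k = 0\<close> and \<open>k = 1\<close>, so cells with at most one point
  contribute no error.\<close>

definition pgf_error :: "real \<Rightarrow> nat \<Rightarrow> real" where
  "pgf_error z k = z ^ k - 1 + (1 - z) * real k"

text \<open>The lower bound is Bernoulli's inequality. The upper bound telescopes along a grid and
  so gives a domination that does not depend on the mesh.\<close>

lemma pgf_error_bounds:
  assumes "0 \<le> z" "z \<le> 1"
  shows "0 \<le> pgf_error z k" "pgf_error z k \<le> real k"
proof -
  have "1 + real k * (z - 1) \<le> (1 + (z - 1)) ^ k"
    by (rule Bernoulli_inequality) (use assms in simp)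
  then show "0 \<le> pgf_error z k" by (simp add: pgf_error_def algebra_simps)
  have "z ^ k \<le> 1" "(1 - z) * real k \<le> 1 * real k"
    using assms by (simp add: power_le_one, intro mult_right_mono) (use assms in auto)
  then show "pgf_error z k \<le> real k" by (simp add: pgf_error_def)
qed

lemma pgf_error_le_1: "k \<le> 1 \<Longrightarrow> pgf_error z k = 0"
  by (cases k) (auto simp: pgf_error_def)

text \<open>First-order Taylor remainder of \<open>exp (- v)\<close>. Its linear bound serves for
  domination, its quadratic bound for convergence along grids.\<close>

definition exp_error :: "real \<Rightarrow> real" where
  "exp_error v = exp (- v) - 1 + v"

lemma exp_error_bounds:
  assumes "0 \<le> v"
  shows "0 \<le> exp_error v" "exp_error v \<le> v" "exp_error v \<le> v * v"
proof -
  have 1: "1 - v \<le> exp (- v)" using exp_ge_add_one_self[of "-v"] by simp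
  then show "0 \<le> exp_error v" by (simp add: exp_error_def)
  show "exp_error v \<le> v" using assms by (simp add: exp_error_def)
  \<comment> \<open>Rearranged, \<open>exp (- v) * (1 + v) \<le> 1\<close> says that the error is at
    most \<open>v * (1 - exp (- v))\<close>.\<close>
  have "exp (-v) * (1 + v) \<le> exp (-v) * exp v"
    by (intro mult_left_mono) (auto simp: exp_ge_add_one_self)
  also have "\<dots> = 1" by (simp add: exp_minus)
  finally have "exp_error v \<le> v * (1 - exp (-v))" by (simp add: exp_error_def algebra_simps)
  also have "\<dots> \<le> v * v" using 1 assms by (intro mult_left_mono) auto
  finally show "exp_error v \<le> v * v" .
qed

lemma pgf_error_grid_tendsto:
  assumes "counting_path x" "unit_jumps x" "0 \<le> s" "s \<le> t"
  shows "(\<lambda>n. \<Sum>i<Suc n. pgf_error z (x (grid s t n (Suc i)) - x (grid s t n i))) \<longlonglongrightarrow> 0"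
proof -
  obtain e where e: "e > 0" "\<forall>a b. 0 \<le> a \<longrightarrow> a \<le> b \<longrightarrow> b \<le> t \<longrightarrow> b - a < e \<longrightarrow> x b \<le> x a + 1"
    using counting_path_uniform_unit[OF assms(1,2), of t] by blast
  have "\<forall>\<^sub>F n in sequentially. (\<Sum>i<Suc n. pgf_error z (x (grid s t n (Suc i)) - x (grid s t n i))) = 0"
    using grid_mesh[OF e(1), of t s]
  proof eventually_elim
    case (elim n)
    show ?case
    proof (intro sum.neutral ballI pgf_error_le_1)
      fix i assume i: "i \<in> {..<Suc n}"
      have "x (grid s t n (Suc i)) \<le> x (grid s t n i) + 1"
        using e(2)[rule_format, of "grid s t n i" "grid s t n (Suc i)"] grid_step[of s t n i] elim
          grid_bounds[OF assms(4), of i n] grid_bounds[OF assms(4), of "Suc i" n] i assms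
          grid_mono[OF assms(4), of i "Suc i" n] by auto
      then show "x (grid s t n (Suc i)) - x (grid s t n i) \<le> 1" by simp
    qed
  qed
  then show ?thesis by (rule tendsto_eventually)
qed

text \<open>A continuous monotone function has zero quadratic variation: the sum of the squared
  increments is at most the largest increment times the total increment, and the largest one tends
  to \<open>0\<close> by uniform continuity.\<close>

lemma exp_error_grid_tendsto:
  fixes y :: "real \<Rightarrow> real"
  assumes "continuous_on {0..} y" "mono_on {0..} y" "0 \<le> s" "s \<le> t" "0 \<le> c"
  shows "(\<lambda>n. \<Sum>i<Suc n. exp_error (c * (y (grid s t n (Suc i)) - y (grid s t n i)))) \<longlonglongrightarrow> 0"
proof -
  let ?d = "\<lambda>n i. c * (y (grid s t n (Suc i)) - y (grid s t n i))"
  have uc: "uniformly_continuous_on {s..t} y"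
    by (intro compact_uniformly_continuous continuous_on_subset[OF assms(1)]) (use assms in auto)
  have d0: "0 \<le> ?d n i" if "i < Suc n" for n i
    using assms(2)[THEN mono_onD, of "grid s t n i" "grid s t n (Suc i)"] grid_mono[OF assms(4), of i "Suc i" n]
      grid_bounds[OF assms(4), of i n] that assms(3,5) by simp
  have tele: "(\<Sum>i<Suc n. ?d n i) = c * (y t - y s)" for n
    using sum_lessThan_telescope[of "\<lambda>i. y (grid s t n i)" "Suc n"]
    by (simp only: sum_distrib_left[symmetric] grid_0 grid_Suc)
  have tot: "0 \<le> c * (y t - y s)" using tele[of 0] d0[of 0 0] by simp
  show ?thesis
  proof (rule LIMSEQ_I)
    fix r :: real assume "r > 0"
    \<comment> \<open>The summand \<open>1\<close> guards against a total increment of zero;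
      \<open>c + 1\<close> below does the same for \<open>c = 0\<close>.\<close>
    define e where "e = r / (c * (y t - y s) + 1)"
    have e: "e > 0" "e * (c * (y t - y s)) < r"
      using \<open>r > 0\<close> tot by (auto simp: e_def field_simps)
    have "e / (c + 1) > 0" using e assms by simp
    then obtain d where d: "d > 0" "\<And>a b. a \<in> {s..t} \<Longrightarrow> b \<in> {s..t} \<Longrightarrow> dist a b < d \<Longrightarrow> dist (y a) (y b) < e / (c + 1)"
      using uc unfolding uniformly_continuous_on_def by metis
    obtain n0 where n0: "\<And>n. n \<ge> n0 \<Longrightarrow> (t - s) / real (Suc n) < d"
      using grid_mesh[OF d(1), of t s] unfolding eventually_sequentially by blast
    show "\<exists>no. \<forall>n\<ge>no. norm ((\<Sum>i<Suc n. exp_error (?d n i)) - 0) < r"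
    proof (intro exI[of _ n0] allI impI)
      fix n assume n: "n \<ge> n0"
      have le: "exp_error (?d n i) \<le> e * ?d n i" if "i < Suc n" for i
      proof -
        have "dist (y (grid s t n (Suc i))) (y (grid s t n i)) < e / (c + 1)"
          using grid_bounds[OF assms(4), of i n] grid_bounds[OF assms(4), of "Suc i" n] that n0[OF n]
            grid_step[of s t n i] grid_mono[OF assms(4), of i "Suc i" n]
          by (intro d(2)) (auto simp: dist_real_def simp del: of_nat_Suc)
        then have "y (grid s t n (Suc i)) - y (grid s t n i) \<le> e / (c + 1)" by (simp add: dist_real_def)
        then have "?d n i \<le> c * (e / (c + 1))" using assms(5) by (intro mult_left_mono)
        also have "\<dots> \<le> e" using assms(5) e by (simp add: field_simps)
        finally have "?d n i * ?d n i \<le> e * ?d n i" using d0[OF that] by (intro mult_right_mono) auto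
        then show ?thesis using exp_error_bounds(3)[OF d0[OF that]] by linarith
      qed
      have "(\<Sum>i<Suc n. exp_error (?d n i)) \<le> (\<Sum>i<Suc n. e * ?d n i)"
        using le by (intro sum_mono) auto
      also have "\<dots> = e * (c * (y t - y s))" using tele by (simp add: sum_distrib_left[symmetric] del: sum.lessThan_Suc)
      finally have "(\<Sum>i<Suc n. exp_error (?d n i)) < r" using e by linarith
      moreover have "0 \<le> (\<Sum>i<Suc n. exp_error (?d n i))"
        using d0 by (intro sum_nonneg exp_error_bounds) auto
      ultimately show "norm ((\<Sum>i<Suc n. exp_error (?d n i)) - 0) < r" by simp
    qed
  qed
qed

section \<open>Subordinators and their inverses\<close>

text \<open>What the inversion of a path uses: unboundedness keeps the infimum away from the empty
  set, right continuity makes it attained, and strict increase makes the inverse continuous.\<close>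

definition clock_path :: "(real \<Rightarrow> real) \<Rightarrow> bool" where
  "clock_path l \<longleftrightarrow>
     l 0 = 0 \<and> strict_mono_on {0..} l \<and> (\<forall>t\<ge>0. continuous (at_right t) l) \<and> (\<forall>c. \<exists>t\<ge>0. c \<le> l t)"

definition path_inverse :: "(real \<Rightarrow> real) \<Rightarrow> real \<Rightarrow> real" where
  "path_inverse l t = Inf {s. 0 \<le> s \<and> t \<le> l s}"

lemma inverse_subordinator_eq: "inverse_subordinator L t \<omega> = path_inverse (\<lambda>s. L s \<omega>) t"
  by (simp add: inverse_subordinator_def path_inverse_def)

lemma clock_path_less: "clock_path l \<Longrightarrow> 0 \<le> a \<Longrightarrow> a < b \<Longrightarrow> l a < l b"
  unfolding clock_path_def using strict_mono_onD[of "{0..}" l a b] by auto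

lemma clock_path_mono: "clock_path l \<Longrightarrow> 0 \<le> a \<Longrightarrow> a \<le> b \<Longrightarrow> l a \<le> l b"
  using clock_path_less[of l a b] by (cases "a = b") auto

lemma clock_path_nonneg: "clock_path l \<Longrightarrow> 0 \<le> a \<Longrightarrow> 0 \<le> l a"
  using clock_path_mono[of l 0 a] by (simp add: clock_path_def)

text \<open>Right continuity makes the infimum a minimum, so \<open>l\<close> and its inverse form a Galois connection.\<close>

lemma path_inverse_le_iff:
  assumes "clock_path l" "0 \<le> u"
  shows "path_inverse l t \<le> u \<longleftrightarrow> t \<le> l u"
proof
  let ?S = "{s. 0 \<le> s \<and> t \<le> l s}"
  have ne: "?S \<noteq> {}" and bb: "bdd_below ?S"
    using assms(1) by (auto simp: clock_path_def intro!: bdd_belowI[of _ 0])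
  show "path_inverse l t \<le> u" if "t \<le> l u"
    unfolding path_inverse_def using that assms by (intro cInf_lower bb) auto
  show "t \<le> l u" if "path_inverse l t \<le> u"
  proof (rule ccontr)
    assume "\<not> t \<le> l u"
    moreover have "(l \<longlongrightarrow> l u) (at_right u)"
      using assms by (auto simp: clock_path_def continuous_within)
    ultimately have "\<forall>\<^sub>F v in at_right u. l v < t" by (auto intro: order_tendstoD)
    then obtain b where b: "b > u" "\<And>v. v > u \<Longrightarrow> v < b \<Longrightarrow> l v < t"
      by (metis eventually_at_right_field)
    have "(u + b) / 2 \<le> path_inverse l t"
      unfolding path_inverse_def
    proof (rule cInf_greatest[OF ne])
      fix s assume s: "s \<in> ?S"
      show "(u + b) / 2 \<le> s"
      proof (rule ccontr)
        assume "\<not> (u + b) / 2 \<le> s"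
        then have "l s \<le> l ((u + b) / 2)" using s assms clock_path_mono[of l s "(u + b) / 2"] by auto
        also have "\<dots> < t" using b(1) by (intro b(2)) auto
        finally show False using s by simp
      qed
    qed
    then show False using that b(1) by simp
  qed
qed

lemma path_inverse_nonneg:
  assumes "clock_path l" shows "0 \<le> path_inverse l t"
  unfolding path_inverse_def using assms
  by (intro cInf_greatest) (auto simp: clock_path_def)

lemma le_path_inverse: "clock_path l \<Longrightarrow> t \<le> l (path_inverse l t)"
  using path_inverse_le_iff[OF _ path_inverse_nonneg, of l l t t] by simp

lemma path_inverse_mono: "clock_path l \<Longrightarrow> s \<le> t \<Longrightarrow> path_inverse l s \<le> path_inverse l t"
  using path_inverse_le_iff[of l "path_inverse l t" s] path_inverse_nonneg[of l t] le_path_inverse[of l t]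
  by simp

text \<open>The lower bound rests on strict increase: a value of the inverse below \<open>u\<close>
  would put \<open>l\<close> strictly below \<open>l u\<close> there, against
  \<open>le_path_inverse\<close>.\<close>

lemma path_inverse_clock:
  assumes "clock_path l" "0 \<le> u" shows "path_inverse l (l u) = u"
proof (rule antisym)
  show "path_inverse l (l u) \<le> u" using path_inverse_le_iff[OF assms] by simp
  show "u \<le> path_inverse l (l u)"
  proof (rule ccontr)
    assume "\<not> u \<le> path_inverse l (l u)"
    then have "l (path_inverse l (l u)) < l u"
      using assms clock_path_less[of l] path_inverse_nonneg[of l] by simp
    with le_path_inverse[OF assms(1), of "l u"] show False by simp
  qed
qed

lemma path_inverse_0: "clock_path l \<Longrightarrow> path_inverse l 0 = 0"
  using path_inverse_clock[of l 0] by (simp add: clock_path_def)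

lemma less_path_inverse_iff: "clock_path l \<Longrightarrow> 0 \<le> u \<Longrightarrow> u < path_inverse l t \<longleftrightarrow> l u < t"
  using path_inverse_le_iff[of l u t] by auto

text \<open>A jump of the inverse would be a flat piece of \<open>l\<close>, which strict increase
  excludes. Both one-sided bounds come from the Galois connection, at the levels
  \<open>?u - e / 2\<close> and \<open>?u + e / 2\<close>.\<close>

lemma path_inverse_isCont:
  assumes l: "clock_path l"
  shows "isCont (path_inverse l) t"
  unfolding isCont_def
proof (rule LIM_I)
  fix e :: real assume e: "e > 0"
  let ?u = "path_inverse l t"
  note u = path_inverse_nonneg[OF l, of t]
  obtain c where c: "c < t" "\<And>v. c < v \<Longrightarrow> ?u - e < path_inverse l v"
  proof (cases "?u - e / 2 \<ge> 0")
    case True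
    have "l (?u - e / 2) < t" using less_path_inverse_iff[OF l True, of t] e by simp
    moreover have "?u - e < path_inverse l v" if "l (?u - e / 2) < v" for v
      using less_path_inverse_iff[OF l True, of v] that e by simp
    ultimately show ?thesis by (rule that)
  next
    case False
    \<comment> \<open>The level \<open>?u - e / 2\<close> is negative here, so nonnegativity of the
      inverse already gives the bound and any point left of \<open>t\<close> may serve as
      \<open>c\<close>.\<close>
    have "?u - e < path_inverse l v" for v using path_inverse_nonneg[OF l, of v] False e by simp
    then show ?thesis using that[of "t - 1"] by simp
  qed
  have up: "path_inverse l v \<le> ?u + e / 2" if "v \<le> l (?u + e / 2)" for v
    using path_inverse_le_iff[OF l, of "?u + e/2" v] that u e by simp
  have r: "t < l (?u + e / 2)"
    using le_path_inverse[OF l, of t] clock_path_less[OF l u, of "?u + e / 2"] e by simp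
  show "\<exists>s>0. \<forall>x. x \<noteq> t \<and> norm (x - t) < s \<longrightarrow> norm (path_inverse l x - ?u) < e"
  proof (intro exI[of _ "min (t - c) (l (?u + e / 2) - t)"] conjI allI impI)
    fix x assume "x \<noteq> t \<and> norm (x - t) < min (t - c) (l (?u + e / 2) - t)"
    then have "c < x" "x \<le> l (?u + e / 2)" unfolding real_norm_def by linarith+
    then show "norm (path_inverse l x - ?u) < e" using c(2)[of x] up[of x] e by simp
  qed (use c r in auto)
qed

lemma path_inverse_continuous_on: "clock_path l \<Longrightarrow> continuous_on A (path_inverse l)"
  by (intro continuous_at_imp_continuous_on ballI path_inverse_isCont)

section \<open>Exponential tails and almost sure path properties of stable subordinators\<close>

context prob_space
begin

text \<open>By convention the integral of a non-integrable function is \<open>0\<close>, whereas the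
  prescribed Laplace transform is positive.\<close>

lemma stable_subordinator_Laplace_integrable:
  assumes "stable_subordinator M \<alpha> L" "0 \<le> t" "0 \<le> s"
  shows "integrable M (\<lambda>\<omega>. exp (- s * L t \<omega>))"
proof (rule ccontr)
  assume "\<not> ?thesis"
  then have "integral\<^sup>L M (\<lambda>\<omega>. exp (- s * L t \<omega>)) = 0" by (rule not_integrable_integral_eq)
  moreover have "integral\<^sup>L M (\<lambda>\<omega>. exp (- s * L t \<omega>)) = exp (- t * s powr \<alpha>)"
    using assms unfolding stable_subordinator_def by blast
  ultimately show False by simp
qed

text \<open>Chernoff bound for the lower tail: the indicator of \<open>L t \<omega> \<le> c\<close>
  lies below \<open>exp (s * (c - L t \<omega>))\<close>.\<close>

lemma stable_subordinator_tail:
  assumes "stable_subordinator M \<alpha> L" "0 \<le> t" "0 \<le> s"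
  shows "prob {\<omega>\<in>space M. L t \<omega> \<le> c} \<le> exp (s * c) * exp (- t * s powr \<alpha>)"
proof -
  have [measurable]: "L t \<in> borel_measurable M"
    using assms unfolding stable_subordinator_def levy_process_def by blast
  have "prob {\<omega>\<in>space M. L t \<omega> \<le> c} = integral\<^sup>L M (indicator {\<omega>\<in>space M. L t \<omega> \<le> c})"
    by simp
  also have "\<dots> \<le> integral\<^sup>L M (\<lambda>\<omega>. exp (s * c) * exp (- s * L t \<omega>))"
  proof (intro integral_mono integrable_mult_right stable_subordinator_Laplace_integrable[OF assms])
    fix \<omega>
    show "indicator {\<omega>\<in>space M. L t \<omega> \<le> c} \<omega> \<le> exp (s * c) * exp (- s * L t \<omega>)"
      using assms(3) by (auto simp: indicator_def mult_exp_exp mult_left_mono)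
  qed (auto intro!: integrable_real_indicator simp: emeasure_eq_measure)
  also have "\<dots> = exp (s * c) * exp (- t * s powr \<alpha>)"
    using assms unfolding stable_subordinator_def by simp
  finally show ?thesis .
qed

text \<open>Stationarity moves the increment to the origin, where the Chernoff bound at
  \<open>c = 0\<close> tends to \<open>0\<close> as \<open>s\<close> grows.\<close>

lemma stable_subordinator_increment_pos:
  assumes L: "stable_subordinator M \<alpha> L" and "0 < \<alpha>" "0 \<le> p" "p < q"
  shows "AE \<omega> in M. L p \<omega> < L q \<omega>"
proof -
  have m [measurable]: "L t \<in> borel_measurable M" if "t \<ge> 0" for t
    using that L unfolding stable_subordinator_def levy_process_def by blast
  have pq: "p \<ge> 0" "q \<ge> 0" "q - p \<ge> 0" using assms by auto
  note [measurable] = m[OF pq(1)] m[OF pq(2)] m[OF pq(3)] m[OF order_refl]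
  have "distr M borel (\<lambda>\<omega>. L (p + (q - p)) \<omega> - L p \<omega>) = distr M borel (\<lambda>\<omega>. L (q - p) \<omega> - L 0 \<omega>)"
    using L pq unfolding stable_subordinator_def levy_process_def stationary_increments_def by blast
  then have "measure (distr M borel (\<lambda>\<omega>. L q \<omega> - L p \<omega>)) {..0} = measure (distr M borel (\<lambda>\<omega>. L (q - p) \<omega> - L 0 \<omega>)) {..0}"
    by simp
  then have "prob {\<omega>\<in>space M. L q \<omega> - L p \<omega> \<le> 0} = prob {\<omega>\<in>space M. L (q - p) \<omega> - L 0 \<omega> \<le> 0}"
    by (simp add: measure_distr vimage_def Int_def conj_commute)
  also have "\<dots> = prob {\<omega>\<in>space M. L (q - p) \<omega> \<le> 0}"
  proof (rule finite_measure_eq_AE)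
    have "AE \<omega> in M. L 0 \<omega> = 0"
      using L unfolding stable_subordinator_def levy_process_def by auto
    then show "AE \<omega> in M. \<omega> \<in> {\<omega>\<in>space M. L (q - p) \<omega> - L 0 \<omega> \<le> 0} \<longleftrightarrow> \<omega> \<in> {\<omega>\<in>space M. L (q - p) \<omega> \<le> 0}"
      by eventually_elim auto
  qed measurable
  also have "\<dots> \<le> 0"
  proof (rule LIMSEQ_le_const)
    show "(\<lambda>n. exp (- (q - p) * real n)) \<longlonglongrightarrow> 0"
    proof -
      have "(\<lambda>n. exp (- (q - p)) ^ n) \<longlonglongrightarrow> 0" using assms by (intro LIMSEQ_power_zero) auto
      then show ?thesis by (simp add: exp_of_nat_mult[symmetric] mult.commute)
    qed
    \<comment> \<open>With \<open>s = real n powr (1 / \<alpha>)\<close> the exponent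
      \<open>s powr \<alpha>\<close> is exactly \<open>n\<close>.\<close>
    have "prob {\<omega>\<in>space M. L (q - p) \<omega> \<le> 0} \<le> exp (- (q - p) * real n)" for n
      using stable_subordinator_tail[OF L pq(3), of "real n powr (1 / \<alpha>)" 0] assms(2)
      by (simp add: powr_powr)
    then show "\<exists>N. \<forall>n\<ge>N. prob {\<omega>\<in>space M. L (q - p) \<omega> \<le> 0} \<le> exp (- (q - p) * real n)" by blast
  qed
  finally have "prob {\<omega>\<in>space M. L q \<omega> - L p \<omega> \<le> 0} = 0" by (simp add: antisym)
  then have "AE \<omega> in M. \<omega> \<notin> {\<omega>\<in>space M. L q \<omega> - L p \<omega> \<le> 0}"
    by (subst (asm) prob_eq_0) measurable
  then show ?thesis by (auto elim!: eventually_mono AE_mp)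
qed

text \<open>The Chernoff bound at \<open>s = 1\<close> decays like \<open>exp (- n)\<close> at time
  \<open>n\<close>, so a path stays below \<open>c\<close> at all integer times with probability
  zero.\<close>

lemma stable_subordinator_unbounded:
  assumes L: "stable_subordinator M \<alpha> L"
  shows "AE \<omega> in M. \<exists>n::nat. c < L (real n) \<omega>"
proof -
  have [measurable]: "L (real n) \<in> borel_measurable M" for n
    using L unfolding stable_subordinator_def levy_process_def by simp
  have "prob {\<omega>\<in>space M. \<forall>n::nat. L (real n) \<omega> \<le> c} \<le> 0"
  proof (rule LIMSEQ_le_const)
    have "(\<lambda>n. exp c * exp (- 1) ^ n) \<longlonglongrightarrow> exp c * 0"
      by (intro tendsto_mult_left LIMSEQ_power_zero) auto
    then show "(\<lambda>n. exp c * exp (- real n)) \<longlonglongrightarrow> 0" by (simp add: exp_of_nat_mult[symmetric])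
    have "prob {\<omega>\<in>space M. \<forall>n::nat. L (real n) \<omega> \<le> c} \<le> exp c * exp (- real n)" for n
    proof -
      have "prob {\<omega>\<in>space M. \<forall>n::nat. L (real n) \<omega> \<le> c} \<le> prob {\<omega>\<in>space M. L (real n) \<omega> \<le> c}"
        by (rule finite_measure_mono) auto
      also have "\<dots> \<le> exp c * exp (- real n)" using stable_subordinator_tail[OF L, of "real n" 1 c] by simp
      finally show ?thesis .
    qed
    then show "\<exists>N. \<forall>n\<ge>N. prob {\<omega>\<in>space M. \<forall>n::nat. L (real n) \<omega> \<le> c} \<le> exp c * exp (- real n)" by blast
  qed
  then have "prob {\<omega>\<in>space M. \<forall>n::nat. L (real n) \<omega> \<le> c} = 0" by (simp add: antisym)
  then have "AE \<omega> in M. \<omega> \<notin> {\<omega>\<in>space M. \<forall>n::nat. L (real n) \<omega> \<le> c}"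
    by (subst (asm) prob_eq_0) measurable
  moreover have "AE \<omega> in M. \<omega> \<in> space M" by simp
  ultimately show ?thesis by eventually_elim (auto simp: not_le)
qed

text \<open>Almost sure statements combine only countably often, so strict increase is first
  obtained at rational times. Monotonicity of the paths carries it to real times, through two
  rationals strictly between them.\<close>

lemma stable_subordinator_clock_path:
  assumes L: "stable_subordinator M \<alpha> L" and \<alpha>: "0 < \<alpha>"
  shows "AE \<omega> in M. clock_path (\<lambda>t. L t \<omega>)"
proof -
  have "AE \<omega> in M. \<forall>p q. p \<ge> 0 \<longrightarrow> p < q \<longrightarrow> L (real_of_rat p) \<omega> < L (real_of_rat q) \<omega>"
    unfolding AE_all_countable
    using stable_subordinator_increment_pos[OF L \<alpha>] by (auto simp: of_rat_less)
  moreover have "AE \<omega> in M. \<forall>m::nat. \<exists>n::nat. real m < L (real n) \<omega>"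
    unfolding AE_all_countable using stable_subordinator_unbounded[OF L] by blast
  moreover have "AE \<omega> in M. L 0 \<omega> = 0 \<and> cadlag_path (\<lambda>t. L t \<omega>)" "AE \<omega> in M. mono_on {0..} (\<lambda>t. L t \<omega>)"
    using L unfolding stable_subordinator_def levy_process_def by auto
  ultimately show ?thesis
  proof eventually_elim
    case (elim \<omega>)
    have "L a \<omega> < L b \<omega>" if ab: "0 \<le> a" "a < b" for a b
    proof -
      obtain p where p: "a < real_of_rat p" "real_of_rat p < b" using of_rat_dense[OF ab(2)] by blast
      obtain q where q: "real_of_rat p < real_of_rat q" "real_of_rat q < b" using of_rat_dense[OF p(2)] by blast
      have "0 < real_of_rat p" using p ab by linarith
      then have "0 \<le> p" "p < q" using q by (simp_all add: of_rat_less)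
      have "L a \<omega> \<le> L (real_of_rat p) \<omega>" using mono_onD[OF elim(4), of a "real_of_rat p"] ab p \<open>0 \<le> p\<close> by simp
      also have "\<dots> < L (real_of_rat q) \<omega>" using elim(1) \<open>0 \<le> p\<close> \<open>p < q\<close> by blast
      also have "\<dots> \<le> L b \<omega>" using mono_onD[OF elim(4), of "real_of_rat q" b] ab q \<open>0 \<le> p\<close> \<open>p < q\<close> by simp
      finally show ?thesis .
    qed
    moreover have "\<exists>t\<ge>0. c \<le> L t \<omega>" for c
    proof -
      obtain m :: nat where "c < real m" using reals_Archimedean2 by blast
      moreover obtain n :: nat where "real m < L (real n) \<omega>" using elim(2) by blast
      ultimately show ?thesis by (intro exI[of _ "real n"]) auto
    qed
    ultimately show ?case
      using elim(3) unfolding clock_path_def cadlag_path_def by (auto intro!: strict_mono_onI)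
  qed
qed

text \<open>The ceiling of \<open>Y\<close> counts the integers \<open>n\<close> with
  \<open>real n < Y\<close>, which means \<open>L n < t\<close>. The mean is therefore bounded by a
  sum of lower tails of \<open>L\<close>, and this sum is geometric.\<close>

lemma inverse_subordinator_integrable:
  assumes L: "stable_subordinator M \<alpha> L" and \<alpha>: "0 < \<alpha>" and "0 < t"
    and [measurable]: "inverse_subordinator L t \<in> borel_measurable M"
  shows "integrable M (inverse_subordinator L t)"
proof (rule integrableI_nonneg)
  define Y where "Y = inverse_subordinator L t"
  have mY [measurable]: "Y \<in> borel_measurable M" by (simp add: Y_def)
  note clock = stable_subordinator_clock_path[OF L \<alpha>]
  show "AE \<omega> in M. 0 \<le> inverse_subordinator L t \<omega>"
    using clock by eventually_elim (simp add: inverse_subordinator_eq path_inverse_nonneg)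
  have [measurable]: "L (real n) \<in> borel_measurable M" for n
    using L unfolding stable_subordinator_def levy_process_def by simp
  \<comment> \<open>The tail bound at \<open>s = 1 / t\<close> has the prefactor
    \<open>exp 1\<close>, and \<open>r\<close> is its ratio from \<open>n\<close> to
    \<open>Suc n\<close>.\<close>
  define r where "r = exp (- ((1 / t) powr \<alpha>))"
  have r: "0 \<le> r" "r < 1" using \<open>0 < t\<close> by (auto simp: r_def)
  have "(\<integral>\<^sup>+\<omega>. ennreal (Y \<omega>) \<partial>M) \<le> (\<integral>\<^sup>+\<omega>. (\<Sum>n. indicator {\<omega>\<in>space M. L (real n) \<omega> \<le> t} \<omega>) \<partial>M)"
  proof (rule nn_integral_mono_AE)
    show "AE \<omega> in M. ennreal (Y \<omega>) \<le> (\<Sum>n. indicator {\<omega>\<in>space M. L (real n) \<omega> \<le> t} \<omega>)"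
      using clock AE_space
    proof eventually_elim
      case (elim \<omega>)
      let ?K = "nat \<lceil>Y \<omega>\<rceil>"
      have "ennreal (Y \<omega>) \<le> ennreal (real ?K)" by (intro ennreal_leI) linarith
      also have "\<dots> = (\<Sum>n<?K. 1)" by (simp add: ennreal_of_nat_eq_real_of_nat)
      also have "\<dots> \<le> (\<Sum>n<?K. indicator {\<omega>\<in>space M. L (real n) \<omega> \<le> t} \<omega>)"
      proof (rule sum_mono)
        fix n assume "n \<in> {..<?K}"
        then have "real n < Y \<omega>" by simp linarith
        then show "1 \<le> (indicator {\<omega>\<in>space M. L (real n) \<omega> \<le> t} \<omega> :: ennreal)"
          using elim less_path_inverse_iff[OF elim(1), of "real n" t]
          by (simp add: Y_def inverse_subordinator_eq)
      qed
      also have "\<dots> \<le> (\<Sum>n. indicator {\<omega>\<in>space M. L (real n) \<omega> \<le> t} \<omega>)"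
        by (rule sum_le_suminf) auto
      finally show ?case .
    qed
  qed
  also have "\<dots> = (\<Sum>n. emeasure M {\<omega>\<in>space M. L (real n) \<omega> \<le> t})"
    by (subst nn_integral_suminf) auto
  also have "\<dots> \<le> (\<Sum>n. ennreal (exp 1 * r ^ n))"
  proof (intro suminf_le)
    fix n
    have "prob {\<omega>\<in>space M. L (real n) \<omega> \<le> t} \<le> exp 1 * r ^ n"
      using stable_subordinator_tail[OF L, of "real n" "1 / t" t] \<open>0 < t\<close>
      by (simp add: r_def exp_of_nat_mult[symmetric])
    then show "emeasure M {\<omega>\<in>space M. L (real n) \<omega> \<le> t} \<le> ennreal (exp 1 * r ^ n)"
      by (simp add: emeasure_eq_measure ennreal_leI)
  qed auto
  also have "\<dots> = ennreal (\<Sum>n. exp 1 * r ^ n)"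
    using r by (intro suminf_ennreal2 summable_mult summable_geometric) auto
  also have "\<dots> < \<infinity>" by simp
  finally show "(\<integral>\<^sup>+\<omega>. ennreal (inverse_subordinator L t \<omega>) \<partial>M) < \<infinity>" by (simp add: Y_def)
qed simp

end

section \<open>Mixed Poisson laws\<close>

text \<open>Identity theorem from one side only, since generating functions are available for
  \<open>z\<close> in \<open>[0, 1)\<close>. Once the coefficients below \<open>m\<close> vanish,
  the series may be divided by \<open>z ^ m\<close>, and continuity at \<open>0\<close> isolates
  \<open>d m\<close>.\<close>

lemma power_series_zero_right:
  fixes d :: "nat \<Rightarrow> real"
  assumes "\<And>z. 0 \<le> z \<Longrightarrow> z < 1 \<Longrightarrow> (\<lambda>k. d k * z ^ k) sums 0"
  shows "d m = 0"
proof (induction m rule: less_induct)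
  case (less m)
  let ?g = "\<lambda>z. \<Sum>k. d (k + m) * z ^ k"
  have sh: "(\<lambda>k. d (k + m) * z ^ k) sums 0" if z: "0 < z" "z < 1" for z
  proof -
    have "(\<lambda>k. d (k + m) * z ^ (k + m)) sums (0 - (\<Sum>k<m. d k * z ^ k))"
      using assms[of z] z by (intro sums_split_initial_segment) auto
    then have "(\<lambda>k. d (k + m) * z ^ (k + m) / z ^ m) sums (0 / z ^ m)"
      using less by (intro sums_divide) simp
    then show ?thesis using z by (simp add: power_add field_simps)
  qed
  have "isCont ?g 0"
    by (rule isCont_powser[of _ "1/2"]) (use sh[of "1/2"] in \<open>auto dest: sums_summable\<close>)
  then have "(?g \<longlongrightarrow> ?g 0) (at_right 0)"
    by (auto simp: isCont_def intro: tendsto_within_subset)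
  moreover have "(?g \<longlongrightarrow> 0) (at_right 0)"
  proof (rule tendsto_eventually)
    have "\<forall>\<^sub>F z :: real in at_right 0. z \<in> {0<..<1}"
      by (rule eventually_at_right_real) simp
    then show "\<forall>\<^sub>F z in at_right 0. ?g z = 0"
      by eventually_elim (simp add: sums_unique[OF sh, symmetric])
  qed
  ultimately have "?g 0 = 0" by (intro tendsto_unique) auto
  then show ?case by simp
qed

lemma measurable_nat_binop:
  fixes f g :: "'a \<Rightarrow> nat" and h :: "nat \<Rightarrow> nat \<Rightarrow> 'b"
  assumes "f \<in> measurable M (count_space UNIV)" "g \<in> measurable M (count_space UNIV)" "space N = UNIV"
  shows "(\<lambda>\<omega>. h (f \<omega>) (g \<omega>)) \<in> measurable M N"
proof (rule measurable_compose_countable[OF _ assms(1), of "\<lambda>i \<omega>. h i (g \<omega>)"])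
  fix i show "(\<lambda>\<omega>. h i (g \<omega>)) \<in> measurable M N"
    by (rule measurable_compose[OF assms(2)]) (use assms(3) in auto)
qed

lemma measurable_nat_diff:
  fixes f g :: "'a \<Rightarrow> nat"
  assumes "f \<in> measurable M (count_space UNIV)" "g \<in> measurable M (count_space UNIV)"
  shows "(\<lambda>\<omega>. f \<omega> - g \<omega>) \<in> measurable M (count_space UNIV)"
  by (rule measurable_nat_binop[OF assms]) simp

lemma measurable_nat_list:
  fixes f :: "'b \<Rightarrow> 'a \<Rightarrow> nat"
  assumes "\<And>r. r \<in> set rs \<Longrightarrow> f r \<in> measurable M (count_space UNIV)"
  shows "(\<lambda>\<omega>. map (\<lambda>r. f r \<omega>) rs) \<in> measurable M (count_space UNIV)"
  using assms
proof (induction rs)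
  case (Cons r rs)
  have "(\<lambda>\<omega>. f r \<omega> # map (\<lambda>r. f r \<omega>) rs) \<in> measurable M (count_space UNIV)"
  proof (rule measurable_compose_countable[where g="f r" and f="\<lambda>i \<omega>. i # map (\<lambda>r. f r \<omega>) rs"])
    show "(\<lambda>\<omega>. i # map (\<lambda>r. f r \<omega>) rs) \<in> measurable M (count_space UNIV)" for i
      by (rule measurable_compose[OF Cons.IH]) (use Cons.prems in auto)
  qed (use Cons.prems in auto)
  then show ?case by simp
qed simp

lemma (in finite_measure) integrable_unit_mult:
  fixes f g :: "'a \<Rightarrow> real"
  assumes "integrable M f" "g \<in> borel_measurable M" "\<And>\<omega>. 0 \<le> g \<omega>" "\<And>\<omega>. g \<omega> \<le> 1"
  shows "integrable M (\<lambda>\<omega>. g \<omega> * f \<omega>)"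
proof (rule Bochner_Integration.integrable_bound[OF assms(1)])
  show "(\<lambda>\<omega>. g \<omega> * f \<omega>) \<in> borel_measurable M" using assms by measurable
  show "AE \<omega> in M. norm (g \<omega> * f \<omega>) \<le> norm (f \<omega>)"
    using assms(3,4) by (auto simp: abs_mult intro!: mult_left_le_one_le)
qed

lemma (in finite_measure) integrable_unit:
  fixes g :: "'a \<Rightarrow> real"
  assumes "g \<in> borel_measurable M" "\<And>\<omega>. 0 \<le> g \<omega>" "\<And>\<omega>. g \<omega> \<le> 1"
  shows "integrable M g"
  using integrable_unit_mult[OF _ assms, of "\<lambda>_. 1"] by simp

lemma (in prob_space) sums_expectation:
  fixes f :: "nat \<Rightarrow> 'a \<Rightarrow> real"
  assumes [measurable]: "\<And>k. f k \<in> borel_measurable M"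
    and bd: "\<And>n \<omega>. (\<Sum>k<n. \<bar>f k \<omega>\<bar>) \<le> 1"
  shows "(\<lambda>k. expectation (f k)) sums expectation (\<lambda>\<omega>. \<Sum>k. f k \<omega>)"
proof -
  have sm: "summable (\<lambda>k. f k \<omega>)" for \<omega>
    by (rule summable_rabs_cancel, rule summableI_nonneg_bounded[of _ 1]) (use bd in auto)
  have int: "integrable M (f k)" for k
  proof (rule integrable_const_bound[of _ 1])
    have "\<bar>f k \<omega>\<bar> \<le> 1" for \<omega>
      by (rule order_trans[OF member_le_sum[of k "{..<Suc k}" "\<lambda>k. \<bar>f k \<omega>\<bar>"] bd]) auto
    then show "AE \<omega> in M. norm (f k \<omega>) \<le> 1" by simp
  qed measurable
  have "(\<lambda>n. expectation (\<lambda>\<omega>. \<Sum>k<n. f k \<omega>)) \<longlonglongrightarrow> expectation (\<lambda>\<omega>. \<Sum>k. f k \<omega>)"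
  proof (rule integral_dominated_convergence[where w="\<lambda>_. 1"])
    show "AE \<omega> in M. (\<lambda>n. \<Sum>k<n. f k \<omega>) \<longlonglongrightarrow> (\<Sum>k. f k \<omega>)"
      using sm by (auto intro: summable_LIMSEQ)
    show "AE \<omega> in M. norm (\<Sum>k<n. f k \<omega>) \<le> 1" for n
      by (auto intro!: order_trans[OF sum_abs bd])
  qed auto
  then show ?thesis unfolding sums_def by (subst (asm) Bochner_Integration.integral_sum) (use int in auto)
qed

text \<open>Clipping the parameter keeps the weight in \<open>[0, 1]\<close> and continuous for every real argument.\<close>

definition poisson_weight :: "nat set \<Rightarrow> real \<Rightarrow> real" where
  "poisson_weight A \<mu> = exp (- max 0 \<mu>) * (\<Sum>k. indicator A k / fact k * max 0 \<mu> ^ k)"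

lemma poisson_series_summable:
  fixes m :: real assumes "\<And>k. \<bar>c k\<bar> \<le> 1"
  shows "summable (\<lambda>k. c k / fact k * m ^ k)"
proof (rule summable_comparison_test')
  show "summable (\<lambda>k. \<bar>m\<bar> ^ k / fact k)"
    using summable_exp[of "\<bar>m\<bar>"] by (simp add: divide_inverse mult.commute)
  fix k
  have "\<bar>c k\<bar> * \<bar>m ^ k\<bar> \<le> 1 * \<bar>m ^ k\<bar>" by (rule mult_right_mono) (use assms in auto)
  then show "norm (c k / fact k * m ^ k) \<le> \<bar>m\<bar> ^ k / fact k"
    by (simp add: abs_mult power_abs divide_right_mono)
qed

lemma poisson_partial_sum_le:
  assumes "0 \<le> (m :: real)"
  shows "(\<Sum>k<n. exp (- m) * (m ^ k / fact k)) \<le> 1"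
proof -
  have "(\<Sum>k<n. m ^ k / fact k) \<le> (\<Sum>k. m ^ k / fact k)"
    using assms poisson_series_summable[of "\<lambda>_. 1" m] by (intro sum_le_suminf) auto
  also have "\<dots> = exp m" by (simp add: exp_def divide_inverse mult.commute)
  finally have "exp (- m) * (\<Sum>k<n. m ^ k / fact k) \<le> exp (- m) * exp m" by (intro mult_left_mono) auto
  then show ?thesis by (simp add: sum_distrib_left exp_minus)
qed

lemma poisson_weight_isCont: "isCont (poisson_weight A) \<mu>"
proof -
  have "isCont (\<lambda>m :: real. \<Sum>k. indicator A k / fact k * m ^ k) m" for m
    by (intro isCont_powser_converges_everywhere poisson_series_summable) simp
  then have "isCont (\<lambda>\<mu> :: real. \<Sum>k. indicator A k / fact k * max 0 \<mu> ^ k) \<mu>"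
    by (rule isCont_o2[rotated]) (auto intro!: continuous_intros)
  then show ?thesis unfolding poisson_weight_def by (intro continuous_intros) auto
qed

lemma poisson_weight_measurable [measurable]: "poisson_weight A \<in> borel_measurable borel"
  by (intro borel_measurable_continuous_onI continuous_at_imp_continuous_on ballI poisson_weight_isCont)

lemma poisson_weight_UNIV: "poisson_weight UNIV \<mu> = 1"
proof -
  have "(\<Sum>k. (max 0 \<mu>) ^ k / fact k) = exp (max 0 \<mu>)"
    by (simp add: exp_def divide_inverse mult.commute)
  then show ?thesis by (simp add: poisson_weight_def exp_minus)
qed

lemma poisson_weight_bounds: "0 \<le> poisson_weight A \<mu>" "poisson_weight A \<mu> \<le> 1"
proof -
  let ?f = "\<lambda>A k. indicator A k / fact k * max 0 \<mu> ^ k"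
  have sm: "summable (?f A)" for A :: "nat set" by (rule poisson_series_summable) auto
  show "0 \<le> poisson_weight A \<mu>"
    unfolding poisson_weight_def by (intro mult_nonneg_nonneg suminf_nonneg sm) auto
  have "poisson_weight A \<mu> \<le> poisson_weight UNIV \<mu>"
    unfolding poisson_weight_def
    by (intro mult_left_mono suminf_le sm) (auto intro!: mult_right_mono divide_right_mono simp: indicator_def)
  then show "poisson_weight A \<mu> \<le> 1" by (simp add: poisson_weight_UNIV)
qed

lemma poisson_weight_singleton:
  assumes "0 \<le> \<mu>"
  shows "poisson_weight {k} \<mu> = \<mu> ^ k / fact k * exp (- \<mu>)"
proof -
  have "(\<Sum>j. indicator {k} j / fact j * \<mu> ^ j) = (\<Sum>j\<in>{k}. indicator {k} j / fact j * \<mu> ^ j)"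
    by (rule suminf_finite) auto
  then show ?thesis using assms by (simp add: poisson_weight_def max_def)
qed

context prob_space
begin

text \<open>Both sides of \<open>pgf\<close> are power series in \<open>z\<close>, with coefficients
  \<open>a k\<close> and \<open>b k\<close>. Uniqueness gives \<open>a = b\<close>, and summing over
  \<open>k\<close> in \<open>A\<close> gives the claim. The weight \<open>\<phi>\<close> plays the
  role of conditioning.\<close>

lemma mixed_poisson_of_pgf:
  fixes K :: "'a \<Rightarrow> nat" and \<mu> \<phi> :: "'a \<Rightarrow> real"
  assumes K [measurable]: "K \<in> measurable M (count_space UNIV)"
    and [measurable]: "\<mu> \<in> borel_measurable M" "\<phi> \<in> borel_measurable M"
    and \<phi>: "\<And>\<omega>. 0 \<le> \<phi> \<omega>" "\<And>\<omega>. \<phi> \<omega> \<le> 1"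
    and pgf: "\<And>z. 0 \<le> z \<Longrightarrow> z < 1 \<Longrightarrow>
      expectation (\<lambda>\<omega>. \<phi> \<omega> * z ^ K \<omega>) = expectation (\<lambda>\<omega>. \<phi> \<omega> * exp (- ((1 - z) * max 0 (\<mu> \<omega>))))"
  shows "expectation (\<lambda>\<omega>. \<phi> \<omega> * indicator A (K \<omega>)) = expectation (\<lambda>\<omega>. \<phi> \<omega> * poisson_weight A (\<mu> \<omega>))"
proof -
  define m where "m \<omega> = max 0 (\<mu> \<omega>)" for \<omega>
  have m0: "0 \<le> m \<omega>" for \<omega> by (simp add: m_def)
  have [measurable]: "m \<in> borel_measurable M" unfolding m_def by measurable
  define a where "a k = expectation (\<lambda>\<omega>. \<phi> \<omega> * indicator {k} (K \<omega>))" for k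
  define b where "b k = expectation (\<lambda>\<omega>. \<phi> \<omega> * (exp (- m \<omega>) * (m \<omega> ^ k / fact k)))" for k
  \<comment> \<open>The bounded coefficients \<open>c\<close> are left free because two choices
    occur: \<open>c k = z ^ k\<close> for the generating functions, and the indicator of
    \<open>A\<close> for the conclusion.\<close>
  have A: "(\<lambda>k. c k * a k) sums expectation (\<lambda>\<omega>. \<phi> \<omega> * c (K \<omega>))" if c: "\<And>k. \<bar>c k\<bar> \<le> 1" for c :: "nat \<Rightarrow> real"
  proof -
    have "(\<lambda>k. expectation (\<lambda>\<omega>. c k * (\<phi> \<omega> * indicator {k} (K \<omega>)))) sums
        expectation (\<lambda>\<omega>. \<Sum>k. c k * (\<phi> \<omega> * indicator {k} (K \<omega>)))"
    proof (rule sums_expectation)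
      fix n \<omega>
      have "(\<Sum>k<n. \<bar>c k * (\<phi> \<omega> * indicator {k} (K \<omega>))\<bar>) \<le> (\<Sum>k<n. indicator {K \<omega>} k)"
      proof (rule sum_mono)
        fix k
        have "\<bar>c k\<bar> * \<bar>\<phi> \<omega>\<bar> \<le> 1 * 1" by (rule mult_mono) (use c \<phi> in auto)
        then show "\<bar>c k * (\<phi> \<omega> * indicator {k} (K \<omega>))\<bar> \<le> indicator {K \<omega>} k"
          by (auto simp: abs_mult indicator_def)
      qed
      also have "\<dots> \<le> 1" using card_mono[of "{K \<omega>}" "{..<n} \<inter> {K \<omega>}"] by (simp add: indicator_def)
      finally show "(\<Sum>k<n. \<bar>c k * (\<phi> \<omega> * indicator {k} (K \<omega>))\<bar>) \<le> 1" .
    qed (intro borel_measurable_times borel_measurable_const measurable_compose[OF K], measurable)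
    moreover have "(\<Sum>k. c k * (\<phi> \<omega> * indicator {k} (K \<omega>))) = \<phi> \<omega> * c (K \<omega>)" for \<omega>
      by (subst suminf_finite[of "{K \<omega>}"]) (auto simp: indicator_def)
    ultimately show ?thesis by (simp add: a_def)
  qed
  have B: "(\<lambda>k. c k * b k) sums expectation (\<lambda>\<omega>. \<phi> \<omega> * (exp (- m \<omega>) * (\<Sum>k. c k / fact k * m \<omega> ^ k)))"
    if c: "\<And>k. \<bar>c k\<bar> \<le> 1" for c :: "nat \<Rightarrow> real"
  proof -
    let ?f = "\<lambda>k \<omega>. c k * (\<phi> \<omega> * (exp (- m \<omega>) * (m \<omega> ^ k / fact k)))"
    have "(\<lambda>k. expectation (?f k)) sums expectation (\<lambda>\<omega>. \<Sum>k. ?f k \<omega>)"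
    proof (rule sums_expectation)
      fix n \<omega>
      have "(\<Sum>k<n. \<bar>?f k \<omega>\<bar>) \<le> (\<Sum>k<n. exp (- m \<omega>) * (m \<omega> ^ k / fact k))"
      proof (rule sum_mono)
        fix k
        have "\<bar>c k\<bar> * \<bar>\<phi> \<omega>\<bar> \<le> 1 * 1" by (rule mult_mono) (use c \<phi> in auto)
        then have "(\<bar>c k\<bar> * \<bar>\<phi> \<omega>\<bar>) * (exp (- m \<omega>) * (m \<omega> ^ k / fact k)) \<le> 1 * (exp (- m \<omega>) * (m \<omega> ^ k / fact k))"
          using m0 by (intro mult_right_mono) auto
        then show "\<bar>?f k \<omega>\<bar> \<le> exp (- m \<omega>) * (m \<omega> ^ k / fact k)"
          using m0[of \<omega>] by (simp add: abs_mult mult.assoc)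
      qed
      also have "\<dots> \<le> 1" using m0 by (rule poisson_partial_sum_le)
      finally show "(\<Sum>k<n. \<bar>?f k \<omega>\<bar>) \<le> 1" .
    qed measurable
    moreover have "(\<Sum>k. ?f k \<omega>) = \<phi> \<omega> * (exp (- m \<omega>) * (\<Sum>k. c k / fact k * m \<omega> ^ k))" for \<omega>
      using suminf_mult[OF poisson_series_summable[where c=c and m="m \<omega>", OF c], of "\<phi> \<omega> * exp (- m \<omega>)"]
      by (simp add: ac_simps)
    ultimately show ?thesis by (simp add: b_def)
  qed
  have "a k - b k = 0" for k
  proof (rule power_series_zero_right)
    fix z :: real assume z: "0 \<le> z" "z < 1"
    then have c: "\<bar>z ^ k\<bar> \<le> 1" for k by (simp add: power_le_one)
    have e: "exp (- m \<omega>) * (\<Sum>k. z ^ k / fact k * m \<omega> ^ k) = exp (- ((1 - z) * m \<omega>))" for \<omega>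
    proof -
      have "(\<Sum>k. z ^ k / fact k * m \<omega> ^ k) = exp (z * m \<omega>)"
        by (simp add: exp_def divide_inverse power_mult_distrib ac_simps)
      then show ?thesis by (simp add: mult_exp_exp algebra_simps)
    qed
    have "(\<lambda>k. z ^ k * a k - z ^ k * b k) sums
      (expectation (\<lambda>\<omega>. \<phi> \<omega> * z ^ K \<omega>) - expectation (\<lambda>\<omega>. \<phi> \<omega> * exp (- ((1 - z) * m \<omega>))))"
      using sums_diff[OF A[of "\<lambda>k. z ^ k", OF c] B[of "\<lambda>k. z ^ k", OF c]] by (simp only: e)
    also have "expectation (\<lambda>\<omega>. \<phi> \<omega> * z ^ K \<omega>) - expectation (\<lambda>\<omega>. \<phi> \<omega> * exp (- ((1 - z) * m \<omega>))) = 0"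
      using pgf[OF z] by (simp add: m_def)
    finally show "(\<lambda>k. (a k - b k) * z ^ k) sums 0" by (simp add: algebra_simps)
  qed
  then have "b = a" by auto
  have c: "\<bar>indicator A k :: real\<bar> \<le> 1" for k by simp
  show ?thesis
    using sums_unique2[OF A[of "indicator A", OF c] B[of "indicator A", OF c, unfolded \<open>b = a\<close>]] by (simp add: poisson_weight_def m_def)
qed

end

section \<open>Point processes compensated by a clock\<close>

text \<open>The compensated increments in the second sum are centred, the errors in the first vanish with the mesh.\<close>

lemma grid_telescope:
  fixes x :: "real \<Rightarrow> nat" and y :: "real \<Rightarrow> real" and s t z lam :: real and n :: nat
  assumes x: "mono_on {0..} x" and y: "mono_on {0..} y" and st: "0 \<le> s" "s \<le> t"
  defines "g \<equiv> grid s t n"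
  defines "V \<equiv> \<lambda>i. z ^ (x (g i) - x s) * exp (- (lam * (1 - z) * max 0 (y t - y (g (Suc i)))))"
  shows "z ^ (x t - x s) - exp (- (lam * (1 - z) * max 0 (y t - y s))) =
    (\<Sum>i<Suc n. V i * (pgf_error z (x (g (Suc i)) - x (g i)) - exp_error (lam * (1 - z) * (y (g (Suc i)) - y (g i))))) -
    (\<Sum>i<Suc n. V i * ((1 - z) * ((real (x (g (Suc i))) - real (x (g i))) - lam * (y (g (Suc i)) - y (g i)))))"
proof -
  define c where "c = lam * (1 - z)"
  \<comment> \<open>\<open>U i\<close> uses the actual path up to \<open>g i\<close> and the Poisson
    prediction from \<open>g i\<close> to \<open>t\<close>; its end values are the two terms on the
    left-hand side.\<close>
  define U where "U i = z ^ (x (g i) - x s) * exp (- (c * (y t - y (g i))))" for i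
  have g: "s \<le> g i" "g i \<le> t" if "i \<le> Suc n" for i
    unfolding g_def using grid_bounds[OF st(2) that] by auto
  have gm: "g i \<le> g (Suc i)" for i unfolding g_def by (rule grid_mono) (use st in auto)
  have step: "U (Suc i) - U i = V i * (pgf_error z (x (g (Suc i)) - x (g i)) - exp_error (c * (y (g (Suc i)) - y (g i))))
      - V i * ((1 - z) * ((real (x (g (Suc i))) - real (x (g i))) - lam * (y (g (Suc i)) - y (g i))))"
    if i: "i < Suc n" for i
  proof -
    have x1: "x s \<le> x (g i)" using g[of i] i st by (intro mono_onD[OF x]) auto
    have x2: "x (g i) \<le> x (g (Suc i))" using g[of i] i st gm[of i] by (intro mono_onD[OF x]) auto
    have y1: "y (g (Suc i)) \<le> y t" using g[of "Suc i"] i st by (intro mono_onD[OF y]) auto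
    define a where "a = x (g i) - x s"
    define k where "k = x (g (Suc i)) - x (g i)"
    define u where "u = c * (y t - y (g (Suc i)))"
    define v where "v = c * (y (g (Suc i)) - y (g i))"
    have k: "real (x (g (Suc i))) - real (x (g i)) = real k" using x2 by (simp add: k_def)
    have "x (g (Suc i)) - x s = a + k" using x1 x2 by (simp add: a_def k_def)
    then have U1: "U (Suc i) = z ^ a * exp (- u) * z ^ k" by (simp add: U_def u_def power_add)
    have "c * (y t - y (g i)) = u + v" by (simp add: u_def v_def algebra_simps)
    then have U0: "U i = z ^ a * exp (- u) * exp (- v)" by (simp add: U_def a_def mult_exp_exp)
    have V: "V i = z ^ a * exp (- u)" using y1 by (simp add: V_def a_def u_def c_def)
    have v: "(1 - z) * (real k - lam * (y (g (Suc i)) - y (g i))) = (1 - z) * real k - v"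
      by (simp add: v_def c_def algebra_simps)
    show ?thesis
      unfolding k v U1 U0 V k_def[symmetric] v_def[symmetric] pgf_error_def exp_error_def
      by (simp add: algebra_simps)
  qed
  have "y s \<le> y t" using st by (intro mono_onD[OF y]) auto
  then have "z ^ (x t - x s) - exp (- (c * max 0 (y t - y s))) = U (Suc n) - U 0"
    by (simp add: U_def g_def)
  also have "\<dots> = (\<Sum>i<Suc n. U (Suc i) - U i)" by (rule sum_lessThan_telescope[symmetric])
  also have "\<dots> = (\<Sum>i<Suc n. V i * (pgf_error z (x (g (Suc i)) - x (g i)) - exp_error (c * (y (g (Suc i)) - y (g i))))
      - V i * ((1 - z) * ((real (x (g (Suc i))) - real (x (g i))) - lam * (y (g (Suc i)) - y (g i)))))"
    using step by (intro sum.cong) auto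
  finally show ?thesis unfolding c_def sum_subtractf .
qed

text \<open>In \<open>Y_meas\<close> the times \<open>s\<close> and \<open>t\<close> are unrelated:
  the whole clock belongs to \<open>G 0\<close>, and weights that anticipate \<open>Y\<close> remain
  admissible at every time.\<close>

locale clock_compensated = prob_space M for M :: "'w measure" +
  fixes G :: "real \<Rightarrow> 'w measure" and X :: "real \<Rightarrow> 'w \<Rightarrow> nat" and Y :: "real \<Rightarrow> 'w \<Rightarrow> real" and lam :: real
  assumes lam: "0 \<le> lam"
    and sub: "0 \<le> t \<Longrightarrow> subalgebra M (G t)"
    and G_mono: "0 \<le> s \<Longrightarrow> s \<le> t \<Longrightarrow> sets (G s) \<subseteq> sets (G t)"
    and X_meas: "0 \<le> s \<Longrightarrow> s \<le> t \<Longrightarrow> X s \<in> measurable (G t) (count_space UNIV)"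
    and Y_meas: "0 \<le> s \<Longrightarrow> 0 \<le> t \<Longrightarrow> Y s \<in> borel_measurable (G t)"
    and X_int: "0 \<le> t \<Longrightarrow> integrable M (\<lambda>\<omega>. real (X t \<omega>))"
    and Y_int: "0 \<le> t \<Longrightarrow> integrable M (Y t)"
    and compensated: "0 \<le> s \<Longrightarrow> s \<le> t \<Longrightarrow>
      AE \<omega> in M. real_cond_exp M (G s) (\<lambda>\<omega>. real (X t \<omega>) - lam * Y t \<omega>) \<omega> = real (X s \<omega>) - lam * Y s \<omega>"
    and X_counting: "AE \<omega> in M. counting_path (\<lambda>t. X t \<omega>)"
    and X_unit: "AE \<omega> in M. unit_jumps (\<lambda>t. X t \<omega>)"
    and Y_cont: "AE \<omega> in M. continuous_on {0..} (\<lambda>t. Y t \<omega>)"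
    and Y_mono: "AE \<omega> in M. mono_on {0..} (\<lambda>t. Y t \<omega>)"
begin

lemma space_G: "0 \<le> t \<Longrightarrow> space (G t) = space M"
  using sub by (simp add: subalgebra_def)

lemma from_G: "0 \<le> t \<Longrightarrow> f \<in> measurable (G t) N \<Longrightarrow> f \<in> measurable M N"
  by (rule measurable_from_subalg[OF sub])

lemma G_up: "0 \<le> s \<Longrightarrow> s \<le> t \<Longrightarrow> f \<in> measurable (G s) N \<Longrightarrow> f \<in> measurable (G t) N"
  using G_mono by (intro measurable_from_subalg[of "G t" "G s"]) (auto simp: subalgebra_def space_G)

lemma X_M: "0 \<le> t \<Longrightarrow> X t \<in> measurable M (count_space UNIV)"
  by (rule from_G[OF _ X_meas]) auto

lemma Y_M: "0 \<le> t \<Longrightarrow> Y t \<in> borel_measurable M"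
  by (rule from_G[OF _ Y_meas]) auto

text \<open>The martingale property tested against bounded weights known at time \<open>s\<close>,
  which may be moved inside the conditional expectation.\<close>

lemma compensated_increment:
  assumes st: "0 \<le> s" "s \<le> t" and \<phi>: "\<phi> \<in> borel_measurable (G s)" "\<And>\<omega>. 0 \<le> \<phi> \<omega>" "\<And>\<omega>. \<phi> \<omega> \<le> 1"
  shows "integrable M (\<lambda>\<omega>. \<phi> \<omega> * ((real (X t \<omega>) - real (X s \<omega>)) - lam * (Y t \<omega> - Y s \<omega>)))"
    and "expectation (\<lambda>\<omega>. \<phi> \<omega> * ((real (X t \<omega>) - real (X s \<omega>)) - lam * (Y t \<omega> - Y s \<omega>))) = 0"
proof -
  define Z where "Z t \<omega> = real (X t \<omega>) - lam * Y t \<omega>" for t \<omega>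
  have int: "integrable M (Z t)" if "0 \<le> t" for t
    unfolding Z_def using X_int[OF that] Y_int[OF that] by simp
  have t: "0 \<le> t" using st by simp
  have \<phi>M: "\<phi> \<in> borel_measurable M" by (rule from_G[OF st(1) \<phi>(1)])
  have i1: "integrable M (\<lambda>\<omega>. \<phi> \<omega> * Z t \<omega>)" and i2: "integrable M (\<lambda>\<omega>. \<phi> \<omega> * Z s \<omega>)"
    using integrable_unit_mult[OF int[OF t] \<phi>M \<phi>(2,3)] integrable_unit_mult[OF int[OF st(1)] \<phi>M \<phi>(2,3)] by auto
  interpret finite_measure_subalgebra M "G s" using sub[OF st(1)] by unfold_locales
  have m: "Z t \<in> borel_measurable M" using int[OF t] by simp
  have "expectation (\<lambda>\<omega>. \<phi> \<omega> * Z t \<omega>) = expectation (\<lambda>\<omega>. \<phi> \<omega> * real_cond_exp M (G s) (Z t) \<omega>)"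
    by (rule real_cond_exp_intg(2)[OF i1 \<phi>(1) m, symmetric])
  also have "\<dots> = expectation (\<lambda>\<omega>. \<phi> \<omega> * Z s \<omega>)"
    using compensated[OF st] \<phi>M int[OF st(1)] unfolding Z_def[symmetric]
    by (intro integral_cong_AE) auto
  finally have e: "expectation (\<lambda>\<omega>. \<phi> \<omega> * Z t \<omega>) = expectation (\<lambda>\<omega>. \<phi> \<omega> * Z s \<omega>)" .
  have eq: "\<phi> \<omega> * ((real (X t \<omega>) - real (X s \<omega>)) - lam * (Y t \<omega> - Y s \<omega>)) = \<phi> \<omega> * Z t \<omega> - \<phi> \<omega> * Z s \<omega>" for \<omega>
    by (simp add: Z_def algebra_simps)
  show "integrable M (\<lambda>\<omega>. \<phi> \<omega> * ((real (X t \<omega>) - real (X s \<omega>)) - lam * (Y t \<omega> - Y s \<omega>)))"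
    unfolding eq using i1 i2 by simp
  show "expectation (\<lambda>\<omega>. \<phi> \<omega> * ((real (X t \<omega>) - real (X s \<omega>)) - lam * (Y t \<omega> - Y s \<omega>))) = 0"
    unfolding eq using i1 i2 e by simp
qed

text \<open>The difference \<open>D\<close> of the two integrands is the same for every
  \<open>n\<close>. It splits into the centred sum \<open>B n\<close> and a remainder
  \<open>W n\<close>, with \<open>W n\<close> bounded by \<open>E n\<close>; these bounds tend to
  \<open>0\<close> below the fixed integrable function \<open>w\<close>.\<close>

lemma increment_pgf:
  assumes st: "0 \<le> s" "s \<le> t" and \<phi>: "\<phi> \<in> borel_measurable (G s)" "\<And>\<omega>. 0 \<le> \<phi> \<omega>" "\<And>\<omega>. \<phi> \<omega> \<le> 1"
    and z: "0 \<le> z" "z \<le> 1"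
  shows "expectation (\<lambda>\<omega>. \<phi> \<omega> * z ^ (X t \<omega> - X s \<omega>)) =
    expectation (\<lambda>\<omega>. \<phi> \<omega> * exp (- (lam * (1 - z) * max 0 (Y t \<omega> - Y s \<omega>))))"
proof -
  define c where "c = lam * (1 - z)"
  have c: "0 \<le> c" using lam z by (simp add: c_def)
  define g where "g n = grid s t n" for n
  have g: "s \<le> g n i" "g n i \<le> t" "0 \<le> g n i" if "i \<le> Suc n" for n i
    unfolding g_def using grid_bounds[OF st(2) that] st(1) by auto
  have gm: "g n i \<le> g n (Suc i)" for n i unfolding g_def by (rule grid_mono) (use st in auto)
  \<comment> \<open>This weight involves the clock up to time \<open>t\<close> and is still
    measurable at time \<open>g n i\<close>. Since \<open>Y\<close> is monotone only almost surely,
    \<open>max 0\<close> is what keeps \<open>V\<close> below \<open>1\<close> at every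
    point.\<close>
  define V where "V n i \<omega> = z ^ (X (g n i) \<omega> - X s \<omega>) * exp (- (c * max 0 (Y t \<omega> - Y (g n (Suc i)) \<omega>)))" for n i \<omega>
  define R where "R n i \<omega> = pgf_error z (X (g n (Suc i)) \<omega> - X (g n i) \<omega>)" for n i \<omega>
  define Q where "Q n i \<omega> = exp_error (c * (Y (g n (Suc i)) \<omega> - Y (g n i) \<omega>))" for n i \<omega>
  define D where "D \<omega> = \<phi> \<omega> * (z ^ (X t \<omega> - X s \<omega>) - exp (- (c * max 0 (Y t \<omega> - Y s \<omega>))))" for \<omega>
  define W where "W n \<omega> = \<phi> \<omega> * (\<Sum>i<Suc n. V n i \<omega> * (R n i \<omega> - Q n i \<omega>))" for n \<omega>
  define C where "C n i \<omega> = (real (X (g n (Suc i)) \<omega>) - real (X (g n i) \<omega>)) - lam * (Y (g n (Suc i)) \<omega> - Y (g n i) \<omega>)" for n i \<omega>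
  define B where "B n \<omega> = (\<Sum>i<Suc n. (1 - z) * ((\<phi> \<omega> * V n i \<omega>) * C n i \<omega>))" for n \<omega>
  define E where "E n \<omega> = (\<Sum>i<Suc n. R n i \<omega>) + (\<Sum>i<Suc n. Q n i \<omega>)" for n \<omega>
  have t0: "0 \<le> t" using st by simp
  have \<phi>M [measurable]: "\<phi> \<in> borel_measurable M" by (rule from_G[OF st(1) \<phi>(1)])
  note [measurable] = Y_M[OF st(1)] Y_M[OF t0]
  have V01: "0 \<le> V n i \<omega>" "V n i \<omega> \<le> 1" for n i \<omega>
    using z c by (auto simp: V_def intro!: mult_le_one power_le_one)
  have VG: "V n i \<in> borel_measurable (G (g n i))" if "i < Suc n" for n i
  proof -
    have gi: "s \<le> g n i" "0 \<le> g n i" "0 \<le> g n (Suc i)" using g[of i n] g[of "Suc i" n] that by auto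
    have [measurable]: "(\<lambda>\<omega>. z ^ (X (g n i) \<omega> - X s \<omega>)) \<in> borel_measurable (G (g n i))"
      by (rule measurable_nat_binop[of _ _ _ _ "\<lambda>a b. z ^ (a - b)"]) (use gi st in \<open>auto intro!: X_meas\<close>)
    note [measurable] = Y_meas[OF t0 gi(2)] Y_meas[OF gi(3) gi(2)]
    show ?thesis unfolding V_def by measurable
  qed
  have VM: "V n i \<in> borel_measurable M" if "i < Suc n" for n i
    using VG[OF that] g[of i n] that by (intro from_G) auto
  have RM: "R n i \<in> borel_measurable M" if "i < Suc n" for n i
    unfolding R_def by (rule measurable_nat_binop[of _ _ _ _ "\<lambda>a b. pgf_error z (a - b)"])
      (use that g[of i n] g[of "Suc i" n] in \<open>auto intro!: X_M\<close>)
  have QM: "Q n i \<in> borel_measurable M" if "i < Suc n" for n i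
  proof -
    have gi: "0 \<le> g n i" "0 \<le> g n (Suc i)" using g[of i n] g[of "Suc i" n] that by auto
    note [measurable] = Y_M[OF gi(1)] Y_M[OF gi(2)]
    show ?thesis unfolding Q_def exp_error_def by measurable
  qed
  have WM: "W n \<in> borel_measurable M" for n
    unfolding W_def using VM RM QM
    by (intro borel_measurable_times borel_measurable_sum borel_measurable_diff \<phi>M) auto
  have EM: "E n \<in> borel_measurable M" for n
    unfolding E_def using RM QM by (intro borel_measurable_add borel_measurable_sum) auto
  have zM [measurable]: "(\<lambda>\<omega>. z ^ (X t \<omega> - X s \<omega>)) \<in> borel_measurable M"
    by (rule measurable_nat_binop[of _ _ _ _ "\<lambda>a b. z ^ (a - b)"]) (use st in \<open>auto intro!: X_M\<close>)
  have B0: "integrable M (B n)" "expectation (B n) = 0" for n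
  proof -
    have *: "integrable M (\<lambda>\<omega>. (\<phi> \<omega> * V n i \<omega>) * C n i \<omega>)" "expectation (\<lambda>\<omega>. (\<phi> \<omega> * V n i \<omega>) * C n i \<omega>) = 0"
      if i: "i < Suc n" for i
    proof -
      have gi: "0 \<le> g n i" "s \<le> g n i" using g[of i n] i by auto
      have m: "(\<lambda>\<omega>. \<phi> \<omega> * V n i \<omega>) \<in> borel_measurable (G (g n i))"
        by (intro borel_measurable_times VG i G_up[OF st(1) gi(2) \<phi>(1)])
      have b: "0 \<le> \<phi> \<omega> * V n i \<omega>" "\<phi> \<omega> * V n i \<omega> \<le> 1" for \<omega>
        using \<phi> V01 by (auto intro!: mult_le_one)
      show "integrable M (\<lambda>\<omega>. (\<phi> \<omega> * V n i \<omega>) * C n i \<omega>)" "expectation (\<lambda>\<omega>. (\<phi> \<omega> * V n i \<omega>) * C n i \<omega>) = 0"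
        unfolding C_def using compensated_increment[OF gi(1) gm m b] by auto
    qed
    show "integrable M (B n)" unfolding B_def using * by (intro Bochner_Integration.integrable_sum integrable_mult_right) auto
    show "expectation (B n) = 0"
      unfolding B_def using * by (subst Bochner_Integration.integral_sum) auto
  qed
  have E_ae: "AE \<omega> in M. (\<forall>n. \<bar>W n \<omega>\<bar> \<le> E n \<omega> \<and> 0 \<le> E n \<omega> \<and> E n \<omega> \<le> (real (X t \<omega>) - real (X s \<omega>)) + c * (Y t \<omega> - Y s \<omega>) \<and> D \<omega> = W n \<omega> - B n \<omega>)
     \<and> (\<lambda>n. E n \<omega>) \<longlonglongrightarrow> 0"
    using X_counting X_unit Y_cont Y_mono
  proof eventually_elim
    case (elim \<omega>)
    let ?x = "\<lambda>t. X t \<omega>" and ?y = "\<lambda>t. Y t \<omega>"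
    have x: "mono_on {0..} ?x" using elim by (simp add: counting_path_def)
    have R: "0 \<le> R n i \<omega>" "R n i \<omega> \<le> real (X (g n (Suc i)) \<omega>) - real (X (g n i) \<omega>)" if "i < Suc n" for n i
    proof -
      have "X (g n i) \<omega> \<le> X (g n (Suc i)) \<omega>"
        using g[of i n] gm[of n i] g[of "Suc i" n] that by (intro mono_onD[OF x]) auto
      then show "0 \<le> R n i \<omega>" "R n i \<omega> \<le> real (X (g n (Suc i)) \<omega>) - real (X (g n i) \<omega>)"
        using pgf_error_bounds[OF z, of "X (g n (Suc i)) \<omega> - X (g n i) \<omega>"] unfolding R_def by auto
    qed
    have Q: "0 \<le> Q n i \<omega>" "Q n i \<omega> \<le> c * (Y (g n (Suc i)) \<omega> - Y (g n i) \<omega>)" if "i < Suc n" for n i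
    proof -
      have "Y (g n i) \<omega> \<le> Y (g n (Suc i)) \<omega>"
        using g[of i n] gm[of n i] g[of "Suc i" n] that by (intro mono_onD[OF elim(4)]) auto
      then have "0 \<le> c * (Y (g n (Suc i)) \<omega> - Y (g n i) \<omega>)" using c by simp
      from exp_error_bounds[OF this] show "0 \<le> Q n i \<omega>" "Q n i \<omega> \<le> c * (Y (g n (Suc i)) \<omega> - Y (g n i) \<omega>)"
        unfolding Q_def by auto
    qed
    have WE: "\<bar>W n \<omega>\<bar> \<le> E n \<omega>" for n
    proof -
      have "\<bar>W n \<omega>\<bar> \<le> \<bar>\<Sum>i<Suc n. V n i \<omega> * (R n i \<omega> - Q n i \<omega>)\<bar>"
        unfolding W_def abs_mult using \<phi>(2,3)[of \<omega>] by (intro mult_left_le_one_le) auto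
      also have "\<dots> \<le> (\<Sum>i<Suc n. \<bar>V n i \<omega> * (R n i \<omega> - Q n i \<omega>)\<bar>)" by (rule sum_abs)
      also have "\<dots> \<le> (\<Sum>i<Suc n. R n i \<omega> + Q n i \<omega>)"
      proof (rule sum_mono)
        fix i assume i: "i \<in> {..<Suc n}"
        have "\<bar>V n i \<omega> * (R n i \<omega> - Q n i \<omega>)\<bar> \<le> \<bar>R n i \<omega> - Q n i \<omega>\<bar>"
          unfolding abs_mult using V01[of n i \<omega>] by (intro mult_left_le_one_le) auto
        also have "\<dots> \<le> R n i \<omega> + Q n i \<omega>" using R[of i n] Q[of i n] i by simp
        finally show "\<bar>V n i \<omega> * (R n i \<omega> - Q n i \<omega>)\<bar> \<le> R n i \<omega> + Q n i \<omega>" .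
      qed
      also have "\<dots> = E n \<omega>" unfolding E_def by (rule sum.distrib)
      finally show ?thesis .
    qed
    have Eup: "E n \<omega> \<le> (real (X t \<omega>) - real (X s \<omega>)) + c * (Y t \<omega> - Y s \<omega>)" for n
    proof -
      have "(\<Sum>i<Suc n. R n i \<omega>) \<le> (\<Sum>i<Suc n. real (X (g n (Suc i)) \<omega>) - real (X (g n i) \<omega>))"
        using R by (intro sum_mono) auto
      also have "\<dots> = real (X t \<omega>) - real (X s \<omega>)"
        using sum_lessThan_telescope[of "\<lambda>i. real (X (g n i) \<omega>)" "Suc n"] by (simp only: g_def grid_0 grid_Suc)
      finally have 1: "(\<Sum>i<Suc n. R n i \<omega>) \<le> real (X t \<omega>) - real (X s \<omega>)" .
      have "(\<Sum>i<Suc n. Q n i \<omega>) \<le> (\<Sum>i<Suc n. c * (Y (g n (Suc i)) \<omega> - Y (g n i) \<omega>))"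
        using Q by (intro sum_mono) auto
      also have "\<dots> = c * (Y t \<omega> - Y s \<omega>)"
        using sum_lessThan_telescope[of "\<lambda>i. Y (g n i) \<omega>" "Suc n"]
        by (simp only: g_def grid_0 grid_Suc sum_distrib_left[symmetric])
      finally show ?thesis using 1 unfolding E_def by linarith
    qed
    have "D \<omega> = W n \<omega> - B n \<omega>" for n
    proof -
      have "B n \<omega> = \<phi> \<omega> * (\<Sum>i<Suc n. V n i \<omega> * ((1 - z) * C n i \<omega>))"
        unfolding B_def sum_distrib_left by (intro sum.cong) (auto simp: ac_simps)
      then show ?thesis
        using grid_telescope[OF x elim(4) st, of z lam n]
        unfolding D_def W_def V_def R_def Q_def C_def c_def g_def by (simp only:) (rule right_diff_distrib)
    qed
    moreover have "0 \<le> E n \<omega>" for n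
      unfolding E_def using R Q by (intro add_nonneg_nonneg sum_nonneg) auto
    moreover have "(\<lambda>n. E n \<omega>) \<longlonglongrightarrow> 0 + 0"
      unfolding E_def R_def Q_def g_def
      by (intro tendsto_add pgf_error_grid_tendsto exp_error_grid_tendsto elim st c)
    ultimately show ?case using WE Eup by simp
  qed
  define w where "w \<omega> = (real (X t \<omega>) - real (X s \<omega>)) + c * (Y t \<omega> - Y s \<omega>)" for \<omega>
  have w_int: "integrable M w"
    unfolding w_def using X_int[OF st(1)] X_int[OF t0] Y_int[OF st(1)] Y_int[OF t0] by simp
  have E_w: "AE \<omega> in M. norm (E n \<omega>) \<le> w \<omega>" for n
    using E_ae by eventually_elim (simp add: w_def)
  have W_E: "AE \<omega> in M. \<bar>W n \<omega>\<bar> \<le> E n \<omega>" for n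
    using E_ae by eventually_elim simp
  have E_int: "integrable M (E n)" for n
    by (rule Bochner_Integration.integrable_bound[OF w_int EM]) (use E_w[of n] in eventually_elim, simp)
  have W_int: "integrable M (W n)" for n
    by (rule Bochner_Integration.integrable_bound[OF E_int[of n] WM]) (use W_E[of n] in eventually_elim, simp)
  have "(\<lambda>n. expectation (E n)) \<longlonglongrightarrow> expectation (\<lambda>\<omega>. 0)"
  proof (rule integral_dominated_convergence[OF _ EM w_int])
    show "AE \<omega> in M. (\<lambda>n. E n \<omega>) \<longlonglongrightarrow> 0" using E_ae by eventually_elim auto
    show "AE \<omega> in M. norm (E n \<omega>) \<le> w \<omega>" for n by (rule E_w)
  qed auto
  \<comment> \<open>Taking expectations removes \<open>B n\<close>, so the mean of \<open>D\<close>
    is controlled by the error alone.\<close>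
  moreover have "\<bar>expectation D\<bar> \<le> expectation (E n)" for n
  proof -
    have "expectation D = expectation (\<lambda>\<omega>. W n \<omega> - B n \<omega>)"
    proof (rule integral_cong_AE)
      show "D \<in> borel_measurable M" unfolding D_def by measurable
      show "AE \<omega> in M. D \<omega> = W n \<omega> - B n \<omega>" using E_ae by eventually_elim blast
    qed (use WM B0 in auto)
    also have "\<dots> = expectation (W n)" using W_int B0 by simp
    finally have "\<bar>expectation D\<bar> \<le> expectation (\<lambda>\<omega>. \<bar>W n \<omega>\<bar>)"
      using integral_abs_bound[of M "W n"] by simp
    also have "\<dots> \<le> expectation (E n)"
      by (intro integral_mono_AE integrable_abs W_int E_int W_E)
    finally show ?thesis .
  qed
  ultimately have "\<bar>expectation D\<bar> \<le> 0"
    by (intro LIMSEQ_le_const[of _ 0]) auto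
  then have D0: "expectation D = 0" by simp
  have "integrable M (\<lambda>\<omega>. \<phi> \<omega> * z ^ (X t \<omega> - X s \<omega>))"
    by (rule integrable_unit) (use \<phi> z in \<open>auto intro!: mult_le_one power_le_one borel_measurable_times\<close>)
  moreover have "integrable M (\<lambda>\<omega>. \<phi> \<omega> * exp (- (c * max 0 (Y t \<omega> - Y s \<omega>))))"
    by (rule integrable_unit) (use \<phi> c in \<open>auto intro!: mult_le_one\<close>)
  ultimately show ?thesis using D0 unfolding D_def c_def by (simp add: right_diff_distrib)
qed

text \<open>Given \<open>G s\<close>, the increment is Poisson with the random parameter
  \<open>lam * (Y t - Y s)\<close>; the identity for all weights \<open>\<phi>\<close> states this
  without conditional distributions.\<close>

lemma increment_law:
  assumes st: "0 \<le> s" "s \<le> t" and \<phi>: "\<phi> \<in> borel_measurable (G s)" "\<And>\<omega>. 0 \<le> \<phi> \<omega>" "\<And>\<omega>. \<phi> \<omega> \<le> 1"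
  shows "expectation (\<lambda>\<omega>. \<phi> \<omega> * indicator A (X t \<omega> - X s \<omega>)) =
    expectation (\<lambda>\<omega>. \<phi> \<omega> * poisson_weight A (lam * (Y t \<omega> - Y s \<omega>)))"
proof (rule mixed_poisson_of_pgf)
  have t0: "0 \<le> t" using st by simp
  note [measurable] = Y_M[OF st(1)] Y_M[OF t0]
  show "(\<lambda>\<omega>. X t \<omega> - X s \<omega>) \<in> measurable M (count_space UNIV)"
    by (rule measurable_nat_binop) (use st in \<open>auto intro!: X_M\<close>)
  show "(\<lambda>\<omega>. lam * (Y t \<omega> - Y s \<omega>)) \<in> borel_measurable M" by measurable
  show "\<phi> \<in> borel_measurable M" by (rule from_G[OF st(1) \<phi>(1)])
  fix z :: real assume "0 \<le> z" "z < 1"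
  moreover have mx: "max 0 (lam * d) = lam * max 0 d" for d :: real
    using lam by (auto simp add: max_def zero_le_mult_iff mult_le_0_iff)
  ultimately show "expectation (\<lambda>\<omega>. \<phi> \<omega> * z ^ (X t \<omega> - X s \<omega>)) =
      expectation (\<lambda>\<omega>. \<phi> \<omega> * exp (- ((1 - z) * max 0 (lam * (Y t \<omega> - Y s \<omega>)))))"
    using increment_pgf[OF st \<phi>, of z] unfolding mx by (simp add: mult.assoc mult.left_commute)
qed (use \<phi> in auto)

end

section \<open>Increments over times determined by the clock\<close>

text \<open>Localisation for random times with countably many values: on each event
  \<open>J \<omega> = j\<close> they are constants. Nonnegative integrals allow the pieces to be
  summed without prior integrability.\<close>

lemma nn_integral_eq_countable_split:
  fixes J :: "'a \<Rightarrow> 'c :: countable"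
  assumes J [measurable]: "J \<in> measurable M (count_space UNIV)"
    and [measurable]: "f \<in> borel_measurable M" "g \<in> borel_measurable M"
    and eq: "\<And>j. (\<integral>\<^sup>+\<omega>. f \<omega> * indicator {\<omega>. J \<omega> = j} \<omega> \<partial>M) = (\<integral>\<^sup>+\<omega>. g \<omega> * indicator {\<omega>. J \<omega> = j} \<omega> \<partial>M)"
  shows "(\<integral>\<^sup>+\<omega>. f \<omega> \<partial>M) = (\<integral>\<^sup>+\<omega>. g \<omega> \<partial>M)"
proof -
  define D where "D n = {\<omega>. to_nat (J \<omega>) = n}" for n
  have split: "(\<integral>\<^sup>+\<omega>. h \<omega> \<partial>M) = (\<Sum>n. \<integral>\<^sup>+\<omega>. h \<omega> * indicator (D n) \<omega> \<partial>M)"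
    if [measurable]: "h \<in> borel_measurable M" for h
  proof -
    have "h \<omega> = (\<Sum>n. h \<omega> * indicator (D n) \<omega>)" for \<omega>
      by (subst suminf_finite[of "{to_nat (J \<omega>)}"]) (auto simp: D_def)
    then have "(\<integral>\<^sup>+\<omega>. h \<omega> \<partial>M) = (\<integral>\<^sup>+\<omega>. (\<Sum>n. h \<omega> * indicator (D n) \<omega>) \<partial>M)" by simp
    also have "\<dots> = (\<Sum>n. \<integral>\<^sup>+\<omega>. h \<omega> * indicator (D n) \<omega> \<partial>M)"
      unfolding D_def by (intro nn_integral_suminf) measurable
    finally show ?thesis .
  qed
  have "(\<integral>\<^sup>+\<omega>. f \<omega> * indicator (D n) \<omega> \<partial>M) = (\<integral>\<^sup>+\<omega>. g \<omega> * indicator (D n) \<omega> \<partial>M)" for n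
  proof (cases "n \<in> range (to_nat :: 'c \<Rightarrow> nat)")
    case True
    then obtain j :: 'c where "n = to_nat j" by auto
    then have "D n = {\<omega>. J \<omega> = j}" by (auto simp: D_def)
    then show ?thesis using eq by simp
  next
    case False
    then have "D n = {}" by (auto simp: D_def)
    then show ?thesis by simp
  qed
  then show ?thesis by (subst (1 2) split) auto
qed

section \<open>Finite families of times, cylinder events and products over increments\<close>

lemma steps_mono:
  fixes r :: "nat \<Rightarrow> real"
  assumes "\<And>i. i < n \<Longrightarrow> r i \<le> r (Suc i)" "i \<le> j" "j \<le> n"
  shows "r i \<le> r j"
  using assms(2,3)
proof (induction j rule: dec_induct)
  case (step j)
  then show ?case using assms(1)[of j] by simp
qed simp

text \<open>Time \<open>0\<close> is put in front so that the values of a counting path at the given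
  times can be rebuilt from its increments.\<close>

lemma finite_times_enumeration:
  fixes S :: "real set"
  assumes "finite S" "\<And>r. r \<in> S \<Longrightarrow> 0 \<le> r"
  obtains n :: nat and t :: "nat \<Rightarrow> real" where
    "t 0 = 0" "\<And>i. i < n \<Longrightarrow> t i \<le> t (Suc i)" "\<And>r. r \<in> S \<Longrightarrow> \<exists>j\<le>n. r = t j"
    "\<And>i. i \<le> n \<Longrightarrow> t i \<in> insert 0 S"
proof -
  define xs where "xs = sorted_list_of_set (insert 0 S)"
  have xs: "set xs = insert 0 S" "sorted xs" using assms(1) unfolding xs_def by (simp_all del: sorted_list_of_set_insert_remove)
  then have len: "0 < length xs" by (cases xs) auto
  obtain i0 where i0: "i0 < length xs" "xs ! i0 = 0" using xs(1) by (metis in_set_conv_nth insertI1)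
  show ?thesis
  proof (rule that[of "\<lambda>i. xs ! i" "length xs - 1"])
    have "xs ! 0 \<le> xs ! i0" using xs(2) i0 by (intro sorted_nth_mono) auto
    moreover have "xs ! 0 \<in> insert 0 S" using len xs(1) by (metis nth_mem)
    ultimately show "xs ! 0 = 0" using assms(2)[of "xs ! 0"] i0 by auto
    show "xs ! i \<le> xs ! Suc i" if "i < length xs - 1" for i
      using xs(2) that by (intro sorted_nth_mono) auto
    show "\<exists>j\<le>length xs - 1. r = xs ! j" if "r \<in> S" for r
    proof -
      have "r \<in> set xs" using xs(1) that by simp
      then obtain j where "j < length xs" "xs ! j = r" by (auto simp: in_set_conv_nth)
      then show ?thesis by (intro exI[of _ j]) auto
    qed
    show "xs ! i \<in> insert 0 S" if "i \<le> length xs - 1" for i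
    proof -
      have "i < length xs" using that len by linarith
      then show ?thesis using nth_mem[of i xs] xs(1) by simp
    qed
  qed
qed

text \<open>The constraints form a list, so that appending intersects two cylinders and the empty
  list gives the whole space.\<close>

definition cylinder :: "'a measure \<Rightarrow> (real \<Rightarrow> 'a \<Rightarrow> nat) \<Rightarrow> (real \<times> nat set) list \<Rightarrow> 'a set" where
  "cylinder M Z ps = {\<omega> \<in> space M. \<forall>p\<in>set ps. Z (fst p) \<omega> \<in> snd p}"

lemma cylinder_sets:
  assumes "\<forall>p\<in>set ps. 0 \<le> fst p" "\<And>t. 0 \<le> t \<Longrightarrow> Z t \<in> measurable M (count_space UNIV)"
  shows "cylinder M Z ps \<in> sets M"
  unfolding cylinder_def
proof (rule sets.sets_Collect_finite_All)
  fix p assume "p \<in> set ps"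
  then have "Z (fst p) \<in> measurable M (count_space UNIV)" using assms by auto
  then show "{\<omega> \<in> space M. Z (fst p) \<omega> \<in> snd p} \<in> sets M" by measurable
qed simp

text \<open>The subtraction is truncated on \<open>nat\<close>; it is the true increment along
  nondecreasing values.\<close>

definition jump_product :: "(nat \<Rightarrow> nat set) \<Rightarrow> nat \<Rightarrow> (nat \<Rightarrow> nat) \<Rightarrow> real" where
  "jump_product A n x = (\<Prod>i<n. indicator (A i) (x (Suc i) - x i))"

text \<open>For nondecreasing \<open>y\<close> and nonnegative \<open>c\<close>, the probability
  that independent Poisson variables with means \<open>c * (y (Suc i) - y i)\<close> fall into the
  sets \<open>A i\<close>.\<close>

definition poisson_product :: "real \<Rightarrow> (nat \<Rightarrow> nat set) \<Rightarrow> nat \<Rightarrow> (nat \<Rightarrow> real) \<Rightarrow> real" where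
  "poisson_product c A n y = (\<Prod>i<n. poisson_weight (A i) (c * (y (Suc i) - y i)))"

lemma jump_product_cong: "(\<And>i. i \<le> n \<Longrightarrow> x i = x' i) \<Longrightarrow> jump_product A n x = jump_product A n x'"
  unfolding jump_product_def by (intro prod.cong) auto

lemma poisson_product_cong: "(\<And>i. i \<le> n \<Longrightarrow> y i = y' i) \<Longrightarrow> poisson_product c A n y = poisson_product c A n y'"
  unfolding poisson_product_def by (intro prod.cong) auto

lemma jump_product_eq: "jump_product A n x = (if \<forall>i<n. x (Suc i) - x i \<in> A i then 1 else 0)"
  by (auto simp: jump_product_def indicator_def)

lemma jump_product_bounds: "0 \<le> jump_product A n x" "jump_product A n x \<le> 1"
  by (auto simp: jump_product_eq)

lemma poisson_product_bounds: "0 \<le> poisson_product c A n y" "poisson_product c A n y \<le> 1"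
  unfolding poisson_product_def by (auto intro!: prod_nonneg prod_le_1 poisson_weight_bounds)

lemma jump_product_measurable:
  assumes "\<And>i. i \<le> n \<Longrightarrow> x i \<in> measurable M (count_space UNIV)"
  shows "(\<lambda>\<omega>. jump_product A n (\<lambda>i. x i \<omega>)) \<in> borel_measurable M"
  unfolding jump_product_def
proof (rule borel_measurable_prod)
  fix i assume "i \<in> {..<n}"
  then show "(\<lambda>\<omega>. indicator (A i) (x (Suc i) \<omega> - x i \<omega>) :: real) \<in> borel_measurable M"
    by (intro measurable_nat_binop[of _ _ _ _ "\<lambda>a b. indicator (A i) (a - b)"] assms) auto
qed

lemma poisson_product_measurable:
  assumes "\<And>i. i \<le> n \<Longrightarrow> y i \<in> borel_measurable M"
  shows "(\<lambda>\<omega>. poisson_product c A n (\<lambda>i. y i \<omega>)) \<in> borel_measurable M"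
  unfolding poisson_product_def
proof (rule borel_measurable_prod)
  fix i assume "i \<in> {..<n}"
  then have [measurable]: "y i \<in> borel_measurable M" "y (Suc i) \<in> borel_measurable M" using assms by auto
  show "(\<lambda>\<omega>. poisson_weight (A i) (c * (y (Suc i) \<omega> - y i \<omega>))) \<in> borel_measurable M" by measurable
qed

lemma poisson_product_tendsto:
  assumes "\<And>i. i \<le> n \<Longrightarrow> (\<lambda>k. y k i) \<longlonglongrightarrow> y' i"
  shows "(\<lambda>k. poisson_product c A n (y k)) \<longlonglongrightarrow> poisson_product c A n y'"
  unfolding poisson_product_def
  by (intro tendsto_mult tendsto_const tendsto_prod isCont_tendsto_compose[OF poisson_weight_isCont] tendsto_diff)
    (use assms in auto)

text \<open>The approximation is strict from above, so that right continuity suffices.\<close>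

lemma dyadic_approx_tendsto:
  fixes y :: real
  assumes "\<And>k. y < d k" "\<And>k. d k \<le> y + 1 / 2 ^ k"
  shows "d \<longlonglongrightarrow> y"
proof (rule tendsto_sandwich[where f="\<lambda>_. y"])
  have "(\<lambda>k. y + (1 / 2) ^ k) \<longlonglongrightarrow> y + 0"
    by (intro tendsto_add LIMSEQ_power_zero tendsto_const) auto
  then show "(\<lambda>k. y + 1 / 2 ^ k) \<longlonglongrightarrow> y" by (simp add: power_one_over)
qed (auto intro!: always_eventually less_imp_le assms)

lemma dyadic_approx_counting:
  assumes x: "counting_path x" and y: "0 \<le> y" and d: "\<And>k. y < d k" "\<And>k. d k \<le> y + 1 / 2 ^ k"
  shows "\<forall>\<^sub>F k in sequentially. x (d k) = x y"
proof -
  obtain b where b: "b > y" "\<forall>v. y \<le> v \<and> v < b \<longrightarrow> x v = x y"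
    using counting_path_right_constant[OF x y] by blast
  have "\<forall>\<^sub>F k in sequentially. d k < b"
    using order_tendstoD(2)[OF dyadic_approx_tendsto[OF d] b(1)] .
  then show ?thesis by eventually_elim (use b(2) d(1) in \<open>simp add: less_imp_le\<close>)
qed

text \<open>Index of the first dyadic time at which the clock \<open>y\<close> has passed
  \<open>u\<close>. When \<open>y\<close> inverts \<open>l\<close>, that time approximates
  \<open>l u\<close> from above; it reads only countably many clock values, which makes it
  measurable with respect to the clock.\<close>

definition dyadic_hit :: "(real \<Rightarrow> real) \<Rightarrow> nat \<Rightarrow> real \<Rightarrow> nat" where
  "dyadic_hit y k u = (LEAST j. u < y (real j / 2 ^ k))"

text \<open>By the Galois connection, the clock has passed \<open>u\<close> at a time exactly when
  that time exceeds \<open>l u\<close>. So the hit is the first dyadic number strictly above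
  \<open>l u\<close>.\<close>

lemma dyadic_hit_bounds:
  assumes l: "clock_path l" and u: "0 \<le> u"
  shows "l u < real (dyadic_hit (path_inverse l) k u) / 2 ^ k"
    and "real (dyadic_hit (path_inverse l) k u) / 2 ^ k \<le> l u + 1 / 2 ^ k"
proof -
  let ?P = "\<lambda>j. u < path_inverse l (real j / 2 ^ k)"
  let ?j = "dyadic_hit (path_inverse l) k u"
  have P: "?P j \<longleftrightarrow> l u * 2 ^ k < real j" for j
    unfolding less_path_inverse_iff[OF l u] by (simp add: field_simps)
  obtain j where "l u * 2 ^ k < real j" using reals_Archimedean2 by blast
  then have j: "?P ?j" unfolding dyadic_hit_def using P by (intro LeastI[of ?P]) blast
  then show 1: "l u < real ?j / 2 ^ k" using P by (simp add: field_simps)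
  have "0 \<le> l u * 2 ^ k" using clock_path_nonneg[OF l u] by simp
  \<comment> \<open>A positive index has a true predecessor, and minimality says that the
    predecessor is still at most \<open>l u * 2 ^ k\<close>.\<close>
  then have "0 < ?j" using j unfolding P by (cases "?j = 0") auto
  moreover from this have "\<not> ?P (?j - 1)" unfolding dyadic_hit_def by (intro not_less_Least) auto
  ultimately have "real ?j - 1 \<le> l u * 2 ^ k" unfolding P by (simp add: of_nat_diff)
  then show "real ?j / 2 ^ k \<le> l u + 1 / 2 ^ k" by (simp add: field_simps)
qed

lemma dyadic_hit_tendsto:
  assumes "clock_path l" "0 \<le> u"
  shows "(\<lambda>k. real (dyadic_hit (path_inverse l) k u) / 2 ^ k) \<longlonglongrightarrow> l u"
  by (rule dyadic_approx_tendsto[OF dyadic_hit_bounds[OF assms]])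

lemma dyadic_hit_clock_tendsto:
  assumes l: "clock_path l" and u: "0 \<le> u"
  shows "(\<lambda>k. path_inverse l (real (dyadic_hit (path_inverse l) k u) / 2 ^ k)) \<longlonglongrightarrow> u"
  using isCont_tendsto_compose[OF path_inverse_isCont[OF l] dyadic_hit_tendsto[OF assms]]
  by (simp add: path_inverse_clock[OF assms])

lemma dyadic_hit_counting:
  assumes l: "clock_path l" and u: "0 \<le> u" and x: "counting_path x"
  shows "\<forall>\<^sub>F k in sequentially. x (real (dyadic_hit (path_inverse l) k u) / 2 ^ k) = x (l u)"
  by (rule dyadic_approx_counting[OF x clock_path_nonneg[OF l u] dyadic_hit_bounds[OF l u]])

lemma dyadic_hit_mono:
  assumes l: "clock_path l" and u: "0 \<le> u" "u \<le> v"
  shows "dyadic_hit (path_inverse l) k u \<le> dyadic_hit (path_inverse l) k v"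
  unfolding dyadic_hit_def[of _ _ u]
proof (rule Least_le)
  have v: "0 \<le> v" using u by simp
  show "u < path_inverse l (real (dyadic_hit (path_inverse l) k v) / 2 ^ k)"
    using dyadic_hit_bounds(1)[OF l v, of k] less_path_inverse_iff[OF l v, of "real (dyadic_hit (path_inverse l) k v) / 2 ^ k"] u
    by simp
qed

section \<open>Joint laws of increments along times determined by the clock\<close>

context clock_compensated
begin

text \<open>Increments are removed from the last one backwards. The Poisson weight that replaces an
  increment depends on the clock only, hence is measurable at time \<open>0\<close> and joins
  \<open>\<xi>\<close> for the rest of the induction.\<close>

lemma chain_law:
  assumes "\<xi> \<in> borel_measurable (G 0)" "\<And>\<omega>. 0 \<le> \<xi> \<omega>" "\<And>\<omega>. \<xi> \<omega> \<le> 1"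
    and "0 \<le> r 0" "\<And>i. i < n \<Longrightarrow> r i \<le> r (Suc i)"
  shows "expectation (\<lambda>\<omega>. \<xi> \<omega> * jump_product A n (\<lambda>i. X (r i) \<omega>)) =
    expectation (\<lambda>\<omega>. \<xi> \<omega> * poisson_product lam A n (\<lambda>i. Y (r i) \<omega>))"
  using assms
proof (induction n arbitrary: \<xi>)
  case 0
  then show ?case by (simp add: jump_product_def poisson_product_def)
next
  case (Suc n)
  have r: "0 \<le> r i" "r i \<le> r n" if "i \<le> n" for i
    using steps_mono[of "Suc n" r 0 i] steps_mono[of "Suc n" r i n] Suc.prems that by auto
  define \<phi> where "\<phi> \<omega> = \<xi> \<omega> * jump_product A n (\<lambda>i. X (r i) \<omega>)" for \<omega>
  \<comment> \<open>\<open>\<eta>\<close> is the weight to which the induction hypothesis is applied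
    once the last increment has been integrated out.\<close>
  define \<eta> where "\<eta> \<omega> = \<xi> \<omega> * poisson_weight (A n) (lam * (Y (r (Suc n)) \<omega> - Y (r n) \<omega>))" for \<omega>
  have rn: "0 \<le> r n" "r n \<le> r (Suc n)" "0 \<le> r (Suc n)" using r[of n] Suc.prems(5)[of n] by auto
  have \<phi>1: "\<phi> \<in> borel_measurable (G (r n))"
    unfolding \<phi>_def
    by (intro borel_measurable_times jump_product_measurable G_up[OF order_refl rn(1) Suc.prems(1)] X_meas[OF r])
  have \<phi>2: "0 \<le> \<phi> \<omega>" "\<phi> \<omega> \<le> 1" for \<omega>
    unfolding \<phi>_def using Suc.prems(2,3) jump_product_bounds by (auto intro!: mult_le_one)
  note [measurable] = Suc.prems(1) Y_meas[OF rn(1), of 0, simplified] Y_meas[OF rn(3), of 0, simplified]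
  have \<eta>: "\<eta> \<in> borel_measurable (G 0)" "\<And>\<omega>. 0 \<le> \<eta> \<omega>" "\<And>\<omega>. \<eta> \<omega> \<le> 1"
    unfolding \<eta>_def using Suc.prems(2,3) poisson_weight_bounds by (measurable, auto intro!: mult_le_one)
  have "expectation (\<lambda>\<omega>. \<xi> \<omega> * jump_product A (Suc n) (\<lambda>i. X (r i) \<omega>)) =
      expectation (\<lambda>\<omega>. \<phi> \<omega> * indicator (A n) (X (r (Suc n)) \<omega> - X (r n) \<omega>))"
    by (simp add: \<phi>_def jump_product_def mult.assoc)
  also have "\<dots> = expectation (\<lambda>\<omega>. \<phi> \<omega> * poisson_weight (A n) (lam * (Y (r (Suc n)) \<omega> - Y (r n) \<omega>)))"
    by (rule increment_law[OF rn(1,2) \<phi>1 \<phi>2])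
  also have "\<dots> = expectation (\<lambda>\<omega>. \<eta> \<omega> * jump_product A n (\<lambda>i. X (r i) \<omega>))"
    by (simp add: \<phi>_def \<eta>_def ac_simps)
  also have "\<dots> = expectation (\<lambda>\<omega>. \<eta> \<omega> * poisson_product lam A n (\<lambda>i. Y (r i) \<omega>))"
    using Suc.prems by (intro Suc.IH \<eta>) auto
  also have "\<dots> = expectation (\<lambda>\<omega>. \<xi> \<omega> * poisson_product lam A (Suc n) (\<lambda>i. Y (r i) \<omega>))"
    by (simp add: \<eta>_def poisson_product_def ac_simps)
  finally show ?case .
qed

lemma random_times_measurable:
  fixes J :: "'w \<Rightarrow> nat" and g :: "nat \<Rightarrow> real"
  assumes "J \<in> measurable (G 0) (count_space UNIV)" "\<And>j. 0 \<le> g j"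
  shows "(\<lambda>\<omega>. X (g (J \<omega>)) \<omega>) \<in> measurable M (count_space UNIV)"
    and "(\<lambda>\<omega>. Y (g (J \<omega>)) \<omega>) \<in> borel_measurable M"
proof -
  have JM: "J \<in> measurable M (count_space UNIV)" by (rule from_G[OF _ assms(1)]) simp
  show "(\<lambda>\<omega>. X (g (J \<omega>)) \<omega>) \<in> measurable M (count_space UNIV)"
    by (rule measurable_compose_countable[OF _ JM]) (rule X_M[OF assms(2)])
  show "(\<lambda>\<omega>. Y (g (J \<omega>)) \<omega>) \<in> borel_measurable M"
    by (rule measurable_compose_countable[OF _ JM]) (rule Y_M[OF assms(2)])
qed

text \<open>On the event that the indices take the values \<open>js\<close>, the times are
  constants; the event lies in \<open>G 0\<close>, so it can be merged with \<open>C\<close> and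
  \<open>chain_law\<close> applies.\<close>

lemma random_chain_law:
  fixes J :: "nat \<Rightarrow> 'w \<Rightarrow> nat" and g :: "nat \<Rightarrow> nat \<Rightarrow> real"
  assumes C: "C \<in> sets (G 0)"
    and J: "\<And>i. i \<le> n \<Longrightarrow> J i \<in> measurable (G 0) (count_space UNIV)"
    and g: "\<And>i j. 0 \<le> g i j"
    and ord: "AE \<omega> in M. \<forall>i<n. g i (J i \<omega>) \<le> g (Suc i) (J (Suc i) \<omega>)"
  shows "expectation (\<lambda>\<omega>. indicator C \<omega> * jump_product A n (\<lambda>i. X (g i (J i \<omega>)) \<omega>)) =
    expectation (\<lambda>\<omega>. indicator C \<omega> * poisson_product lam A n (\<lambda>i. Y (g i (J i \<omega>)) \<omega>))"
    (is "expectation ?f = expectation ?h")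
proof -
  have CM [measurable]: "C \<in> sets M" using C sub[of 0] by (auto simp: subalgebra_def)
  have fM: "?f \<in> borel_measurable M"
    by (intro borel_measurable_times borel_measurable_indicator CM jump_product_measurable random_times_measurable J g)
  have hM: "?h \<in> borel_measurable M"
    by (intro borel_measurable_times borel_measurable_indicator CM poisson_product_measurable random_times_measurable J g)
  have f01: "0 \<le> ?f \<omega>" "?f \<omega> \<le> 1" and h01: "0 \<le> ?h \<omega>" "?h \<omega> \<le> 1" for \<omega>
    by (auto intro!: mult_le_one mult_nonneg_nonneg jump_product_bounds poisson_product_bounds)
  define Js where "Js \<omega> = map (\<lambda>i. J i \<omega>) [0..<Suc n]" for \<omega>
  have JsG: "Js \<in> measurable (G 0) (count_space UNIV)"
    unfolding Js_def by (rule measurable_nat_list) (rule J, auto)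
  have JsM: "Js \<in> measurable M (count_space UNIV)" by (rule from_G[OF _ JsG]) simp
  have "(\<integral>\<^sup>+\<omega>. ennreal (?f \<omega>) \<partial>M) = (\<integral>\<^sup>+\<omega>. ennreal (?h \<omega>) \<partial>M)"
  proof (rule nn_integral_eq_countable_split[OF JsM])
    show "(\<lambda>\<omega>. ennreal (?f \<omega>)) \<in> borel_measurable M" "(\<lambda>\<omega>. ennreal (?h \<omega>)) \<in> borel_measurable M"
      using fM hM by auto
    fix js
    define D where "D = Js -` {js} \<inter> space (G 0)"
    have D [measurable]: "D \<in> sets (G 0)" "D \<in> sets M"
      using measurable_sets[OF JsG, of "{js}"] sub[of 0] by (auto simp: D_def subalgebra_def)
    have DJ: "J i \<omega> = js ! i" if "\<omega> \<in> D" "i \<le> n" for i \<omega>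
      using that by (auto simp: D_def Js_def simp del: upt_Suc)
    have conv: "(\<integral>\<^sup>+\<omega>. ennreal (k \<omega>) * indicator {\<omega>. Js \<omega> = js} \<omega> \<partial>M) = ennreal (expectation (\<lambda>\<omega>. k \<omega> * indicator D \<omega>))"
      if k: "k \<in> borel_measurable M" "\<And>\<omega>. 0 \<le> k \<omega>" "\<And>\<omega>. k \<omega> \<le> 1" for k
    proof -
      have "integrable M (\<lambda>\<omega>. k \<omega> * indicator D \<omega>)"
        by (rule integrable_unit) (use k in \<open>auto intro!: mult_le_one\<close>)
      then have "ennreal (expectation (\<lambda>\<omega>. k \<omega> * indicator D \<omega>)) = (\<integral>\<^sup>+\<omega>. ennreal (k \<omega> * indicator D \<omega>) \<partial>M)"
        using k by (intro nn_integral_eq_integral[symmetric]) auto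
      also have "\<dots> = (\<integral>\<^sup>+\<omega>. ennreal (k \<omega>) * indicator {\<omega>. Js \<omega> = js} \<omega> \<partial>M)"
        by (intro nn_integral_cong) (auto simp: D_def indicator_def space_G)
      finally show ?thesis by simp
    qed
    have "expectation (\<lambda>\<omega>. ?f \<omega> * indicator D \<omega>) = expectation (\<lambda>\<omega>. ?h \<omega> * indicator D \<omega>)"
    proof (cases "\<forall>i<n. g i (js ! i) \<le> g (Suc i) (js ! Suc i)")
      case True
      define r where "r i = g i (js ! i)" for i
      have CD: "C \<inter> D \<in> sets (G 0)" using C D by auto
      have jp: "jump_product A n (\<lambda>i. X (g i (J i \<omega>)) \<omega>) = jump_product A n (\<lambda>i. X (r i) \<omega>)" if "\<omega> \<in> D" for \<omega>
        by (rule jump_product_cong) (simp add: DJ[OF that] r_def)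
      have pp: "poisson_product lam A n (\<lambda>i. Y (g i (J i \<omega>)) \<omega>) = poisson_product lam A n (\<lambda>i. Y (r i) \<omega>)" if "\<omega> \<in> D" for \<omega>
        by (rule poisson_product_cong) (simp add: DJ[OF that] r_def)
      have "expectation (\<lambda>\<omega>. ?f \<omega> * indicator D \<omega>) =
          expectation (\<lambda>\<omega>. indicator (C \<inter> D) \<omega> * jump_product A n (\<lambda>i. X (r i) \<omega>))"
        by (intro Bochner_Integration.integral_cong) (auto simp: jp split: split_indicator)
      also have "\<dots> = expectation (\<lambda>\<omega>. indicator (C \<inter> D) \<omega> * poisson_product lam A n (\<lambda>i. Y (r i) \<omega>))"
        using True g CD by (intro chain_law) (auto simp: r_def)
      also have "\<dots> = expectation (\<lambda>\<omega>. ?h \<omega> * indicator D \<omega>)"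
        by (intro Bochner_Integration.integral_cong) (auto simp: pp split: split_indicator)
      finally show ?thesis .
    next
      case False
      \<comment> \<open>The order of the times holds almost surely, so an index pattern that
        violates it belongs to a null event and contributes nothing to either side.\<close>
      have "AE \<omega> in M. \<omega> \<notin> D"
        using ord
      proof eventually_elim
        case (elim \<omega>)
        show ?case
        proof
          assume "\<omega> \<in> D"
          then have "\<forall>i\<le>n. J i \<omega> = js ! i" using DJ by blast
          then show False using False elim by (metis Suc_leI less_imp_le)
        qed
      qed
      then show ?thesis
        using fM hM D by (intro integral_cong_AE) (auto elim!: eventually_mono)
    qed
    then show "(\<integral>\<^sup>+\<omega>. ennreal (?f \<omega>) * indicator {\<omega>. Js \<omega> = js} \<omega> \<partial>M) = (\<integral>\<^sup>+\<omega>. ennreal (?h \<omega>) * indicator {\<omega>. Js \<omega> = js} \<omega> \<partial>M)"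
      using conv[OF fM f01] conv[OF hM h01] by simp
  qed
  moreover have "(\<integral>\<^sup>+\<omega>. ennreal (?f \<omega>) \<partial>M) = ennreal (expectation ?f)"
    using f01 by (intro nn_integral_eq_integral integrable_unit fM) auto
  moreover have "(\<integral>\<^sup>+\<omega>. ennreal (?h \<omega>) \<partial>M) = ennreal (expectation ?h)"
    using h01 by (intro nn_integral_eq_integral integrable_unit hM) auto
  moreover have "0 \<le> expectation ?f" "0 \<le> expectation ?h"
    using f01 h01 by (auto intro: integral_nonneg_AE)
  ultimately show ?thesis by simp
qed

text \<open>Bounded convergence from countably valued times. The discrete \<open>X\<close> values
  must be eventually equal to their limits, as indicators are not continuous, whereas for the clock
  values convergence is enough.\<close>

lemma limit_chain_law:
  fixes J :: "nat \<Rightarrow> nat \<Rightarrow> 'w \<Rightarrow> nat" and g :: "nat \<Rightarrow> nat \<Rightarrow> nat \<Rightarrow> real"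
  assumes C: "C \<in> sets (G 0)"
    and J: "\<And>k i. i \<le> n \<Longrightarrow> J k i \<in> measurable (G 0) (count_space UNIV)"
    and g: "\<And>k i j. 0 \<le> g k i j"
    and ord: "\<And>k. AE \<omega> in M. \<forall>i<n. g k i (J k i \<omega>) \<le> g k (Suc i) (J k (Suc i) \<omega>)"
    and x: "\<And>i. i \<le> n \<Longrightarrow> x i \<in> measurable M (count_space UNIV)"
    and y: "\<And>i. i \<le> n \<Longrightarrow> y i \<in> borel_measurable M"
    and x_lim: "\<And>i. i \<le> n \<Longrightarrow> AE \<omega> in M. \<forall>\<^sub>F k in sequentially. X (g k i (J k i \<omega>)) \<omega> = x i \<omega>"
    and y_lim: "\<And>i. i \<le> n \<Longrightarrow> AE \<omega> in M. (\<lambda>k. Y (g k i (J k i \<omega>)) \<omega>) \<longlonglongrightarrow> y i \<omega>"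
  shows "expectation (\<lambda>\<omega>. indicator C \<omega> * jump_product A n (\<lambda>i. x i \<omega>)) =
    expectation (\<lambda>\<omega>. indicator C \<omega> * poisson_product lam A n (\<lambda>i. y i \<omega>))"
    (is "expectation ?f = expectation ?h")
proof -
  define f where "f k \<omega> = indicator C \<omega> * jump_product A n (\<lambda>i. X (g k i (J k i \<omega>)) \<omega>)" for k \<omega>
  define h where "h k \<omega> = indicator C \<omega> * poisson_product lam A n (\<lambda>i. Y (g k i (J k i \<omega>)) \<omega>)" for k \<omega>
  have eq: "expectation (f k) = expectation (h k)" for k
    unfolding f_def h_def by (rule random_chain_law[OF C J g ord])
  have CM: "C \<in> sets M" using C sub[of 0] by (auto simp: subalgebra_def)
  have fk: "f k \<in> borel_measurable M" for k
    unfolding f_def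
    by (intro borel_measurable_times borel_measurable_indicator CM jump_product_measurable random_times_measurable J g)
  have hk: "h k \<in> borel_measurable M" for k
    unfolding h_def
    by (intro borel_measurable_times borel_measurable_indicator CM poisson_product_measurable random_times_measurable J g)
  have fM: "?f \<in> borel_measurable M"
    by (intro borel_measurable_times borel_measurable_indicator CM jump_product_measurable x)
  have hM: "?h \<in> borel_measurable M"
    by (intro borel_measurable_times borel_measurable_indicator CM poisson_product_measurable y)
  have bd: "0 \<le> f k \<omega>" "f k \<omega> \<le> 1" "0 \<le> h k \<omega>" "h k \<omega> \<le> 1" for k \<omega>
    unfolding f_def h_def by (auto intro!: mult_le_one mult_nonneg_nonneg jump_product_bounds poisson_product_bounds)
  have "AE \<omega> in M. \<forall>i\<in>{..n}. \<forall>\<^sub>F k in sequentially. X (g k i (J k i \<omega>)) \<omega> = x i \<omega>"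
    by (rule AE_finite_allI) (use x_lim in auto)
  then have "AE \<omega> in M. (\<lambda>k. f k \<omega>) \<longlonglongrightarrow> ?f \<omega>"
  proof eventually_elim
    case (elim \<omega>)
    then have "\<forall>\<^sub>F k in sequentially. \<forall>i\<in>{..n}. X (g k i (J k i \<omega>)) \<omega> = x i \<omega>"
      by (intro eventually_ball_finite) auto
    then have "\<forall>\<^sub>F k in sequentially. f k \<omega> = ?f \<omega>"
      unfolding f_def by eventually_elim (auto intro!: arg_cong[where f="times (indicator C \<omega>)"] jump_product_cong)
    then show ?case by (rule tendsto_eventually)
  qed
  then have "(\<lambda>k. expectation (f k)) \<longlonglongrightarrow> expectation ?f"
    using bd fk by (intro integral_dominated_convergence[where w="\<lambda>_. 1"] fM) auto
  moreover have "AE \<omega> in M. \<forall>i\<in>{..n}. (\<lambda>k. Y (g k i (J k i \<omega>)) \<omega>) \<longlonglongrightarrow> y i \<omega>"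
    by (rule AE_finite_allI) (use y_lim in auto)
  then have "AE \<omega> in M. (\<lambda>k. h k \<omega>) \<longlonglongrightarrow> ?h \<omega>"
    unfolding h_def by eventually_elim (intro tendsto_mult tendsto_const poisson_product_tendsto, simp)
  then have "(\<lambda>k. expectation (h k)) \<longlonglongrightarrow> expectation ?h"
    using bd hk by (intro integral_dominated_convergence[where w="\<lambda>_. 1"] hM) auto
  ultimately show ?thesis using eq by (intro LIMSEQ_unique[of "\<lambda>k. expectation (f k)"]) auto
qed

end

section \<open>The time-changed process\<close>

lemma measurable_nat_of_real:
  fixes f :: "'a \<Rightarrow> nat"
  assumes "(\<lambda>\<omega>. real (f \<omega>)) \<in> borel_measurable M"
  shows "f \<in> measurable M (count_space UNIV)"
proof -
  have "(\<lambda>\<omega>. \<lfloor>real (f \<omega>)\<rfloor>) \<in> measurable M (count_space UNIV)"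
    using assms by measurable
  then have "(\<lambda>\<omega>. nat \<lfloor>real (f \<omega>)\<rfloor>) \<in> measurable M (count_space UNIV)"
    by (rule measurable_compose) simp
  then show ?thesis by simp
qed

lemma (in prob_space) indep_set_mono:
  assumes "indep_set A B" "A' \<subseteq> A" "B' \<subseteq> B"
  shows "indep_set A' B'"
  using assms unfolding indep_sets2_eq by blast

text \<open>\<open>Bad\<close> collects the exceptional paths in one measurable null set, so that
  the constructions below may be given prescribed values on it.\<close>

locale clock_time_change = clock_compensated +
  fixes L :: "real \<Rightarrow> 'a \<Rightarrow> real" and Bad :: "'a set"
  assumes Bad: "Bad \<in> null_sets M"
    and L_clock: "\<omega> \<in> space M - Bad \<Longrightarrow> clock_path (\<lambda>s. L s \<omega>)"
    and X_path: "\<omega> \<in> space M - Bad \<Longrightarrow> counting_path (\<lambda>t. X t \<omega>)"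
    and Y_inverse: "Y t \<omega> = path_inverse (\<lambda>s. L s \<omega>) t"
begin

text \<open>The level is a random variable because two kinds occur: constants, which define
  \<open>N\<close>, and \<open>Y q\<close>, which tests whether \<open>X q\<close> is recovered. The
  value \<open>0\<close> on \<open>Bad\<close> makes every path of \<open>N\<close> a counting path,
  without exception.\<close>

definition time_change :: "('a \<Rightarrow> real) \<Rightarrow> 'a \<Rightarrow> nat" where
  "time_change U \<omega> = (if \<omega> \<in> space M - Bad then X (L (U \<omega>) \<omega>) \<omega> else 0)"

definition hit :: "nat \<Rightarrow> ('a \<Rightarrow> real) \<Rightarrow> 'a \<Rightarrow> nat" where
  "hit k U \<omega> = dyadic_hit (\<lambda>t. Y t \<omega>) k (U \<omega>)"

lemma hit_inverse: "hit k U \<omega> = dyadic_hit (path_inverse (\<lambda>s. L s \<omega>)) k (U \<omega>)"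
proof -
  have "(\<lambda>t. Y t \<omega>) = path_inverse (\<lambda>s. L s \<omega>)" by (rule ext) (rule Y_inverse)
  then show ?thesis by (simp only: hit_def)
qed

lemma AE_good: "AE \<omega> in M. \<omega> \<in> space M - Bad"
  using AE_not_in[OF Bad] AE_space by eventually_elim simp

lemma hit_measurable:
  assumes [measurable]: "U \<in> borel_measurable (G 0)"
  shows "hit k U \<in> measurable (G 0) (count_space UNIV)"
proof -
  have [measurable]: "Y (real j / 2 ^ k) \<in> borel_measurable (G 0)" for j
    by (rule Y_meas) auto
  show ?thesis unfolding hit_def dyadic_hit_def by measurable
qed

lemma hit_X_eventually:
  assumes "\<omega> \<in> space M - Bad" "0 \<le> U \<omega>"
  shows "\<forall>\<^sub>F k in sequentially. X (real (hit k U \<omega>) / 2 ^ k) \<omega> = time_change U \<omega>"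
  using dyadic_hit_counting[OF L_clock[OF assms(1)] assms(2) X_path[OF assms(1)]] assms(1)
  by (simp add: hit_inverse time_change_def)

text \<open>Measurability is obtained from the clock rather than from \<open>L\<close>: the values
  of \<open>X\<close> at the hits are countable mixtures of measurable variables and converge
  everywhere once set to \<open>0\<close> on \<open>Bad\<close>.\<close>

lemma time_change_measurable:
  assumes U: "U \<in> borel_measurable (G 0)" "\<And>\<omega>. \<omega> \<in> space M - Bad \<Longrightarrow> 0 \<le> U \<omega>"
  shows "time_change U \<in> measurable M (count_space UNIV)"
proof (rule measurable_nat_of_real, rule borel_measurable_LIMSEQ_real)
  define f where "f k \<omega> = (if \<omega> \<in> space M - Bad then real (X (real (hit k U \<omega>) / 2 ^ k) \<omega>) else 0)" for k \<omega>
  show "f k \<in> borel_measurable M" for k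
  proof -
    have "hit k U \<in> measurable M (count_space UNIV)"
      by (rule from_G[OF _ hit_measurable[OF U(1)]]) simp
    then have "(\<lambda>\<omega>. X (real (hit k U \<omega>) / 2 ^ k) \<omega>) \<in> measurable M (count_space UNIV)"
      by (rule measurable_compose_countable[rotated]) (rule X_M, simp)
    then have [measurable]: "(\<lambda>\<omega>. real (X (real (hit k U \<omega>) / 2 ^ k) \<omega>)) \<in> borel_measurable M"
      by (rule measurable_compose) simp
    have [measurable]: "Bad \<in> sets M" using Bad by auto
    show ?thesis unfolding f_def by measurable
  qed
  show "(\<lambda>k. f k \<omega>) \<longlonglongrightarrow> real (time_change U \<omega>)" for \<omega>
  proof (cases "\<omega> \<in> space M - Bad")
    case True
    have "\<forall>\<^sub>F k in sequentially. f k \<omega> = real (time_change U \<omega>)"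
      using hit_X_eventually[of \<omega> U, OF True U(2)[OF True]] by eventually_elim (use True in \<open>simp add: f_def\<close>)
    then show ?thesis by (rule tendsto_eventually)
  next
    case False
    then show ?thesis by (simp only: f_def time_change_def if_False of_nat_0 tendsto_const)
  qed
qed

lemma hit_Y_tendsto:
  assumes "\<omega> \<in> space M - Bad" "0 \<le> U \<omega>"
  shows "(\<lambda>k. Y (real (hit k U \<omega>) / 2 ^ k) \<omega>) \<longlonglongrightarrow> U \<omega>"
  using dyadic_hit_clock_tendsto[OF L_clock[OF assms(1)] assms(2)]
  by (simp add: hit_inverse Y_inverse)

lemma space_in_G: "space M \<in> sets (G 0)"
  using sets.top[of "G 0"] by (simp add: space_G)

text \<open>At the hits of level \<open>u i\<close> the clock tends to the constant
  \<open>u i\<close>, so the mixed Poisson weights become deterministic. The factor \<open>C\<close>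
  then separates, which carries the independence from the clock.\<close>

lemma time_change_law:
  assumes C: "C \<in> sets (G 0)" and u: "0 \<le> u 0" "\<And>i. i < n \<Longrightarrow> u i \<le> u (Suc i)"
  shows "expectation (\<lambda>\<omega>. indicator C \<omega> * jump_product A n (\<lambda>i. time_change (\<lambda>_. u i) \<omega>)) =
    expectation (\<lambda>\<omega>. indicator C \<omega> * poisson_product lam A n u)"
proof -
  have u0: "0 \<le> u i" if "i \<le> n" for i
    using steps_mono[of n u 0 i] u that by auto
  show ?thesis
  proof (rule limit_chain_law[OF C, where J="\<lambda>k i. hit k (\<lambda>_. u i)" and g="\<lambda>k i j. real j / 2 ^ k"
        and x="\<lambda>i. time_change (\<lambda>_. u i)" and y="\<lambda>i _. u i"])
    fix k
    show "AE \<omega> in M. \<forall>i<n. real (hit k (\<lambda>_. u i) \<omega>) / 2 ^ k \<le> real (hit k (\<lambda>_. u (Suc i)) \<omega>) / 2 ^ k"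
      using AE_good
    proof eventually_elim
      case (elim \<omega>)
      show ?case
      proof (intro allI impI divide_right_mono)
        fix i assume i: "i < n"
        show "real (hit k (\<lambda>_. u i) \<omega>) \<le> real (hit k (\<lambda>_. u (Suc i)) \<omega>)"
          unfolding hit_inverse using dyadic_hit_mono[OF L_clock[OF elim]] u0[of i] u(2)[OF i] i by simp
      qed simp
    qed
  next
    fix i assume i: "i \<le> n"
    show "AE \<omega> in M. \<forall>\<^sub>F k in sequentially. X (real (hit k (\<lambda>_. u i) \<omega>) / 2 ^ k) \<omega> = time_change (\<lambda>_. u i) \<omega>"
      using AE_good by eventually_elim (rule hit_X_eventually[of _ "\<lambda>_. u i", OF _ u0[OF i]])
    show "AE \<omega> in M. (\<lambda>k. Y (real (hit k (\<lambda>_. u i) \<omega>) / 2 ^ k) \<omega>) \<longlonglongrightarrow> u i"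
      using AE_good by eventually_elim (rule hit_Y_tendsto[of _ "\<lambda>_. u i", OF _ u0[OF i]])
  qed (auto intro!: hit_measurable time_change_measurable u0)
qed

lemma Y_nonneg: "\<omega> \<in> space M - Bad \<Longrightarrow> 0 \<le> Y t \<omega>"
  unfolding Y_inverse by (rule path_inverse_nonneg[OF L_clock])

lemma le_L_Y: "\<omega> \<in> space M - Bad \<Longrightarrow> t \<le> L (Y t \<omega>) \<omega>"
  unfolding Y_inverse using le_path_inverse[OF L_clock] by simp

text \<open>There are no points of \<open>X\<close> between \<open>q\<close> and the next time at which the clock \<open>Y\<close> moves.\<close>

lemma time_change_Y:
  assumes q: "0 \<le> q"
  shows "AE \<omega> in M. time_change (Y q) \<omega> = X q \<omega>"
proof -
  have Yq: "Y q \<in> borel_measurable (G 0)" by (rule Y_meas) (use q in auto)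
  note tcM = time_change_measurable[OF Yq Y_nonneg]
  \<comment> \<open>Of the two times, index \<open>0\<close> is the constant \<open>q\<close> and
    index \<open>1\<close> the hits of level \<open>Y q\<close>. The clock tends to
    \<open>Y q\<close> at both, which leaves the Poisson parameter \<open>0\<close>.\<close>
  define J where "J k i = (if i = 0 then (\<lambda>_. 0) else hit k (Y q))" for k i :: nat
  define g where "g k i j = (if i = 0 then q else real j / 2 ^ k)" for k i j :: nat
  define x where "x i = (if i = 0 then X q else time_change (Y q))" for i :: nat
  have "expectation (\<lambda>\<omega>. indicator (space M) \<omega> * jump_product (\<lambda>_. {0}) 1 (\<lambda>i. x i \<omega>)) =
    expectation (\<lambda>\<omega>. indicator (space M) \<omega> * poisson_product lam (\<lambda>_. {0}) 1 (\<lambda>_. Y q \<omega>))"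
  proof (rule limit_chain_law[OF space_in_G, where n=1 and A="\<lambda>_. {0}" and J=J and g=g and x=x and y="\<lambda>_. Y q"])
    fix k
    show "AE \<omega> in M. \<forall>i<(1::nat). g k i (J k i \<omega>) \<le> g k (Suc i) (J k (Suc i) \<omega>)"
      using AE_good
    proof eventually_elim
      case (elim \<omega>)
      have "q \<le> L (Y q \<omega>) \<omega>" by (rule le_L_Y[OF elim])
      also have "\<dots> < real (hit k (Y q) \<omega>) / 2 ^ k"
        unfolding hit_inverse by (rule dyadic_hit_bounds(1)[OF L_clock[OF elim] Y_nonneg[OF elim]])
      finally show ?case by (simp add: g_def J_def)
    qed
  next
    fix i :: nat
    show "AE \<omega> in M. \<forall>\<^sub>F k in sequentially. X (g k i (J k i \<omega>)) \<omega> = x i \<omega>"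
      using AE_good
    proof eventually_elim
      case (elim \<omega>)
      show ?case using hit_X_eventually[of \<omega> "Y q", OF elim Y_nonneg[OF elim]] by (cases "i = 0") (simp_all add: g_def J_def x_def)
    qed
    show "AE \<omega> in M. (\<lambda>k. Y (g k i (J k i \<omega>)) \<omega>) \<longlonglongrightarrow> Y q \<omega>"
      using AE_good
    proof eventually_elim
      case (elim \<omega>)
      show ?case using hit_Y_tendsto[of \<omega> "Y q", OF elim Y_nonneg[OF elim]] by (cases "i = 0") (simp_all add: g_def J_def)
    qed
  qed (use q Yq tcM in \<open>auto simp: g_def J_def x_def intro!: hit_measurable X_M Y_M\<close>)
  then have e: "expectation (\<lambda>\<omega>. indicat_real (space M) \<omega> * indicator {0} (time_change (Y q) \<omega> - X q \<omega>)) = 1"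
    by (simp add: x_def jump_product_def poisson_product_def poisson_weight_singleton prob_space)
  have m: "{\<omega> \<in> space M. time_change (Y q) \<omega> - X q \<omega> = 0} \<in> events"
  proof -
    have "(\<lambda>\<omega>. time_change (Y q) \<omega> - X q \<omega>) \<in> measurable M (count_space UNIV)"
      by (rule measurable_nat_diff) (use tcM q in \<open>auto intro!: X_M\<close>)
    then show ?thesis by measurable
  qed
  have "expectation (\<lambda>\<omega>. indicat_real (space M) \<omega> * indicator {0} (time_change (Y q) \<omega> - X q \<omega>)) =
      expectation (indicat_real {\<omega> \<in> space M. time_change (Y q) \<omega> - X q \<omega> = 0})"
    by (intro Bochner_Integration.integral_cong) (auto simp: indicator_def)
  then have "prob {\<omega> \<in> space M. time_change (Y q) \<omega> - X q \<omega> = 0} = 1" using e m by simp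
  then have "AE \<omega> in M. time_change (Y q) \<omega> - X q \<omega> = 0" using m by (simp add: prob_Collect_eq_1)
  then show ?thesis
    using AE_good
  proof eventually_elim
    case (elim \<omega>)
    \<comment> \<open>A truncated difference of \<open>0\<close> only bounds the time-changed value
      by \<open>X q\<close>; the reverse inequality is monotonicity, as
      \<open>q \<le> L (Y q)\<close>.\<close>
    have "mono_on {0..} (\<lambda>t. X t \<omega>)" using X_path[OF elim(2)] by (simp add: counting_path_def)
    then have "X q \<omega> \<le> X (L (Y q \<omega>) \<omega>) \<omega>"
      by (rule mono_onD) (use q le_L_Y[OF elim(2), of q] in auto)
    then show ?case using elim by (simp add: time_change_def)
  qed
qed

text \<open>Rational times are settled by \<open>time_change_Y\<close>. A real \<open>t\<close> is
  compared with a rational just after it at which neither \<open>X\<close> nor \<open>Y\<close> has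
  moved; if the clock starts to move at \<open>t\<close> itself, there is nothing to
  compare.\<close>

lemma X_eq_time_change: "AE \<omega> in M. \<forall>t\<ge>0. X t \<omega> = time_change (Y t) \<omega>"
proof -
  have "AE \<omega> in M. \<forall>q. 0 \<le> real_of_rat q \<longrightarrow> time_change (Y (real_of_rat q)) \<omega> = X (real_of_rat q) \<omega>"
    unfolding AE_all_countable using time_change_Y by auto
  then show ?thesis
    using AE_good
  proof eventually_elim
    case (elim \<omega>)
    show ?case
    proof (intro allI impI)
      fix t :: real assume t: "0 \<le> t"
      \<comment> \<open>\<open>b\<close> is the right end of the flat piece of the clock that
        contains \<open>t\<close>.\<close>
      define b where "b = L (Y t \<omega>) \<omega>"
      have tb: "t \<le> b" unfolding b_def by (rule le_L_Y[OF elim(2)])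
      have "X t \<omega> = X b \<omega>"
      proof (cases "t = b")
        case False
        obtain c where c: "c > t" "\<forall>u. t \<le> u \<and> u < c \<longrightarrow> X u \<omega> = X t \<omega>"
          using counting_path_right_constant[OF X_path[OF elim(2)] t] by blast
        have "t < min b c" using False tb c by simp
        then obtain q where q: "t < real_of_rat q" "real_of_rat q < min b c" using of_rat_dense by blast
        have "Y t \<omega> \<le> Y (real_of_rat q) \<omega>" "Y (real_of_rat q) \<omega> \<le> Y b \<omega>"
          unfolding Y_inverse using q by (auto intro!: path_inverse_mono[OF L_clock[OF elim(2)]])
        moreover have "Y b \<omega> = Y t \<omega>"
          unfolding b_def Y_inverse[of "L _ _"] by (rule path_inverse_clock[OF L_clock[OF elim(2)] Y_nonneg[OF elim(2)]])
        ultimately have Yq: "Y (real_of_rat q) \<omega> = Y t \<omega>" by simp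
        have "X t \<omega> = X (real_of_rat q) \<omega>" using c(2)[rule_format, of "real_of_rat q"] q by simp
        also have "\<dots> = time_change (Y (real_of_rat q)) \<omega>"
        proof -
          have "0 \<le> (real_of_rat q :: real)" using q(1) t by linarith
          then show ?thesis using elim(1)[rule_format, of q] by simp
        qed
        also have "\<dots> = X b \<omega>" using elim(2) by (simp add: time_change_def Yq b_def)
        finally show ?thesis .
      qed simp
      then show "X t \<omega> = time_change (Y t) \<omega>" using elim(2) by (simp add: time_change_def b_def)
    qed
  qed
qed

definition N :: "real \<Rightarrow> 'a \<Rightarrow> nat" where "N u = time_change (\<lambda>_. u)"

lemma N_measurable: "0 \<le> u \<Longrightarrow> N u \<in> measurable M (count_space UNIV)"
  unfolding N_def by (intro time_change_measurable) auto

lemma N_mono: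
  assumes "0 \<le> u" "u \<le> v" shows "N u \<omega> \<le> N v \<omega>"
proof (cases "\<omega> \<in> space M - Bad")
  case True
  have "L u \<omega> \<le> L v \<omega>" using clock_path_mono[OF L_clock[OF True] assms] .
  moreover have "0 \<le> L u \<omega>" using clock_path_nonneg[OF L_clock[OF True] assms(1)] .
  moreover have "mono_on {0..} (\<lambda>t. X t \<omega>)" using X_path[OF True] by (simp add: counting_path_def)
  ultimately have "X (L u \<omega>) \<omega> \<le> X (L v \<omega>) \<omega>" using mono_onD[of "{0..}" "\<lambda>t. X t \<omega>" "L u \<omega>" "L v \<omega>"] by simp
  then show ?thesis using True by (simp add: N_def time_change_def)
next
  case False
  then show ?thesis by (simp only: N_def time_change_def if_False)
qed

lemma N_0: "N 0 \<omega> = 0"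
proof (cases "\<omega> \<in> space M - Bad")
  case True
  have "L 0 \<omega> = 0" using L_clock[OF True] by (simp add: clock_path_def)
  then show ?thesis using X_path[OF True] by (simp add: N_def time_change_def counting_path_def)
next
  case False
  then show ?thesis by (simp only: N_def time_change_def if_False)
qed

text \<open>Right continuity survives the composition because \<open>L v\<close> tends to
  \<open>L u\<close> from above, and \<open>X\<close> is constant immediately after
  \<open>L u\<close>.\<close>

lemma N_counting_path: "counting_path (\<lambda>u. N u \<omega>)"
  unfolding counting_path_def
proof (intro conjI allI impI mono_onI)
  show "N 0 \<omega> = 0" by (rule N_0)
  show "N u \<omega> \<le> N v \<omega>" if "u \<in> {0..}" "v \<in> {0..}" "u \<le> v" for u v
    using that by (intro N_mono) auto
  fix u :: real assume u: "0 \<le> u"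
  have "\<forall>\<^sub>F v in at_right u. N v \<omega> = N u \<omega>"
  proof (cases "\<omega> \<in> space M - Bad")
    case True
    note l = L_clock[OF True]
    obtain b where b: "b > L u \<omega>" "\<forall>v. L u \<omega> \<le> v \<and> v < b \<longrightarrow> X v \<omega> = X (L u \<omega>) \<omega>"
      using counting_path_right_constant[OF X_path[OF True] clock_path_nonneg[OF l u]] by blast
    have "((\<lambda>v. L v \<omega>) \<longlongrightarrow> L u \<omega>) (at_right u)"
      using l u by (auto simp: clock_path_def continuous_within)
    then have "\<forall>\<^sub>F v in at_right u. L v \<omega> < b" using b(1) by (rule order_tendstoD)
    moreover have "\<forall>\<^sub>F v in at_right u. u < v" by (rule eventually_at_right_less)
    ultimately show ?thesis
    proof eventually_elim
      case (elim v)
      have "L u \<omega> \<le> L v \<omega>" using clock_path_mono[OF l u, of v] elim by simp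
      then have "X (L v \<omega>) \<omega> = X (L u \<omega>) \<omega>" using b(2)[rule_format, of "L v \<omega>"] elim by simp
      then show ?case using True by (simp add: N_def time_change_def)
    qed
  next
    case False
    then show ?thesis by (simp only: N_def time_change_def if_False) simp
  qed
  then show "continuous (at_right u) (\<lambda>u. N u \<omega>)"
    unfolding continuous_within by (rule tendsto_eventually)
qed

text \<open>One formula for all that follows: \<open>C = space M\<close> gives the law and
  independence of the increments, a general \<open>C\<close> their independence from the
  clock.\<close>

lemma N_increments_prob:
  assumes C: "C \<in> sets (G 0)" and u: "0 \<le> u 0" "\<And>i. i < n \<Longrightarrow> u i \<le> u (Suc i)"
  shows "prob {\<omega> \<in> space M. \<omega> \<in> C \<and> (\<forall>i<n. N (u (Suc i)) \<omega> - N (u i) \<omega> \<in> A i)} =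
    prob C * poisson_product lam A n u"
    and "{\<omega> \<in> space M. \<omega> \<in> C \<and> (\<forall>i<n. N (u (Suc i)) \<omega> - N (u i) \<omega> \<in> A i)} \<in> events"
proof -
  let ?D = "{\<omega> \<in> space M. \<omega> \<in> C \<and> (\<forall>i<n. N (u (Suc i)) \<omega> - N (u i) \<omega> \<in> A i)}"
  have CM [measurable]: "C \<in> sets M" using C sub[of 0] by (auto simp: subalgebra_def)
  have u0: "0 \<le> u i" if "i \<le> n" for i
    using steps_mono[of n u 0 i] u that by auto
  have "{\<omega> \<in> space M. \<forall>i\<in>{..<n}. N (u (Suc i)) \<omega> - N (u i) \<omega> \<in> A i} \<in> events"
  proof (rule sets.sets_Collect_finite_All)
    fix i assume "i \<in> {..<n}"
    then have "(\<lambda>\<omega>. N (u (Suc i)) \<omega> - N (u i) \<omega>) \<in> measurable M (count_space UNIV)"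
      by (intro measurable_nat_diff N_measurable u0) auto
    then show "{\<omega> \<in> space M. N (u (Suc i)) \<omega> - N (u i) \<omega> \<in> A i} \<in> events" by measurable
  qed simp
  then have "C \<inter> {\<omega> \<in> space M. \<forall>i\<in>{..<n}. N (u (Suc i)) \<omega> - N (u i) \<omega> \<in> A i} \<in> events"
    by (intro sets.Int CM)
  also have "C \<inter> {\<omega> \<in> space M. \<forall>i\<in>{..<n}. N (u (Suc i)) \<omega> - N (u i) \<omega> \<in> A i} = ?D" by auto
  finally show D: "?D \<in> events" .
  have "prob B = expectation (indicat_real B)" if "B \<in> events" for B
    using that by simp
  from this[OF D] have "prob ?D = expectation (indicat_real ?D)" .
  also have "\<dots> = expectation (\<lambda>\<omega>. indicator C \<omega> * jump_product A n (\<lambda>i. N (u i) \<omega>))"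
    unfolding jump_product_eq by (intro Bochner_Integration.integral_cong) (auto simp: indicator_def)
  also have "\<dots> = expectation (\<lambda>\<omega>. indicator C \<omega> * poisson_product lam A n u)"
    unfolding N_def by (rule time_change_law[OF C u])
  also have "\<dots> = prob C * poisson_product lam A n u" by simp
  finally show "prob ?D = prob C * poisson_product lam A n u" .
qed

lemma N_increment_prob:
  assumes "0 \<le> s" "s \<le> t"
  shows "prob {\<omega> \<in> space M. N t \<omega> - N s \<omega> \<in> A} = poisson_weight A (lam * (t - s))"
proof -
  have "prob {\<omega> \<in> space M. \<omega> \<in> space M \<and> (\<forall>i<1. N (if Suc i = 0 then s else t) \<omega> - N (if i = 0 then s else t) \<omega> \<in> A)} =
    prob (space M) * poisson_product lam (\<lambda>_. A) 1 (\<lambda>i. if i = 0 then s else t)"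
    by (rule N_increments_prob(1)[OF space_in_G, of "\<lambda>i. if i = 0 then s else t" 1 "\<lambda>_. A"]) (use assms in auto)
  then show ?thesis by (simp add: poisson_product_def prob_space)
qed

lemma N_independent_increments: "independent_increments M (\<lambda>t \<omega>. real (N t \<omega>))"
  unfolding independent_increments_def
proof (intro allI impI)
  fix n :: nat and t :: "nat \<Rightarrow> real"
  assume t0: "0 \<le> t 0" and ts: "\<forall>i<n. t i \<le> t (Suc i)"
  have t: "0 \<le> t i" if "i \<le> n" for i
    using steps_mono[of n t 0 i] t0 ts that by auto
  let ?D = "\<lambda>i \<omega>. N (t (Suc i)) \<omega> - N (t i) \<omega>"
  show "indep_vars (\<lambda>_. borel) (\<lambda>i \<omega>. real (N (t (Suc i)) \<omega>) - real (N (t i) \<omega>)) {..<n}"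
  \<comment> \<open>The empty family is treated apart because an empty intersection is the whole
    type rather than \<open>space M\<close>.\<close>
  proof (cases "n = 0")
    case True
    then show ?thesis by (simp add: indep_vars_def indep_sets_def)
  next
    case False
    have rv: "?D i \<in> measurable M (count_space UNIV)" if "i \<in> {..<n}" for i
      using that by (intro measurable_nat_diff N_measurable t) auto
    have "indep_vars (\<lambda>_. count_space UNIV) ?D {..<n}"
    proof (subst indep_vars_finite[where E="\<lambda>_. UNIV"])
      show "\<forall>A\<in>{..<n} \<rightarrow> UNIV. prob (\<Inter>j\<in>{..<n}. ?D j -` A j \<inter> space M) = (\<Prod>j\<in>{..<n}. prob (?D j -` A j \<inter> space M))"
      proof
        fix A :: "nat \<Rightarrow> nat set"
        have "(\<Inter>j\<in>{..<n}. ?D j -` A j \<inter> space M) = {\<omega> \<in> space M. \<omega> \<in> space M \<and> (\<forall>i<n. ?D i \<omega> \<in> A i)}"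
          using False by auto
        then have "prob (\<Inter>j\<in>{..<n}. ?D j -` A j \<inter> space M) = (\<Prod>i<n. poisson_weight (A i) (lam * (t (Suc i) - t i)))"
          using N_increments_prob(1)[OF space_in_G, of t n A] t0 ts by (simp add: poisson_product_def prob_space)
        also have "\<dots> = (\<Prod>i<n. prob (?D i -` A i \<inter> space M))"
        proof (intro prod.cong refl)
          fix i assume "i \<in> {..<n}"
          then show "poisson_weight (A i) (lam * (t (Suc i) - t i)) = prob (?D i -` A i \<inter> space M)"
            using N_increment_prob[of "t i" "t (Suc i)" "A i"] t[of i] ts
            by (simp add: vimage_def Int_def conj_commute)
        qed
        finally show "prob (\<Inter>j\<in>{..<n}. ?D j -` A j \<inter> space M) = (\<Prod>j\<in>{..<n}. prob (?D j -` A j \<inter> space M))" .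
      qed
    qed (use False rv in \<open>auto simp: Int_stable_def intro: sigma_sets.Basic\<close>)
    then have "indep_vars (\<lambda>_. borel) (\<lambda>i. real \<circ> ?D i) {..<n}"
      by (rule indep_vars_compose) simp
    also have "?this \<longleftrightarrow> ?thesis"
    proof (intro indep_vars_cong refl)
      fix i assume "i \<in> {..<n}"
      then show "real \<circ> ?D i = (\<lambda>\<omega>. real (N (t (Suc i)) \<omega>) - real (N (t i) \<omega>))"
        using N_mono[OF t, of i "t (Suc i)"] ts by (auto simp: fun_eq_iff)
    qed
    finally show ?thesis .
  qed
qed

lemma N_poisson_process:
  assumes "0 < lam"
  shows "poisson_process M lam N"
  unfolding poisson_process_def
proof (intro conjI allI impI N_independent_increments)
  show "point_process M N" unfolding point_process_def using N_measurable N_counting_path by auto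
  fix s t :: real assume st: "0 \<le> s" "s < t"
  have rv: "(\<lambda>\<omega>. N t \<omega> - N s \<omega>) \<in> measurable M (count_space UNIV)"
    using st by (intro measurable_nat_diff N_measurable) auto
  have pos: "0 < lam * (t - s)" using assms st by simp
  show "distr M (count_space UNIV) (\<lambda>\<omega>. N t \<omega> - N s \<omega>) = measure_pmf (poisson_pmf (lam * (t - s)))"
  proof (rule measure_eqI_countable[where A=UNIV])
    fix k
    have "emeasure (distr M (count_space UNIV) (\<lambda>\<omega>. N t \<omega> - N s \<omega>)) {k} = ennreal (prob {\<omega> \<in> space M. N t \<omega> - N s \<omega> \<in> {k}})"
      using rv by (simp add: emeasure_distr emeasure_eq_measure vimage_def Int_def conj_commute)
    also have "\<dots> = ennreal (pmf (poisson_pmf (lam * (t - s))) k)"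
      using N_increment_prob[of s t "{k}"] st pos by (simp add: poisson_weight_singleton)
    finally show "emeasure (distr M (count_space UNIV) (\<lambda>\<omega>. N t \<omega> - N s \<omega>)) {k} = emeasure (measure_pmf (poisson_pmf (lam * (t - s)))) {k}"
      by (simp add: emeasure_pmf_single)
  qed auto
qed

text \<open>Since \<open>N\<close> starts at \<open>0\<close>, its values at the cylinder times are
  sums of increments. Splitting by the vector \<open>Js\<close> of all increments reduces the claim
  to \<open>N_increments_prob\<close> with singletons.\<close>

lemma N_cylinder_indep:
  assumes ps: "\<forall>p\<in>set ps. 0 \<le> fst p" and C: "C \<in> sets (G 0)"
  shows "prob (cylinder M N ps \<inter> C) = prob (cylinder M N ps) * prob C"
proof -
  have CM [measurable]: "C \<in> sets M" using C sub[of 0] by (auto simp: subalgebra_def)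
  note [measurable] = cylinder_sets[OF ps N_measurable]
  obtain n t where t0: "t 0 = (0 :: real)" and ts: "\<And>i. i < n \<Longrightarrow> t i \<le> t (Suc i)"
    and tS: "\<And>r. r \<in> fst ` set ps \<Longrightarrow> \<exists>j\<le>n. r = t j"
    by (rule finite_times_enumeration[of "fst ` set ps"]) (use ps in auto)
  have t: "0 \<le> t i" if "i \<le> n" for i
    using steps_mono[of n t 0 i] t0 ts that by auto
  define Js where "Js \<omega> = map (\<lambda>i. N (t (Suc i)) \<omega> - N (t i) \<omega>) [0..<n]" for \<omega>
  have Nsum: "N (t j) \<omega> = (\<Sum>i<j. Js \<omega> ! i)" if "j \<le> n" for j \<omega>
    using that
  proof (induction j)
    case 0
    then show ?case by (simp add: t0 N_0)
  next
    case (Suc j)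
    then have "N (t j) \<omega> \<le> N (t (Suc j)) \<omega>" by (intro N_mono t ts) auto
    then show ?case using Suc by (simp add: Js_def)
  qed
  have D_eq: "{\<omega> \<in> space M. \<omega> \<in> B \<and> Js \<omega> = v} =
      {\<omega> \<in> space M. \<omega> \<in> B \<and> (\<forall>i<n. N (t (Suc i)) \<omega> - N (t i) \<omega> \<in> {v ! i})}" if "length v = n" for B v
    using that unfolding Js_def by (auto simp: list_eq_iff_nth_eq)
  have JsM [measurable]: "Js \<in> measurable M (count_space UNIV)"
    unfolding Js_def by (rule measurable_nat_list, rule measurable_nat_diff; rule N_measurable, rule t) auto
  have "(\<integral>\<^sup>+\<omega>. indicator (cylinder M N ps \<inter> C) \<omega> \<partial>M) = (\<integral>\<^sup>+\<omega>. ennreal (prob C) * indicator (cylinder M N ps) \<omega> \<partial>M)"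
  proof (rule nn_integral_eq_countable_split[OF JsM])
    fix v
    define D where "D = {\<omega> \<in> space M. Js \<omega> = v}"
    have [measurable]: "D \<in> events" unfolding D_def by measurable
    have l: "(\<integral>\<^sup>+\<omega>. indicator (cylinder M N ps \<inter> C) \<omega> * indicator {\<omega>. Js \<omega> = v} \<omega> \<partial>M) = ennreal (prob (cylinder M N ps \<inter> C \<inter> D))"
    proof -
      have "(\<integral>\<^sup>+\<omega>. indicator (cylinder M N ps \<inter> C) \<omega> * indicator {\<omega>. Js \<omega> = v} \<omega> \<partial>M) =
        (\<integral>\<^sup>+\<omega>. indicator (cylinder M N ps \<inter> C \<inter> D) \<omega> \<partial>M)"
        by (intro nn_integral_cong) (auto simp: D_def indicator_def)
      then show ?thesis by (simp add: emeasure_eq_measure)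
    qed
    have r: "(\<integral>\<^sup>+\<omega>. ennreal (prob C) * indicator (cylinder M N ps) \<omega> * indicator {\<omega>. Js \<omega> = v} \<omega> \<partial>M) =
        ennreal (prob C * prob (cylinder M N ps \<inter> D))"
    proof -
      have "(\<integral>\<^sup>+\<omega>. ennreal (prob C) * indicator (cylinder M N ps) \<omega> * indicator {\<omega>. Js \<omega> = v} \<omega> \<partial>M) =
        (\<integral>\<^sup>+\<omega>. ennreal (prob C) * indicator (cylinder M N ps \<inter> D) \<omega> \<partial>M)"
        by (intro nn_integral_cong) (auto simp: D_def indicator_def)
      then show ?thesis by (simp add: nn_integral_cmult emeasure_eq_measure ennreal_mult)
    qed
    have "prob (cylinder M N ps \<inter> C \<inter> D) = prob C * prob (cylinder M N ps \<inter> D)"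
    \<comment> \<open>The increments decide membership in the cylinder, so \<open>D\<close> is
      either contained in it or disjoint from it.\<close>
    proof (cases "length v = n \<and> D \<subseteq> cylinder M N ps")
      case True
      then have v: "length v = n" by simp
      have e: "cylinder M N ps \<inter> C \<inter> D = {\<omega> \<in> space M. \<omega> \<in> C \<and> Js \<omega> = v}" "cylinder M N ps \<inter> D = {\<omega> \<in> space M. \<omega> \<in> space M \<and> Js \<omega> = v}"
        using True unfolding D_def by auto
      show ?thesis
        unfolding e D_eq[OF v] using N_increments_prob(1)[OF C, of t n "\<lambda>i. {v ! i}"]
          N_increments_prob(1)[OF space_in_G, of t n "\<lambda>i. {v ! i}"] t0 ts by (simp add: prob_space)
    next
      case False
      have "cylinder M N ps \<inter> D = {}"
      proof (rule ccontr)
        assume "cylinder M N ps \<inter> D \<noteq> {}"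
        then obtain \<omega> where \<omega>: "\<omega> \<in> cylinder M N ps" "\<omega> \<in> D" by blast
        have "length v = n" using \<omega> by (auto simp: D_def Js_def)
        moreover have "D \<subseteq> cylinder M N ps"
        proof
          fix \<omega>' assume \<omega>': "\<omega>' \<in> D"
          have "N (fst p) \<omega>' \<in> snd p" if p: "p \<in> set ps" for p
          proof -
            obtain j where j: "j \<le> n" "fst p = t j" using tS[of "fst p"] p by auto
            have "N (fst p) \<omega>' = N (fst p) \<omega>"
              using \<omega>(2) \<omega>' by (simp add: j(2) Nsum[OF j(1)] D_def)
            then show ?thesis using \<omega>(1) p by (simp add: cylinder_def)
          qed
          then show "\<omega>' \<in> cylinder M N ps" using \<omega>' by (simp add: cylinder_def D_def)
        qed
        ultimately show False using False by blast
      qed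
      moreover from this have "cylinder M N ps \<inter> C \<inter> D = {}" by blast
      ultimately show ?thesis by (simp only: measure_empty mult_zero_right)
    qed
    then show "(\<integral>\<^sup>+\<omega>. indicator (cylinder M N ps \<inter> C) \<omega> * indicator {\<omega>. Js \<omega> = v} \<omega> \<partial>M) =
      (\<integral>\<^sup>+\<omega>. ennreal (prob C) * indicator (cylinder M N ps) \<omega> * indicator {\<omega>. Js \<omega> = v} \<omega> \<partial>M)"
      using l r by simp
  qed measurable
  then have "ennreal (prob (cylinder M N ps \<inter> C)) = ennreal (prob C * prob (cylinder M N ps))"
    by (simp add: nn_integral_cmult emeasure_eq_measure ennreal_mult)
  then show ?thesis by (simp add: mult.commute)
qed

text \<open>Independence extends from the intersection-stable family of cylinders to the
  sigma-algebra that they generate. That one contains all path events of \<open>N\<close>, and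
  \<open>G 0\<close> contains those of \<open>Y\<close>.\<close>

lemma N_Y_independent: "independent_processes M (\<lambda>t \<omega>. real (N t \<omega>)) Y"
  unfolding independent_processes_def indep_var_eq
proof (intro conjI)
  let ?N = "\<lambda>\<omega>. \<lambda>t\<in>{0..}. real (N t \<omega>)" and ?Y = "\<lambda>\<omega>. \<lambda>t\<in>{0..}. Y t \<omega>"
  show NM: "?N \<in> measurable M (PiM {0..} (\<lambda>_. borel))"
    by (intro measurable_restrict measurable_compose[OF N_measurable]) auto
  show YM: "?Y \<in> measurable M (PiM {0..} (\<lambda>_. borel))"
    by (intro measurable_restrict Y_M) auto
  define Cyl where "Cyl = {cylinder M N ps | ps. \<forall>p\<in>set ps. 0 \<le> fst p}"
  have Cyl_sub: "Cyl \<subseteq> Pow (space M)" by (auto simp: Cyl_def cylinder_def)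
  have "indep_set Cyl (sets (G 0))"
    unfolding indep_sets2_eq
  proof (intro conjI ballI)
    show "Cyl \<subseteq> events" by (auto simp: Cyl_def intro!: cylinder_sets N_measurable)
    show "sets (G 0) \<subseteq> events" using sub[of 0] by (auto simp: subalgebra_def)
    fix a b assume "a \<in> Cyl" "b \<in> sets (G 0)"
    then show "prob (a \<inter> b) = prob a * prob b" using N_cylinder_indep by (auto simp: Cyl_def)
  qed
  moreover have "Int_stable Cyl"
    unfolding Int_stable_def Cyl_def
  proof safe
    fix ps qs :: "(real \<times> nat set) list"
    assume "\<forall>p\<in>set ps. 0 \<le> fst p" "\<forall>p\<in>set qs. 0 \<le> fst p"
    then show "\<exists>rs. cylinder M N ps \<inter> cylinder M N qs = cylinder M N rs \<and> (\<forall>p\<in>set rs. 0 \<le> fst p)"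
      by (intro exI[of _ "ps @ qs"]) (auto simp: cylinder_def)
  qed
  moreover have "Int_stable (sets (G 0))" by (auto simp: Int_stable_def)
  ultimately have ind: "indep_set (sigma_sets (space M) Cyl) (sigma_sets (space M) (sets (G 0)))"
    by (rule indep_set_sigma_sets)
  have 1: "{?N -` A \<inter> space M | A. A \<in> sets (PiM {0..} (\<lambda>_. borel))} \<subseteq> sigma_sets (space M) Cyl"
  proof -
    define S where "S = sigma (space M) Cyl"
    have S: "space S = space M" "sets S = sigma_sets (space M) Cyl"
      using Cyl_sub by (auto simp: S_def)
    have "?N \<in> measurable S (PiM {0..} (\<lambda>_. borel))"
    proof (rule measurable_restrict)
      fix t :: real assume t: "t \<in> {0..}"
      show "(\<lambda>\<omega>. real (N t \<omega>)) \<in> borel_measurable S"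
      proof (rule measurableI)
        fix A :: "real set" assume "A \<in> sets borel"
        have "(\<lambda>\<omega>. real (N t \<omega>)) -` A \<inter> space S = cylinder M N [(t, real -` A)]"
          by (auto simp: cylinder_def S)
        also have "\<dots> \<in> sets S"
          unfolding S using t by (intro sigma_sets.Basic) (auto simp: Cyl_def intro!: exI[of _ "[(t, real -` A)]"])
        finally show "(\<lambda>\<omega>. real (N t \<omega>)) -` A \<inter> space S \<in> sets S" .
      qed simp
    qed
    then show ?thesis using measurable_sets[of ?N S] by (auto simp: S)
  qed
  have 2: "{?Y -` A \<inter> space M | A. A \<in> sets (PiM {0..} (\<lambda>_. borel))} \<subseteq> sigma_sets (space M) (sets (G 0))"
  proof -
    have "?Y \<in> measurable (G 0) (PiM {0..} (\<lambda>_. borel))"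
      by (intro measurable_restrict Y_meas) auto
    then have "?Y -` A \<inter> space M \<in> sets (G 0)" if "A \<in> sets (PiM {0..} (\<lambda>_. borel))" for A
      using measurable_sets[of ?Y "G 0" "PiM {0..} (\<lambda>_. borel)" A] that by (simp add: space_G)
    then show ?thesis by (auto intro: sigma_sets.Basic)
  qed
  have G0: "sets (G 0) \<subseteq> Pow (space M)" using sets.space_closed[of "G 0"] by (simp add: space_G)
  have 3: "sigma_sets (space M) {?N -` A \<inter> space M | A. A \<in> sets (PiM {0..} (\<lambda>_. borel))} \<subseteq> sigma_sets (space M) Cyl"
    using sigma_sets_mono'[OF 1, of "space M"] unfolding sigma_sets_sigma_sets_eq[OF Cyl_sub] .
  have 4: "sigma_sets (space M) {?Y -` A \<inter> space M | A. A \<in> sets (PiM {0..} (\<lambda>_. borel))} \<subseteq> sigma_sets (space M) (sets (G 0))"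
    using sigma_sets_mono'[OF 2, of "space M"] unfolding sigma_sets_sigma_sets_eq[OF G0] .
  show "indep_set (sigma_sets (space M) {?N -` A \<inter> space M | A. A \<in> sets (PiM {0..} (\<lambda>_. borel))})
      (sigma_sets (space M) {?Y -` A \<inter> space M | A. A \<in> sets (PiM {0..} (\<lambda>_. borel))})"
    by (rule indep_set_mono[OF ind 3 4])
qed

end

section \<open>The filtration of the martingale\<close>

lemma space_fpp_filtration: "space (fpp_filtration P X Y t) = space P"
  by (auto simp: fpp_filtration_def space_measure_of_conv)

lemma sets_fpp_filtration:
  "sets (fpp_filtration P X Y t) = sigma_sets (space P)
     ({X s -` A \<inter> space P | s A. 0 \<le> s \<and> ennreal s \<le> t} \<union>
      {Y s -` B \<inter> space P | s B. 0 \<le> s \<and> B \<in> sets borel})"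
  unfolding fpp_filtration_def by (rule sets_measure_of) auto

lemma fpp_filtration_X:
  assumes "0 \<le> s" "ennreal s \<le> t"
  shows "X s \<in> measurable (fpp_filtration P X Y t) (count_space UNIV)"
proof (rule measurableI)
  fix A
  show "X s -` A \<inter> space (fpp_filtration P X Y t) \<in> sets (fpp_filtration P X Y t)"
    unfolding space_fpp_filtration sets_fpp_filtration using assms by (intro sigma_sets.Basic) blast
qed simp

lemma fpp_filtration_Y:
  assumes "0 \<le> s"
  shows "Y s \<in> borel_measurable (fpp_filtration P X Y t)"
proof (rule measurableI)
  fix A :: "real set" assume "A \<in> sets borel"
  then show "Y s -` A \<inter> space (fpp_filtration P X Y t) \<in> sets (fpp_filtration P X Y t)"
    unfolding space_fpp_filtration sets_fpp_filtration using assms by (intro sigma_sets.Basic) blast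
qed simp

lemma fpp_filtration_mono:
  "s \<le> t \<Longrightarrow> sets (fpp_filtration P X Y s) \<subseteq> sets (fpp_filtration P X Y t)"
  unfolding sets_fpp_filtration by (intro sigma_sets_mono') (blast intro: order_trans)

lemma fpp_filtration_subalgebra:
  assumes "\<And>s. 0 \<le> s \<Longrightarrow> X s \<in> measurable P (count_space UNIV)"
    and "\<And>s. 0 \<le> s \<Longrightarrow> Y s \<in> borel_measurable P"
  shows "subalgebra P (fpp_filtration P X Y t)"
  unfolding subalgebra_def space_fpp_filtration sets_fpp_filtration
  by (intro conjI refl sets.sigma_sets_subset) (use assms in \<open>auto intro: measurable_sets\<close>)

section \<open>From the compensated martingale to the fractional Poisson process\<close>

context prob_space
begin

text \<open>The tail estimate uses \<open>s = 1 / t\<close>, so \<open>t = 0\<close> is added by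
  hand: the clock starts at \<open>0\<close>.\<close>

lemma inverse_subordinator_integrable_nonneg:
  assumes L: "stable_subordinator M \<alpha> L" and \<alpha>: "0 < \<alpha>" and t: "0 \<le> t"
    and m: "inverse_subordinator L t \<in> borel_measurable M"
  shows "integrable M (inverse_subordinator L t)"
proof (cases "t = 0")
  case True
  show ?thesis
  proof (rule integrable_const_bound[of _ 0])
    show "AE \<omega> in M. norm (inverse_subordinator L t \<omega>) \<le> 0"
      using stable_subordinator_clock_path[OF L \<alpha>]
      by eventually_elim (simp add: True inverse_subordinator_eq path_inverse_0)
  qed (rule m)
next
  case False
  then show ?thesis using t by (intro inverse_subordinator_integrable[OF L \<alpha> _ m]) auto
qed

lemma fractional_poisson_of_martingale:
  assumes X: "simple_locally_finite_point_process M X" and lam_pos: "0 < lam"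
    and \<alpha>: "0 < \<alpha>" "\<alpha> < 1" and L: "stable_subordinator M \<alpha> L"
    and mart: "martingale M (fpp_filtration M X (inverse_subordinator L))
      (\<lambda>t \<omega>. real (X t \<omega>) - lam * inverse_subordinator L t \<omega>)"
  shows "fractional_poisson_process M X"
proof -
  define Y where "Y = inverse_subordinator L"
  define G where "G t = fpp_filtration M X Y (ennreal t)" for t
  have sub: "subalgebra M (G t)" for t
    using mart by (simp add: martingale_def G_def Y_def)
  have Xm: "X s \<in> measurable (G t) (count_space UNIV)" if "0 \<le> s" "s \<le> t" for s t
    unfolding G_def using that by (intro fpp_filtration_X ennreal_leI)
  have Ym: "Y s \<in> borel_measurable (G t)" if "0 \<le> s" for s t
    unfolding G_def using that by (rule fpp_filtration_Y)
  have Y_int: "integrable M (Y t)" if t: "0 \<le> t" for t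
    unfolding Y_def using measurable_from_subalg[OF sub Ym[OF t]]
    by (intro inverse_subordinator_integrable_nonneg[OF L \<alpha>(1) t]) (simp add: Y_def)
  \<comment> \<open>The martingale property makes only the difference integrable; the clock,
    integrable by its own tails, is added back.\<close>
  have X_int: "integrable M (\<lambda>\<omega>. real (X t \<omega>))" if t: "0 \<le> t" for t
  proof -
    have "integrable M (\<lambda>\<omega>. real (X t \<omega>) - lam * Y t \<omega>)" using mart t by (simp add: martingale_def Y_def)
    then have "integrable M (\<lambda>\<omega>. (real (X t \<omega>) - lam * Y t \<omega>) + lam * Y t \<omega>)"
      using Y_int[OF t] by (intro Bochner_Integration.integrable_add) auto
    then show ?thesis by simp
  qed
  have Xc: "AE \<omega> in M. counting_path (\<lambda>t. X t \<omega>)" and Xu: "AE \<omega> in M. unit_jumps (\<lambda>t. X t \<omega>)"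
    using X by (auto simp: simple_locally_finite_point_process_def point_process_def)
  note clock = stable_subordinator_clock_path[OF L \<alpha>(1)]
  have "AE \<omega> in M. clock_path (\<lambda>s. L s \<omega>) \<and> counting_path (\<lambda>t. X t \<omega>)"
    using clock Xc by eventually_elim simp
  \<comment> \<open>The set of exceptional paths is covered by a measurable null set, which takes
    its place from here on.\<close>
  then obtain Bad where Bad: "{\<omega> \<in> space M. \<not> (clock_path (\<lambda>s. L s \<omega>) \<and> counting_path (\<lambda>t. X t \<omega>))} \<subseteq> Bad"
    "emeasure M Bad = 0" "Bad \<in> sets M"
    by (rule AE_E)
  interpret clock_time_change M G X Y lam L Bad
  proof unfold_locales
    show "sets (G s) \<subseteq> sets (G t)" if "0 \<le> s" "s \<le> t" for s t
      unfolding G_def using that by (intro fpp_filtration_mono ennreal_leI)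
    show "AE \<omega> in M. real_cond_exp M (G s) (\<lambda>\<omega>. real (X t \<omega>) - lam * Y t \<omega>) \<omega> = real (X s \<omega>) - lam * Y s \<omega>"
      if "0 \<le> s" "s \<le> t" for s t
      using mart that unfolding martingale_def G_def Y_def by blast
    show "AE \<omega> in M. continuous_on {0..} (\<lambda>t. Y t \<omega>)"
      using clock by eventually_elim (simp add: Y_def inverse_subordinator_eq path_inverse_continuous_on)
    show "AE \<omega> in M. mono_on {0..} (\<lambda>t. Y t \<omega>)"
      using clock by eventually_elim (auto simp: Y_def inverse_subordinator_eq intro!: mono_onI path_inverse_mono)
    show "Bad \<in> null_sets M" using Bad by auto
    show "Y t \<omega> = path_inverse (\<lambda>s. L s \<omega>) t" for t \<omega> by (simp add: Y_def inverse_subordinator_eq)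
  qed (use lam_pos sub Xm Ym X_int Y_int Xc Xu Bad in auto)
  have "fractional_poisson_process_with M \<alpha> lam X"
    unfolding fractional_poisson_process_with_def
  proof (intro exI conjI)
    show "poisson_process M lam N" by (rule N_poisson_process[OF lam_pos])
    show "stable_subordinator M \<alpha> L" by (rule L)
    show "independent_processes M (\<lambda>t \<omega>. real (N t \<omega>)) (inverse_subordinator L)"
      using N_Y_independent by (simp add: Y_def)
    show "AE \<omega> in M. \<forall>t\<ge>0. X t \<omega> = N (inverse_subordinator L t \<omega>) \<omega>"
      using X_eq_time_change by eventually_elim (simp add: N_def time_change_def Y_def)
  qed
  then show ?thesis unfolding fractional_poisson_process_def using \<alpha> lam_pos by blast
qed

text \<open>Dynkin's argument: sets over which \<open>h\<close> integrates to \<open>0\<close> are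
  closed under complements, thanks to \<open>space M \<in> E\<close>, and under countable disjoint
  unions.\<close>

lemma integral_zero_on_generated:
  fixes h :: "'a \<Rightarrow> real"
  assumes E: "Int_stable E" "E \<subseteq> sets M" "space M \<in> E" and h: "integrable M h"
    and zero: "\<And>A. A \<in> E \<Longrightarrow> (\<integral>\<omega>\<in>A. h \<omega> \<partial>M) = 0" and A: "A \<in> sigma_sets (space M) E"
  shows "(\<integral>\<omega>\<in>A. h \<omega> \<partial>M) = 0"
proof -
  have sub: "E \<subseteq> Pow (space M)" using E(2) sets.space_closed by blast
  have ss: "B \<in> sets M" if "B \<in> sigma_sets (space M) E" for B
    using sets.sigma_sets_subset[OF E(2)] that by blast
  have si: "set_integrable M B h" if "B \<in> sets M" for B
    using h that unfolding set_integrable_def by (rule integrable_mult_indicator[rotated])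
  show ?thesis
  proof (rule sigma_sets_induct_disjoint[OF E(1) sub A])
    fix B assume B: "B \<in> sigma_sets (space M) E" "(\<integral>\<omega>\<in>B. h \<omega> \<partial>M) = 0"
    note [measurable] = ss[OF B(1)]
    have "(\<integral>\<omega>\<in>(space M - B) \<union> B. h \<omega> \<partial>M) = (\<integral>\<omega>\<in>space M - B. h \<omega> \<partial>M) + (\<integral>\<omega>\<in>B. h \<omega> \<partial>M)"
      by (rule set_integral_Un) (use si in auto)
    moreover have "(space M - B) \<union> B = space M" using sets.sets_into_space[OF ss[OF B(1)]] by auto
    ultimately show "(\<integral>\<omega>\<in>space M - B. h \<omega> \<partial>M) = 0" using zero[OF E(3)] B(2) by simp
  next
    fix B :: "nat \<Rightarrow> 'a set"
    assume B: "disjoint_family B" "range B \<subseteq> sigma_sets (space M) E" "\<And>i. (\<integral>\<omega>\<in>B i. h \<omega> \<partial>M) = 0"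
    have Bs: "B i \<in> sets M" for i using B(2) ss by blast
    have "(\<integral>\<omega>\<in>(\<Union>i. B i). h \<omega> \<partial>M) = (\<Sum>i. \<integral>\<omega>\<in>B i. h \<omega> \<partial>M)"
      by (rule lebesgue_integral_countable_add) (use B(1) Bs si in \<open>auto simp: disjoint_family_on_def\<close>)
    then show "(\<integral>\<omega>\<in>(\<Union>i. B i). h \<omega> \<partial>M) = 0" using B(3) by simp
  qed (use zero in \<open>auto simp: set_lebesgue_integral_def\<close>)
qed

end

text \<open>The factor \<open>k\<close> cancels one factor of the factorial, which shifts the
  exponential series by one and pulls out \<open>\<mu>\<close>.\<close>

lemma poisson_pmf_mean:
  assumes "0 < \<mu>"
  shows "(\<integral>\<^sup>+k. ennreal (real k) \<partial>measure_pmf (poisson_pmf \<mu>)) = ennreal \<mu>"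
proof -
  let ?f = "\<lambda>k. \<mu> ^ k / fact k * exp (- \<mu>) * real k"
  have "(\<lambda>k. \<mu> ^ k / fact k) sums exp \<mu>"
    using exp_converges[of \<mu>] by (simp add: divide_inverse mult.commute)
  then have "(\<lambda>k. \<mu> ^ k / fact k * (\<mu> * exp (- \<mu>))) sums (exp \<mu> * (\<mu> * exp (- \<mu>)))" by (rule sums_mult2)
  moreover have "\<mu> ^ k / fact k * (\<mu> * exp (- \<mu>)) = ?f (Suc k)" for k
  proof -
    have "\<mu> ^ Suc k / fact (Suc k) * real (Suc k) = \<mu> ^ Suc k / fact k"
      by (simp add: fact_Suc del: of_nat_Suc)
    then have "\<mu> ^ Suc k / fact (Suc k) * real (Suc k) * exp (- \<mu>) = \<mu> ^ Suc k / fact k * exp (- \<mu>)" by (rule arg_cong)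
    moreover have "?f (Suc k) = \<mu> ^ Suc k / fact (Suc k) * real (Suc k) * exp (- \<mu>)" by (simp only: ac_simps)
    ultimately show ?thesis by simp
  qed
  moreover have "exp \<mu> * (\<mu> * exp (- \<mu>)) = \<mu>" by (simp add: exp_minus)
  ultimately have "(\<lambda>k. ?f (Suc k)) sums \<mu>" by (simp only:)
  then have s: "?f sums \<mu>" by (subst (asm) sums_Suc_iff) simp
  have "(\<integral>\<^sup>+k. ennreal (real k) \<partial>measure_pmf (poisson_pmf \<mu>)) = (\<Sum>k. ennreal (?f k))"
    using assms by (simp add: nn_integral_measure_pmf nn_integral_count_space_nat ennreal_mult''[symmetric])
  also have "\<dots> = ennreal \<mu>"
    using assms by (subst suminf_ennreal2) (use s in \<open>auto dest: sums_summable sums_unique[symmetric]\<close>)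
  finally show ?thesis .
qed

section \<open>Poisson processes subordinated to an independent clock\<close>

lemma counting_path_mono: "counting_path x \<Longrightarrow> 0 \<le> a \<Longrightarrow> a \<le> b \<Longrightarrow> x a \<le> x b"
  unfolding counting_path_def using mono_onD[of "{0..}" x a b] by auto

text \<open>The successor makes the rounded value strictly larger than \<open>y\<close>, also when
  \<open>y\<close> is itself dyadic.\<close>

definition dyadic_num :: "nat \<Rightarrow> real \<Rightarrow> nat" where
  "dyadic_num k y = Suc (nat \<lfloor>2 ^ k * y\<rfloor>)"

definition dyadic_up :: "nat \<Rightarrow> real \<Rightarrow> real" where
  "dyadic_up k y = real (dyadic_num k y) / 2 ^ k"

lemma dyadic_up_bounds:
  assumes "0 \<le> y"
  shows "y < dyadic_up k y" "dyadic_up k y \<le> y + 1 / 2 ^ k"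
proof -
  have "0 \<le> \<lfloor>2 ^ k * y\<rfloor>" using assms by simp
  then have n: "real (dyadic_num k y) = real_of_int \<lfloor>2 ^ k * y\<rfloor> + 1" by (simp add: dyadic_num_def)
  have "2 ^ k * y < real (dyadic_num k y)" "real (dyadic_num k y) \<le> 2 ^ k * y + 1"
    unfolding n by linarith+
  then show "y < dyadic_up k y" "dyadic_up k y \<le> y + 1 / 2 ^ k"
    by (simp_all add: dyadic_up_def field_simps)
qed

lemma dyadic_up_mono: "x \<le> y \<Longrightarrow> dyadic_up k x \<le> dyadic_up k y"
  unfolding dyadic_up_def dyadic_num_def
  by (intro divide_right_mono) (auto intro!: nat_mono floor_mono)

text \<open>The integer above \<open>y\<close> is also a dyadic number of level \<open>k\<close>
  above \<open>y\<close>, while \<open>dyadic_up k y\<close> is the least such. Level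
  \<open>0\<close> thus dominates all levels, as the later convergence arguments require.\<close>

lemma dyadic_up_le_0:
  assumes "0 \<le> y"
  shows "dyadic_up k y \<le> dyadic_up 0 y"
proof -
  have y: "y < real (dyadic_num 0 y)" using dyadic_up_bounds(1)[OF assms, of 0] by (simp add: dyadic_up_def)
  have "2 ^ k * y < real (2 ^ k * dyadic_num 0 y)" using y by simp
  then have "\<lfloor>2 ^ k * y\<rfloor> < int (2 ^ k * dyadic_num 0 y)" by (subst floor_less_iff) simp
  moreover have "nat z < K" if "z < int K" "0 < K" for z K using that by linarith
  moreover have "0 < 2 ^ k * dyadic_num 0 y" by (simp add: dyadic_num_def)
  ultimately have "nat \<lfloor>2 ^ k * y\<rfloor> < 2 ^ k * dyadic_num 0 y" by blast
  then have "dyadic_num k y \<le> 2 ^ k * dyadic_num 0 y" unfolding dyadic_num_def[of k] Suc_le_eq .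
  then have "real (dyadic_num k y) \<le> real (2 ^ k * dyadic_num 0 y)" by (simp only: of_nat_le_iff)
  then show ?thesis by (simp add: dyadic_up_def field_simps)
qed

lemma dyadic_up_tendsto: "0 \<le> y \<Longrightarrow> (\<lambda>k. dyadic_up k y) \<longlonglongrightarrow> y"
  by (rule dyadic_approx_tendsto[OF dyadic_up_bounds])

lemma dyadic_up_counting:
  assumes "counting_path x" "0 \<le> y"
  shows "\<forall>\<^sub>F k in sequentially. x (dyadic_up k y) = x y"
  by (rule dyadic_approx_counting[OF assms dyadic_up_bounds[OF assms(2)]])

locale subordinated_poisson = prob_space M for M :: "'w measure" +
  fixes N :: "real \<Rightarrow> 'w \<Rightarrow> nat" and L :: "real \<Rightarrow> 'w \<Rightarrow> real" and X :: "real \<Rightarrow> 'w \<Rightarrow> nat" and \<alpha> lam :: real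
  assumes lam: "0 < lam" and \<alpha>: "0 < \<alpha>"
    and poisson: "poisson_process M lam N"
    and stable: "stable_subordinator M \<alpha> L"
    and indep: "independent_processes M (\<lambda>t \<omega>. real (N t \<omega>)) (inverse_subordinator L)"
    and X_eq: "AE \<omega> in M. \<forall>t\<ge>0. X t \<omega> = N (inverse_subordinator L t \<omega>) \<omega>"
    and X_M: "0 \<le> t \<Longrightarrow> X t \<in> measurable M (count_space UNIV)"
    and X_counting: "AE \<omega> in M. counting_path (\<lambda>t. X t \<omega>)"
begin

abbreviation Y :: "real \<Rightarrow> 'w \<Rightarrow> real" where "Y \<equiv> inverse_subordinator L"

definition N_path :: "'w \<Rightarrow> real \<Rightarrow> real" where "N_path \<omega> = (\<lambda>t\<in>{0..}. real (N t \<omega>))"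
definition Y_path :: "'w \<Rightarrow> real \<Rightarrow> real" where "Y_path \<omega> = (\<lambda>t\<in>{0..}. Y t \<omega>)"

lemma path_indep:
  "indep_var (PiM {0..} (\<lambda>_. borel)) N_path (PiM {0..} (\<lambda>_. borel)) Y_path"
  using indep unfolding independent_processes_def N_path_def[abs_def] Y_path_def[abs_def] .

lemma Y_path_M: "Y_path \<in> measurable M (PiM {0..} (\<lambda>_. borel))"
  using path_indep by (rule indep_var_rv2)

text \<open>A pullback under the path map, so that each event of the clock is a path event to which
  \<open>path_indep\<close> applies.\<close>

definition YA :: "'w measure" where "YA = vimage_algebra (space M) Y_path (PiM {0..} (\<lambda>_. borel))"

lemma space_YA: "space YA = space M" by (simp add: YA_def)

lemma Y_path_YA: "Y_path \<in> measurable YA (PiM {0..} (\<lambda>_. borel))"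
  unfolding YA_def by (rule measurable_vimage_algebra1) (use measurable_space[OF Y_path_M] in auto)

lemma YA_sets:
  assumes "C \<in> sets YA"
  obtains B where "B \<in> sets (PiM {0..} (\<lambda>_. borel))" "C = Y_path -` B \<inter> space M"
  using assms unfolding YA_def
  by (subst (asm) sets_vimage_algebra2) (use measurable_space[OF Y_path_M] in auto)

lemma YA_sub: "subalgebra M YA"
  unfolding subalgebra_def
  using space_YA YA_sets measurable_sets[OF Y_path_M] by (metis subsetI)

lemma Y_YA: "0 \<le> t \<Longrightarrow> Y t \<in> borel_measurable YA"
proof -
  assume t: "0 \<le> t"
  have "(\<lambda>\<omega>. Y_path \<omega> t) \<in> borel_measurable YA"
    by (rule measurable_compose[OF Y_path_YA measurable_component_singleton]) (use t in simp)
  then show ?thesis using t by (simp add: Y_path_def)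
qed

lemma Y_M: "0 \<le> t \<Longrightarrow> Y t \<in> borel_measurable M"
  by (rule measurable_from_subalg[OF YA_sub Y_YA])

lemma N_M: "0 \<le> t \<Longrightarrow> N t \<in> measurable M (count_space UNIV)"
  using poisson by (simp add: poisson_process_def point_process_def)

lemma Y_int: "0 \<le> t \<Longrightarrow> integrable M (Y t)"
  by (rule inverse_subordinator_integrable_nonneg[OF stable \<alpha> _ Y_M])

lemma AE_paths: "AE \<omega> in M. clock_path (\<lambda>s. L s \<omega>) \<and> counting_path (\<lambda>t. N t \<omega>) \<and> (\<forall>t\<ge>0. X t \<omega> = N (Y t \<omega>) \<omega>)"
proof -
  have "AE \<omega> in M. counting_path (\<lambda>t. N t \<omega>)"
    using poisson by (simp add: poisson_process_def point_process_def)
  with stable_subordinator_clock_path[OF stable \<alpha>] X_eq show ?thesis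
    by eventually_elim simp
qed

lemma Y_nonneg: "clock_path (\<lambda>s. L s \<omega>) \<Longrightarrow> 0 \<le> Y t \<omega>"
  by (simp add: inverse_subordinator_eq path_inverse_nonneg)

lemma Y_mono: "clock_path (\<lambda>s. L s \<omega>) \<Longrightarrow> s \<le> t \<Longrightarrow> Y s \<omega> \<le> Y t \<omega>"
  by (simp add: inverse_subordinator_eq path_inverse_mono)

lemma N_increment:
  assumes "0 \<le> s" "s \<le> t"
  shows "integrable M (\<lambda>\<omega>. real (N t \<omega>) - real (N s \<omega>))"
    and "expectation (\<lambda>\<omega>. real (N t \<omega>) - real (N s \<omega>)) = lam * (t - s)"
proof -
  have Nr: "(\<lambda>\<omega>. real (N u \<omega>)) \<in> borel_measurable M" if "u \<ge> 0" for u
    by (rule measurable_compose[OF N_M[OF that]]) simp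
  have m: "(\<lambda>\<omega>. N t \<omega> - N s \<omega>) \<in> measurable M (count_space UNIV)"
    using assms by (intro measurable_nat_diff N_M) auto
  have ae: "AE \<omega> in M. real (N t \<omega>) - real (N s \<omega>) = real (N t \<omega> - N s \<omega>)"
    using AE_paths
  proof eventually_elim
    case (elim \<omega>)
    then have "N s \<omega> \<le> N t \<omega>" using counting_path_mono[of "\<lambda>t. N t \<omega>" s t] assms by simp
    then show ?case by (simp add: of_nat_diff)
  qed
  have nn: "(\<integral>\<^sup>+\<omega>. ennreal (real (N t \<omega> - N s \<omega>)) \<partial>M) = ennreal (lam * (t - s))"
  \<comment> \<open>The Poisson law is prescribed for \<open>s < t\<close>; for equal times both
    sides are \<open>0\<close>.\<close>
  proof (cases "s = t")
    case False
    then have st: "0 \<le> s" "s < t" using assms by auto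
    have "(\<integral>\<^sup>+\<omega>. ennreal (real (N t \<omega> - N s \<omega>)) \<partial>M) =
        (\<integral>\<^sup>+k. ennreal (real k) \<partial>distr M (count_space UNIV) (\<lambda>\<omega>. N t \<omega> - N s \<omega>))"
      using m by (subst nn_integral_distr) auto
    also have "\<dots> = (\<integral>\<^sup>+k. ennreal (real k) \<partial>measure_pmf (poisson_pmf (lam * (t - s))))"
      using poisson st unfolding poisson_process_def by simp
    also have "\<dots> = ennreal (lam * (t - s))" using st lam by (intro poisson_pmf_mean) simp
    finally show ?thesis .
  qed simp
  have m': "(\<lambda>\<omega>. real (N t \<omega> - N s \<omega>)) \<in> borel_measurable M" by (rule measurable_compose[OF m]) simp
  have i: "integrable M (\<lambda>\<omega>. real (N t \<omega> - N s \<omega>))"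
    by (rule integrableI_nonneg[OF m']) (auto simp: nn)
  have e: "expectation (\<lambda>\<omega>. real (N t \<omega> - N s \<omega>)) = lam * (t - s)"
    using nn lam assms by (subst integral_eq_nn_integral[OF m']) auto
  have md: "(\<lambda>\<omega>. real (N t \<omega>) - real (N s \<omega>)) \<in> borel_measurable M" using assms by (intro borel_measurable_diff Nr) auto
  show "integrable M (\<lambda>\<omega>. real (N t \<omega>) - real (N s \<omega>))"
    using i md ae by (subst integrable_cong_AE[OF md m' ae])
  show "expectation (\<lambda>\<omega>. real (N t \<omega>) - real (N s \<omega>)) = lam * (t - s)"
    using e by (subst integral_cong_AE[OF md m' ae])
qed

text \<open>Almost surely the cylinder indicator is a function of increments before
  \<open>b\<close>. These form a block disjoint from the increment over \<open>[b, a]\<close>, so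
  the expectation factorises.\<close>

lemma N_past_increment:
  assumes ba: "0 \<le> b" "b \<le> a" and ps: "\<forall>p\<in>set ps. 0 \<le> fst p \<and> fst p \<le> b"
  shows "expectation (\<lambda>\<omega>. (real (N a \<omega>) - real (N b \<omega>)) * indicator (cylinder M N ps) \<omega>) = lam * (a - b) * prob (cylinder M N ps)"
proof -
  obtain n t where t0: "t 0 = (0 :: real)" and ts: "\<And>i. i < n \<Longrightarrow> t i \<le> t (Suc i)"
    and tS: "\<And>r. r \<in> fst ` set ps \<Longrightarrow> \<exists>j\<le>n. r = t j"
    and tin: "\<And>i. i \<le> n \<Longrightarrow> t i \<in> insert 0 (fst ` set ps)"
    by (rule finite_times_enumeration[of "fst ` set ps"]) (use ps in auto)
  have tb: "0 \<le> t i" "t i \<le> b" if "i \<le> n" for i using tin[OF that] ps ba by auto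
  \<comment> \<open>The sorted times are continued by \<open>b\<close> and then \<open>a\<close>, so
    the increment from \<open>b\<close> to \<open>a\<close> has the index \<open>Suc n\<close> and
    those before it fill \<open>{..<Suc n}\<close>.\<close>
  define u where "u i = (if i \<le> n then t i else if i = Suc n then b else a)" for i
  let ?I = "\<lambda>i \<omega>. real (N (u (Suc i)) \<omega>) - real (N (u i) \<omega>)"
  have um: "u i \<le> u (Suc i)" if "i < Suc (Suc n)" for i
    using that ts[of i] tb[of i] ba by (auto simp: u_def)
  have iv: "indep_vars (\<lambda>_. borel) ?I {..<Suc (Suc n)}"
  proof -
    have *: "\<forall>(n::nat) (t::nat \<Rightarrow> real). 0 \<le> t 0 \<longrightarrow> (\<forall>i<n. t i \<le> t (Suc i)) \<longrightarrow>
        indep_vars (\<lambda>_. borel) (\<lambda>i \<omega>. real (N (t (Suc i)) \<omega>) - real (N (t i) \<omega>)) {..<n}"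
      using poisson unfolding poisson_process_def independent_increments_def by (rule conjunct1[OF conjunct2])
    show ?thesis by (rule *[rule_format]) (use um t0 in \<open>auto simp: u_def\<close>)
  qed
  have "\<exists>f. \<forall>p\<in>set ps. f p \<le> n \<and> fst p = t (f p)"
    using tS by (intro bchoice) auto
  then obtain idx where idx: "\<And>p. p \<in> set ps \<Longrightarrow> idx p \<le> n" "\<And>p. p \<in> set ps \<Longrightarrow> fst p = t (idx p)" by blast
  let ?A = "{..<Suc n}"
  \<comment> \<open>The sum of the first \<open>idx p\<close> increments rebuilds
    \<open>N (fst p)\<close>, since the enumeration starts at time \<open>0\<close>. The sets are
    mapped by \<open>real\<close> because increments are real-valued here.\<close>
  define f where "f w = (\<Prod>p\<in>set ps. indicator (real ` snd p) (\<Sum>i<idx p. w i) :: real)" for w :: "nat \<Rightarrow> real"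
  have realA: "real ` (A :: nat set) \<in> sets borel" for A
    by (rule sets.countable) auto
  have fm: "f \<in> borel_measurable (PiM ?A (\<lambda>_. borel))"
    unfolding f_def
  proof (rule borel_measurable_prod)
    fix p assume "p \<in> set ps"
    then have [measurable]: "(\<lambda>w. \<Sum>i<idx p. w i) \<in> borel_measurable (PiM ?A (\<lambda>_. borel :: real measure))"
      using idx(1)[of p] by (intro borel_measurable_sum measurable_component_singleton) auto
    note [measurable] = realA[of "snd p"]
    show "(\<lambda>w. indicator (real ` snd p) (\<Sum>i<idx p. w i) :: real) \<in> borel_measurable (PiM ?A (\<lambda>_. borel))"
      by measurable
  qed
  have f01: "0 \<le> f w" "f w \<le> 1" for w
    unfolding f_def by (auto intro!: prod_nonneg prod_le_1)
  have gm: "(\<lambda>w. w (Suc n)) \<in> borel_measurable (PiM {Suc n} (\<lambda>_. borel))"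
    by (rule measurable_component_singleton) simp
  let ?f = "f \<circ> (\<lambda>\<omega>. restrict (\<lambda>i. ?I i \<omega>) ?A)"
  let ?g = "(\<lambda>w. w (Suc n)) \<circ> (\<lambda>\<omega>. restrict (\<lambda>i. ?I i \<omega>) {Suc n})"
  have ind: "indep_var borel ?g borel ?f"
    by (rule indep_var_compose[OF indep_var_restrict[OF iv] gm fm]) auto
  have g_eq: "?g = (\<lambda>\<omega>. real (N a \<omega>) - real (N b \<omega>))" by (auto simp: u_def fun_eq_iff)
  have fM: "?f \<in> borel_measurable M" using ind by (rule indep_var_rv2)
  have f_int: "integrable M ?f" by (rule integrable_unit[OF fM]) (simp_all add: f01)
  have f_ae: "AE \<omega> in M. ?f \<omega> = indicator (cylinder M N ps) \<omega>"
    using AE_paths AE_space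
  proof eventually_elim
    case (elim \<omega>)
    have N0: "N 0 \<omega> = 0" using elim by (simp add: counting_path_def)
    have tele: "(\<Sum>i<j. ?I i \<omega>) = real (N (t j) \<omega>)" if "j \<le> n" for j
      using sum_lessThan_telescope[of "\<lambda>i. real (N (u i) \<omega>)" j] that by (simp add: u_def t0 N0)
    have "?f \<omega> = (\<Prod>p\<in>set ps. indicator (snd p) (N (fst p) \<omega>))"
      unfolding f_def comp_def
    proof (intro prod.cong refl)
      fix p assume p: "p \<in> set ps"
      have "(\<Sum>i<idx p. restrict (\<lambda>i. ?I i \<omega>) ?A i) = (\<Sum>i<idx p. ?I i \<omega>)"
        using idx(1)[OF p] by (intro sum.cong) auto
      also have "\<dots> = real (N (fst p) \<omega>)" using tele[OF idx(1)[OF p]] idx(2)[OF p] by simp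
      finally have s: "(\<Sum>i<idx p. restrict (\<lambda>i. ?I i \<omega>) ?A i) = real (N (fst p) \<omega>)" .
      show "indicator (real ` snd p) (\<Sum>i<idx p. restrict (\<lambda>i. ?I i \<omega>) ?A i) = (indicator (snd p) (N (fst p) \<omega>) :: real)"
        unfolding s by (auto simp: indicator_def)
    qed
    also have "\<dots> = indicator (cylinder M N ps) \<omega>"
      using elim(2) by (auto simp: cylinder_def indicator_def)
    finally show ?case .
  qed
  have cyl: "cylinder M N ps \<in> events" using ps by (intro cylinder_sets N_M) auto
  have gi: "integrable M ?g" unfolding g_eq by (rule N_increment(1)[OF ba])
  have "expectation (\<lambda>\<omega>. ?g \<omega> * ?f \<omega>) = expectation ?g * expectation ?f"
    by (rule indep_var_lebesgue_integral[OF ind gi f_int])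
  moreover have "expectation ?g = lam * (a - b)" unfolding g_eq by (rule N_increment(2)[OF ba])
  moreover have "expectation ?f = expectation (indicat_real (cylinder M N ps))"
    by (rule integral_cong_AE[OF fM _ f_ae]) (use cyl in simp)
  moreover have "expectation (indicat_real (cylinder M N ps)) = prob (cylinder M N ps)" using cyl by simp
  moreover have "expectation (\<lambda>\<omega>. ?g \<omega> * ?f \<omega>) = expectation (\<lambda>\<omega>. (real (N a \<omega>) - real (N b \<omega>)) * indicator (cylinder M N ps) \<omega>)"
  proof (rule integral_cong_AE)
    have gM: "?g \<in> borel_measurable M" using gi by (rule borel_measurable_integrable)
    show "(\<lambda>\<omega>. ?g \<omega> * ?f \<omega>) \<in> borel_measurable M" using gM fM by (rule borel_measurable_times)
    show "(\<lambda>\<omega>. (real (N a \<omega>) - real (N b \<omega>)) * indicator (cylinder M N ps) \<omega>) \<in> borel_measurable M"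
      by (intro borel_measurable_times borel_measurable_indicator cyl gM[unfolded g_eq])
    show "AE \<omega> in M. ?g \<omega> * ?f \<omega> = (real (N a \<omega>) - real (N b \<omega>)) * indicator (cylinder M N ps) \<omega>"
      using f_ae by eventually_elim (simp only: g_eq)
  qed
  ultimately show ?thesis by simp
qed

text \<open>The increment and the cylinder depend on the path of \<open>N\<close>, the event
  \<open>C\<close> on the path of \<open>Y\<close>. Independence of the paths splits off
  \<open>prob C\<close>, and applied once more to the cylinder alone it puts the factor
  back.\<close>

lemma N_past_increment_clock:
  assumes ba: "0 \<le> b" "b \<le> a" and ps: "\<forall>p\<in>set ps. 0 \<le> fst p \<and> fst p \<le> b" and C: "C \<in> sets YA"
  shows "expectation (\<lambda>\<omega>. (real (N a \<omega>) - real (N b \<omega>)) * indicator (cylinder M N ps \<inter> C) \<omega>) = lam * (a - b) * prob (cylinder M N ps \<inter> C)"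
    and "integrable M (\<lambda>\<omega>. (real (N a \<omega>) - real (N b \<omega>)) * indicator (cylinder M N ps \<inter> C) \<omega>)"
proof -
  obtain B where B: "B \<in> sets (PiM {0..} (\<lambda>_. borel))" "C = Y_path -` B \<inter> space M" by (rule YA_sets[OF C])
  have CM: "C \<in> events" using C YA_sub by (auto simp: subalgebra_def)
  have cyl: "cylinder M N ps \<in> events" using ps by (intro cylinder_sets N_M) auto
  have realA: "real ` (A :: nat set) \<in> sets borel" for A by (rule sets.countable) auto
  define k where "k w = (\<Prod>p\<in>set ps. indicator (real ` snd p) (w (fst p)) :: real)" for w :: "real \<Rightarrow> real"
  have km: "k \<in> borel_measurable (PiM {0..} (\<lambda>_. borel))"
    unfolding k_def
  proof (rule borel_measurable_prod)
    fix p assume "p \<in> set ps"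
    then have [measurable]: "(\<lambda>w. w (fst p)) \<in> borel_measurable (PiM {0..} (\<lambda>_. borel :: real measure))"
      using ps by (intro measurable_component_singleton) auto
    note [measurable] = realA[of "snd p"]
    show "(\<lambda>w. indicator (real ` snd p) (w (fst p)) :: real) \<in> borel_measurable (PiM {0..} (\<lambda>_. borel))"
      by measurable
  qed
  have km2: "(\<lambda>w. (w a - w b) * k w) \<in> borel_measurable (PiM {0..} (\<lambda>_. borel))"
    using ba by (intro borel_measurable_times km borel_measurable_diff measurable_component_singleton) auto
  have bm: "indicat_real B \<in> borel_measurable (PiM {0..} (\<lambda>_. borel))" using B(1) by simp
  have k_eq: "k (N_path \<omega>) = indicator (cylinder M N ps) \<omega>" if "\<omega> \<in> space M" for \<omega>
  proof -
    have "k (N_path \<omega>) = (\<Prod>p\<in>set ps. indicator (snd p) (N (fst p) \<omega>))"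
      unfolding k_def using ps by (intro prod.cong) (auto simp: N_path_def indicator_def)
    also have "\<dots> = indicator (cylinder M N ps) \<omega>" using that by (auto simp: cylinder_def indicator_def)
    finally show ?thesis .
  qed
  have d_eq: "(N_path \<omega> a - N_path \<omega> b) = real (N a \<omega>) - real (N b \<omega>)" for \<omega>
    using ba by (simp add: N_path_def)
  have b_eq: "indicat_real B (Y_path \<omega>) = indicator C \<omega>" if "\<omega> \<in> space M" for \<omega>
    using that B(2) by (simp add: indicator_def)
  let ?d = "\<lambda>\<omega>. real (N a \<omega>) - real (N b \<omega>)"
  have i1: "integrable M (\<lambda>\<omega>. ?d \<omega> * indicator (cylinder M N ps) \<omega>)"
    using integrable_mult_indicator[OF cyl N_increment(1)[OF ba]] by (simp add: mult.commute)
  have i1': "integrable M ((\<lambda>w. (w a - w b) * k w) \<circ> N_path)"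
    by (rule Bochner_Integration.integrable_cong[THEN iffD2, OF refl _ i1]) (simp add: comp_def d_eq k_eq)
  have i2: "integrable M (indicat_real B \<circ> Y_path)"
    by (rule Bochner_Integration.integrable_cong[THEN iffD2, OF refl, of _ _ "indicat_real C"])
      (use CM in \<open>auto simp: b_eq emeasure_eq_measure\<close>)
  have ind: "indep_var borel ((\<lambda>w. (w a - w b) * k w) \<circ> N_path) borel (indicat_real B \<circ> Y_path)"
    by (rule indep_var_compose[OF path_indep km2 bm])
  have ind2: "indep_var borel (k \<circ> N_path) borel (indicat_real B \<circ> Y_path)"
    by (rule indep_var_compose[OF path_indep km bm])
  have i3: "integrable M (k \<circ> N_path)"
    by (rule Bochner_Integration.integrable_cong[THEN iffD2, OF refl, of _ _ "indicat_real (cylinder M N ps)"])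
      (use cyl in \<open>auto simp: k_eq emeasure_eq_measure\<close>)
  have c1: "?d \<omega> * indicator (cylinder M N ps \<inter> C) \<omega> = ((\<lambda>w. (w a - w b) * k w) \<circ> N_path) \<omega> * (indicat_real B \<circ> Y_path) \<omega>"
    if "\<omega> \<in> space M" for \<omega>
    using that by (simp add: d_eq k_eq b_eq indicator_inter_arith)
  have c2: "indicat_real (cylinder M N ps \<inter> C) \<omega> = (k \<circ> N_path) \<omega> * (indicat_real B \<circ> Y_path) \<omega>"
    if "\<omega> \<in> space M" for \<omega>
    using that by (simp add: k_eq b_eq indicator_inter_arith)
  have e2: "expectation (indicat_real B \<circ> Y_path) = prob C"
    using CM by (subst Bochner_Integration.integral_cong[OF refl, of _ _ "indicat_real C"]) (auto simp: b_eq)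
  have e3: "expectation (k \<circ> N_path) = prob (cylinder M N ps)"
    using cyl by (subst Bochner_Integration.integral_cong[OF refl, of _ _ "indicat_real (cylinder M N ps)"]) (auto simp: k_eq)
  have "prob (cylinder M N ps \<inter> C) = expectation (indicat_real (cylinder M N ps \<inter> C))" using cyl CM by simp
  also have "\<dots> = expectation (\<lambda>\<omega>. (k \<circ> N_path) \<omega> * (indicat_real B \<circ> Y_path) \<omega>)"
    by (rule Bochner_Integration.integral_cong[OF refl c2])
  also have "\<dots> = prob (cylinder M N ps) * prob C"
    unfolding indep_var_lebesgue_integral[OF ind2 i3 i2] e2 e3 ..
  finally have p: "prob (cylinder M N ps \<inter> C) = prob (cylinder M N ps) * prob C" .
  have e1: "expectation ((\<lambda>w. (w a - w b) * k w) \<circ> N_path) = lam * (a - b) * prob (cylinder M N ps)"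
    unfolding N_past_increment[OF ba ps, symmetric]
    by (rule Bochner_Integration.integral_cong) (simp_all add: d_eq k_eq)
  have "expectation (\<lambda>\<omega>. ?d \<omega> * indicator (cylinder M N ps \<inter> C) \<omega>) =
      expectation (\<lambda>\<omega>. ((\<lambda>w. (w a - w b) * k w) \<circ> N_path) \<omega> * (indicat_real B \<circ> Y_path) \<omega>)"
    by (rule Bochner_Integration.integral_cong[OF refl c1])
  also have "\<dots> = lam * (a - b) * prob (cylinder M N ps \<inter> C)"
    unfolding indep_var_lebesgue_integral[OF ind i1' i2] e1 e2 p by simp
  finally show "expectation (\<lambda>\<omega>. ?d \<omega> * indicator (cylinder M N ps \<inter> C) \<omega>) = lam * (a - b) * prob (cylinder M N ps \<inter> C)" .
  show "integrable M (\<lambda>\<omega>. ?d \<omega> * indicator (cylinder M N ps \<inter> C) \<omega>)"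
    using integrable_mult_indicator[OF sets.Int[OF cyl CM] N_increment(1)[OF ba]] by (simp add: mult.commute)
qed

end

section \<open>Processes at rounded times, almost sure limits and domination\<close>

lemma dyadic_num_measurable:
  assumes [measurable]: "f \<in> borel_measurable M"
  shows "(\<lambda>\<omega>. dyadic_num k (f \<omega>)) \<in> measurable M (count_space UNIV)"
proof -
  have "(\<lambda>\<omega>. \<lfloor>2 ^ k * f \<omega>\<rfloor>) \<in> measurable M (count_space UNIV)" by measurable
  then show ?thesis unfolding dyadic_num_def by (rule measurable_compose) simp
qed

text \<open>The rounded time takes countably many values, so measurability of each
  \<open>Z u\<close> passes to the composition.\<close>

lemma measurable_at_dyadic_up:
  assumes "f \<in> borel_measurable M" "\<And>u. 0 \<le> u \<Longrightarrow> Z u \<in> measurable M N"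
  shows "(\<lambda>\<omega>. Z (dyadic_up k (f \<omega>)) \<omega>) \<in> measurable M N"
  unfolding dyadic_up_def
  by (rule measurable_compose_countable[OF _ dyadic_num_measurable[OF assms(1)]]) (rule assms(2), simp)

text \<open>Completeness turns almost sure equality with the measurable function \<open>Z'\<close>
  into measurability of \<open>Z\<close>. It is required for processes whose paths are regular only
  almost surely.\<close>

lemma (in complete_measure) measurable_of_AE_limit:
  fixes Z :: "'a \<Rightarrow> real"
  assumes f: "\<And>k. f k \<in> borel_measurable M" and lim: "AE \<omega> in M. (\<lambda>k. f k \<omega>) \<longlonglongrightarrow> Z \<omega>"
  shows "Z \<in> borel_measurable M"
proof -
  obtain Bad where Bad: "{\<omega> \<in> space M. \<not> (\<lambda>k. f k \<omega>) \<longlonglongrightarrow> Z \<omega>} \<subseteq> Bad" "emeasure M Bad = 0" "Bad \<in> sets M"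
    using lim by (rule AE_E)
  define Z' where "Z' \<omega> = (if \<omega> \<in> space M - Bad then Z \<omega> else 0)" for \<omega>
  note [measurable] = f Bad(3)
  have [measurable]: "Z' \<in> borel_measurable M"
  proof (rule borel_measurable_LIMSEQ_real)
    show "(\<lambda>k. if \<omega> \<in> space M - Bad then f k \<omega> else 0) \<longlonglongrightarrow> Z' \<omega>" for \<omega>
      using Bad(1) by (cases "\<omega> \<in> space M - Bad") (auto simp: Z'_def)
  qed measurable
  have ae: "AE \<omega> in M. Z' \<omega> = Z \<omega>"
  proof -
    have "Bad \<in> null_sets M" using Bad by auto
    from AE_not_in[OF this] AE_space show ?thesis by eventually_elim (simp add: Z'_def)
  qed
  show ?thesis
  proof (rule measurableI)
    fix A :: "real set" assume "A \<in> sets borel"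
    then have A: "Z' -` A \<inter> space M \<in> sets M" by measurable
    have "AE \<omega> in M. \<omega> \<in> Z' -` A \<inter> space M \<longleftrightarrow> \<omega> \<in> Z -` A \<inter> space M"
      using ae by eventually_elim simp
    from in_sets_AE[OF this A] show "Z -` A \<inter> space M \<in> sets M" by simp
  qed simp
qed

text \<open>Where \<open>\<bar>f \<omega>\<bar>\<close> exceeds \<open>K\<close>, so does the
  dominating function. One tail integral of the latter therefore bounds all members of
  \<open>H\<close> and tends to \<open>0\<close>.\<close>

lemma (in prob_space) uniformly_integrable_dominated:
  assumes m: "\<And>f. f \<in> H \<Longrightarrow> f \<in> borel_measurable M"
    and dom: "\<And>f. f \<in> H \<Longrightarrow> AE \<omega> in M. \<bar>f \<omega>\<bar> \<le> g \<omega>" and g: "integrable M g"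
  shows "uniformly_integrable M H"
proof -
  define g' where "g' \<omega> = \<bar>g \<omega>\<bar>" for \<omega>
  have g': "integrable M g'" "\<And>\<omega>. 0 \<le> g' \<omega>" unfolding g'_def using g by auto
  have [measurable]: "g' \<in> borel_measurable M" using g'(1) by simp
  define t where "t K = expectation (\<lambda>\<omega>. g' \<omega> * indicator {\<omega>. K < g' \<omega>} \<omega>)" for K
  have tm: "(\<lambda>\<omega>. g' \<omega> * indicator {\<omega>. K < g' \<omega>} \<omega>) \<in> borel_measurable M" for K by measurable
  have ti: "integrable M (\<lambda>\<omega>. g' \<omega> * indicator {\<omega>. K < g' \<omega>} \<omega>)" for K
    by (rule Bochner_Integration.integrable_bound[OF g'(1) tm]) (auto simp: indicator_def g'(2))
  have "((\<lambda>K. t K) \<longlongrightarrow> expectation (\<lambda>\<omega>. 0)) at_top"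
    unfolding t_def
  proof (rule integral_dominated_convergence_at_top[OF _ tm g'(1)])
    show "\<forall>\<^sub>F K in at_top. AE \<omega> in M. norm (g' \<omega> * indicator {\<omega>. K < g' \<omega>} \<omega>) \<le> g' \<omega>"
      by (intro always_eventually allI AE_I2) (auto simp: indicator_def g'(2))
    show "AE \<omega> in M. ((\<lambda>K. g' \<omega> * indicator {\<omega>. K < g' \<omega>} \<omega>) \<longlongrightarrow> 0) at_top"
    proof (rule AE_I2)
      fix \<omega>
      have "\<forall>\<^sub>F K in at_top. g' \<omega> * indicator {\<omega>. K < g' \<omega>} \<omega> = 0"
        using eventually_ge_at_top[of "g' \<omega>"] by eventually_elim simp
      then show "((\<lambda>K. g' \<omega> * indicator {\<omega>. K < g' \<omega>} \<omega>) \<longlongrightarrow> 0) at_top" by (rule tendsto_eventually)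
    qed
  qed auto
  then have "((\<lambda>K. ennreal (t K)) \<longlongrightarrow> ennreal 0) at_top" by (intro tendsto_ennrealI) simp
  then have t0: "((\<lambda>K. ennreal (t K)) \<longlongrightarrow> 0) at_top" by simp
  have le: "(SUP f\<in>H. \<integral>\<^sup>+\<omega>. ennreal \<bar>f \<omega>\<bar> * indicator {\<omega>. K < \<bar>f \<omega>\<bar>} \<omega> \<partial>M) \<le> ennreal (t K)" for K
  proof (rule SUP_least)
    fix f assume f: "f \<in> H"
    have "(\<integral>\<^sup>+\<omega>. ennreal \<bar>f \<omega>\<bar> * indicator {\<omega>. K < \<bar>f \<omega>\<bar>} \<omega> \<partial>M) \<le> (\<integral>\<^sup>+\<omega>. ennreal (g' \<omega> * indicator {\<omega>. K < g' \<omega>} \<omega>) \<partial>M)"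
    proof (rule nn_integral_mono_AE)
      show "AE \<omega> in M. ennreal \<bar>f \<omega>\<bar> * indicator {\<omega>. K < \<bar>f \<omega>\<bar>} \<omega> \<le> ennreal (g' \<omega> * indicator {\<omega>. K < g' \<omega>} \<omega>)"
        using dom[OF f]
      proof eventually_elim
        case (elim \<omega>)
        then have "\<bar>f \<omega>\<bar> \<le> g' \<omega>" by (simp add: g'_def)
        then show ?case by (auto simp: indicator_def intro: ennreal_leI)
      qed
    qed
    also have "\<dots> = ennreal (t K)"
      unfolding t_def using g'(2) by (intro nn_integral_eq_integral ti) auto
    finally show "(\<integral>\<^sup>+\<omega>. ennreal \<bar>f \<omega>\<bar> * indicator {\<omega>. K < \<bar>f \<omega>\<bar>} \<omega> \<partial>M) \<le> ennreal (t K)" .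
  qed
  show ?thesis
    unfolding uniformly_integrable_def
  proof (intro conjI ballI m)
    show "((\<lambda>K. SUP f\<in>H. \<integral>\<^sup>+\<omega>. ennreal \<bar>f \<omega>\<bar> * indicator {\<omega>. K < \<bar>f \<omega>\<bar>} \<omega> \<partial>M) \<longlongrightarrow> 0) at_top"
      by (rule tendsto_sandwich[OF _ _ tendsto_const t0]) (use le in auto)
  qed
qed

context subordinated_poisson
begin

definition N_up :: "nat \<Rightarrow> real \<Rightarrow> 'w \<Rightarrow> nat" where
  "N_up k r \<omega> = N (dyadic_up k (Y r \<omega>)) \<omega>"

lemma N_up_M: "0 \<le> r \<Longrightarrow> N_up k r \<in> measurable M (count_space UNIV)"
  unfolding N_up_def[abs_def] by (rule measurable_at_dyadic_up[of "Y r" M N, OF Y_M N_M])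

lemma dyadic_up_Y_M: "0 \<le> r \<Longrightarrow> (\<lambda>\<omega>. dyadic_up k (Y r \<omega>)) \<in> borel_measurable M"
  by (rule measurable_at_dyadic_up[of _ _ "\<lambda>u _. u"]) (auto intro: Y_M)

text \<open>Conditioning on the clock by hand: the rounded clock values at \<open>t\<close>,
  \<open>s\<close> and all past times form a countably valued vector \<open>J\<close>. On
  \<open>J \<omega> = v\<close> the variables \<open>N_up\<close> are \<open>N\<close> at constant
  times, and that event belongs to \<open>YA\<close>, hence can be merged with
  \<open>C\<close>.\<close>

lemma dyadic_clock_mixing:
  assumes st: "0 \<le> s" "s \<le> t" and ps: "\<forall>p\<in>set ps. 0 \<le> fst p \<and> fst p \<le> s" and C: "C \<in> sets YA"
  shows "(\<integral>\<^sup>+\<omega>. ennreal ((real (N_up k t \<omega>) - real (N_up k s \<omega>)) * indicator (cylinder M (N_up k) ps \<inter> C) \<omega>) \<partial>M) =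
    (\<integral>\<^sup>+\<omega>. ennreal (lam * (dyadic_up k (Y t \<omega>) - dyadic_up k (Y s \<omega>)) * indicator (cylinder M (N_up k) ps \<inter> C) \<omega>) \<partial>M)"
    (is "(\<integral>\<^sup>+\<omega>. ennreal (?f \<omega>) \<partial>M) = (\<integral>\<^sup>+\<omega>. ennreal (?g \<omega>) \<partial>M)")
proof -
  have t0: "0 \<le> t" using st by simp
  have CM: "C \<in> events" using C YA_sub by (auto simp: subalgebra_def)
  have cyl: "cylinder M (N_up k) ps \<in> events" using ps by (intro cylinder_sets N_up_M) auto
  \<comment> \<open>The order matters for the indices below: \<open>t\<close> has position
    \<open>0\<close>, \<open>s\<close> position \<open>1\<close>, and the times of \<open>ps\<close>
    start at position \<open>2\<close>.\<close>
  define rs where "rs = t # s # map fst ps"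
  have rs0: "0 \<le> r" if "r \<in> set rs" for r using that st t0 ps by (auto simp: rs_def)
  have len: "length rs = length ps + 2" by (simp add: rs_def)
  define J where "J \<omega> = map (\<lambda>r. dyadic_num k (Y r \<omega>)) rs" for \<omega>
  have J_YA: "J \<in> measurable YA (count_space UNIV)"
    unfolding J_def by (rule measurable_nat_list) (rule dyadic_num_measurable[OF Y_YA[OF rs0]])
  have JM: "J \<in> measurable M (count_space UNIV)"
    by (rule measurable_from_subalg[OF YA_sub J_YA])
  have Nm: "(\<lambda>\<omega>. real (N_up k r \<omega>)) \<in> borel_measurable M" if "0 \<le> r" for r
    by (rule measurable_compose[OF N_up_M[OF that]]) simp
  have fM: "?f \<in> borel_measurable M"
    by (intro borel_measurable_times borel_measurable_diff borel_measurable_indicator sets.Int cyl CM Nm st t0)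
  have gM: "?g \<in> borel_measurable M"
    by (intro borel_measurable_times borel_measurable_diff borel_measurable_indicator borel_measurable_const
        sets.Int cyl CM dyadic_up_Y_M st t0)
  show ?thesis
  proof (rule nn_integral_eq_countable_split[OF JM])
    show "(\<lambda>\<omega>. ennreal (?f \<omega>)) \<in> borel_measurable M" "(\<lambda>\<omega>. ennreal (?g \<omega>)) \<in> borel_measurable M"
      using fM gM by simp_all
    fix v
    define D where "D = {\<omega> \<in> space M. J \<omega> = v}"
    have "D = J -` {v} \<inter> space YA" by (auto simp: D_def space_YA)
    then have D: "D \<in> sets YA" using measurable_sets[OF J_YA, of "{v}"] by simp
    define a where "a = real (v ! 0) / 2 ^ k"
    define b where "b = real (v ! 1) / 2 ^ k"
    \<comment> \<open>The constraints of \<open>ps\<close>, with each time replaced by the rounded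
      clock value prescribed by \<open>v\<close>.\<close>
    define qs where "qs = map (\<lambda>i. (real (v ! (i + 2)) / 2 ^ k, snd (ps ! i))) [0..<length ps]"
    have onD: "dyadic_up k (Y (rs ! i) \<omega>) = real (v ! i) / 2 ^ k" if "\<omega> \<in> D" "i < length ps + 2" for i \<omega>
      using that len by (auto simp: D_def J_def dyadic_up_def)
    have Dt: "dyadic_up k (Y t \<omega>) = a" and Ds: "dyadic_up k (Y s \<omega>) = b" if "\<omega> \<in> D" for \<omega>
      using onD[OF that, of 0] onD[OF that, of 1] by (simp_all add: rs_def a_def b_def)
    have Dp: "dyadic_up k (Y (fst (ps ! i)) \<omega>) = real (v ! (i + 2)) / 2 ^ k" if "\<omega> \<in> D" "i < length ps" for i \<omega>
      using onD[OF that(1), of "i + 2"] that by (simp add: rs_def)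
    have Dcyl: "\<omega> \<in> cylinder M (N_up k) ps \<longleftrightarrow> \<omega> \<in> cylinder M N qs" if "\<omega> \<in> D" for \<omega>
    proof -
      have "(\<forall>p\<in>set ps. N_up k (fst p) \<omega> \<in> snd p) \<longleftrightarrow> (\<forall>i<length ps. N_up k (fst (ps ! i)) \<omega> \<in> snd (ps ! i))"
        by (simp add: all_set_conv_all_nth)
      also have "\<dots> \<longleftrightarrow> (\<forall>i<length ps. N (real (v ! (i + 2)) / 2 ^ k) \<omega> \<in> snd (ps ! i))"
        using Dp[OF that] by (simp add: N_up_def)
      also have "\<dots> \<longleftrightarrow> (\<forall>q\<in>set qs. N (fst q) \<omega> \<in> snd q)" by (auto simp: qs_def)
      finally show ?thesis using that by (simp add: cylinder_def D_def)
    qed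
    let ?S = "cylinder M N qs \<inter> (C \<inter> D)"
    have f_eq: "ennreal (?f \<omega>) * indicator {\<omega>. J \<omega> = v} \<omega> = ennreal ((real (N a \<omega>) - real (N b \<omega>)) * indicator ?S \<omega>)"
      and g_eq: "ennreal (?g \<omega>) * indicator {\<omega>. J \<omega> = v} \<omega> = ennreal (lam * (a - b)) * indicator ?S \<omega>"
      if \<omega>: "\<omega> \<in> space M" for \<omega>
    proof -
      consider "\<omega> \<in> D" "J \<omega> = v" | "\<omega> \<notin> D" "J \<omega> \<noteq> v" using \<omega> unfolding D_def by blast
      then show "ennreal (?f \<omega>) * indicator {\<omega>. J \<omega> = v} \<omega> = ennreal ((real (N a \<omega>) - real (N b \<omega>)) * indicator ?S \<omega>)"
        "ennreal (?g \<omega>) * indicator {\<omega>. J \<omega> = v} \<omega> = ennreal (lam * (a - b)) * indicator ?S \<omega>"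
        by (cases; simp add: Dt Ds Dcyl N_up_def indicator_def)+
    qed
    have qs0: "\<forall>q\<in>set qs. 0 \<le> fst q" by (auto simp: qs_def)
    have DM: "D \<in> events" using D YA_sub by (auto simp: subalgebra_def)
    have S: "?S \<in> events" by (intro sets.Int cylinder_sets qs0 N_M CM DM)
    have ab0: "0 \<le> a" "0 \<le> b" by (auto simp: a_def b_def)
    have CD: "C \<inter> D \<in> sets YA" using C D by (rule sets.Int)
    have "(\<integral>\<^sup>+\<omega>. ennreal ((real (N a \<omega>) - real (N b \<omega>)) * indicator ?S \<omega>) \<partial>M) = (\<integral>\<^sup>+\<omega>. ennreal (lam * (a - b)) * indicator ?S \<omega> \<partial>M)"
    proof (cases "length v = length rs \<and> b \<le> a \<and> (\<forall>q\<in>set qs. fst q \<le> b)")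
      case True
      then have ord: "b \<le> a" "\<forall>q\<in>set qs. 0 \<le> fst q \<and> fst q \<le> b" using qs0 by auto
      note inc = N_past_increment_clock[OF ab0(2) ord CD]
      have "AE \<omega> in M. 0 \<le> (real (N a \<omega>) - real (N b \<omega>)) * indicator ?S \<omega>"
        using AE_paths
      proof eventually_elim
        case (elim \<omega>)
        then have "N b \<omega> \<le> N a \<omega>" using counting_path_mono[of "\<lambda>t. N t \<omega>" b a] ab0 ord by simp
        then show ?case by simp
      qed
      then have "(\<integral>\<^sup>+\<omega>. ennreal ((real (N a \<omega>) - real (N b \<omega>)) * indicator ?S \<omega>) \<partial>M) = ennreal (lam * (a - b) * prob ?S)"
        unfolding inc(1)[symmetric] by (intro nn_integral_eq_integral inc(2))
      also have "\<dots> = ennreal (lam * (a - b)) * emeasure M ?S"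
        using lam ord by (simp add: emeasure_eq_measure ennreal_mult')
      also have "\<dots> = (\<integral>\<^sup>+\<omega>. ennreal (lam * (a - b)) * indicator ?S \<omega> \<partial>M)"
        using S by (simp add: nn_integral_cmult_indicator)
      finally show ?thesis .
    next
      case False
      \<comment> \<open>The clock is almost surely monotone, so a vector \<open>v\<close> in the
        wrong order has probability zero.\<close>
      have "AE \<omega> in M. \<omega> \<notin> D"
        using AE_paths
      proof eventually_elim
        case (elim \<omega>)
        then have l: "clock_path (\<lambda>s. L s \<omega>)" by simp
        show ?case
        proof
          assume \<omega>: "\<omega> \<in> D"
          have "length v = length rs" using \<omega> by (auto simp: D_def J_def)
          moreover have "b \<le> a"
            using dyadic_up_mono[OF Y_mono[OF l st(2)], of k] Dt[OF \<omega>] Ds[OF \<omega>] by simp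
          moreover have "fst q \<le> b" if q: "q \<in> set qs" for q
          proof -
            obtain i where i: "i < length ps" "fst q = real (v ! (i + 2)) / 2 ^ k" using q by (auto simp: qs_def)
            have "fst (ps ! i) \<le> s" using ps i by simp
            then show ?thesis
              using dyadic_up_mono[OF Y_mono[OF l], of "fst (ps ! i)" s k] Dp[OF \<omega> i(1)] Ds[OF \<omega>] i(2) by simp
          qed
          ultimately show False using False by blast
        qed
      qed
      then show ?thesis by (intro nn_integral_cong_AE) (auto elim!: eventually_mono)
    qed
    moreover have "(\<integral>\<^sup>+\<omega>. ennreal (?f \<omega>) * indicator {\<omega>. J \<omega> = v} \<omega> \<partial>M) =
        (\<integral>\<^sup>+\<omega>. ennreal ((real (N a \<omega>) - real (N b \<omega>)) * indicator ?S \<omega>) \<partial>M)"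
      by (rule nn_integral_cong) (rule f_eq)
    moreover have "(\<integral>\<^sup>+\<omega>. ennreal (?g \<omega>) * indicator {\<omega>. J \<omega> = v} \<omega> \<partial>M) =
        (\<integral>\<^sup>+\<omega>. ennreal (lam * (a - b)) * indicator ?S \<omega> \<partial>M)"
      by (rule nn_integral_cong) (rule g_eq)
    ultimately show "(\<integral>\<^sup>+\<omega>. ennreal (?f \<omega>) * indicator {\<omega>. J \<omega> = v} \<omega> \<partial>M) = (\<integral>\<^sup>+\<omega>. ennreal (?g \<omega>) * indicator {\<omega>. J \<omega> = v} \<omega> \<partial>M)"
      by (simp only:)
  qed
qed

lemma N_up_order:
  assumes "clock_path (\<lambda>s. L s \<omega>)" "counting_path (\<lambda>t. N t \<omega>)" "s \<le> t"
  shows "N_up k s \<omega> \<le> N_up k t \<omega>" "N_up k t \<omega> \<le> N_up 0 t \<omega>"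
proof -
  note y = Y_nonneg[OF assms(1)]
  have "0 \<le> dyadic_up k (Y r \<omega>)" for r k using dyadic_up_bounds(1)[OF y, of r k] y[of r] by linarith
  then show "N_up k s \<omega> \<le> N_up k t \<omega>" "N_up k t \<omega> \<le> N_up 0 t \<omega>"
    unfolding N_up_def
    using counting_path_mono[OF assms(2)] dyadic_up_mono[OF Y_mono[OF assms(1,3)]] dyadic_up_le_0[OF y]
    by blast+
qed

text \<open>The mixing identity compares nonnegative integrals. Its clock side is bounded by
  \<open>lam * (Y t + 1)\<close> and hence finite, which is what makes the side with
  \<open>N_up\<close> integrable.\<close>

lemma dyadic_clock_expectation:
  assumes st: "0 \<le> s" "s \<le> t" and ps: "\<forall>p\<in>set ps. 0 \<le> fst p \<and> fst p \<le> s" and C: "C \<in> sets YA"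
  shows "expectation (\<lambda>\<omega>. (real (N_up k t \<omega>) - real (N_up k s \<omega>)) * indicator (cylinder M (N_up k) ps \<inter> C) \<omega>) =
    expectation (\<lambda>\<omega>. lam * (dyadic_up k (Y t \<omega>) - dyadic_up k (Y s \<omega>)) * indicator (cylinder M (N_up k) ps \<inter> C) \<omega>)"
    (is "expectation ?f = expectation ?g")
    and "integrable M (\<lambda>\<omega>. (real (N_up k t \<omega>) - real (N_up k s \<omega>)) * indicator (cylinder M (N_up k) ps \<inter> C) \<omega>)"
    and "(\<lambda>\<omega>. lam * (dyadic_up k (Y t \<omega>) - dyadic_up k (Y s \<omega>)) * indicator (cylinder M (N_up k) ps \<inter> C) \<omega>) \<in> borel_measurable M"
    and "AE \<omega> in M. \<bar>lam * (dyadic_up k (Y t \<omega>) - dyadic_up k (Y s \<omega>)) * indicator (cylinder M (N_up k) ps \<inter> C) \<omega>\<bar> \<le> lam * (Y t \<omega> + 1)"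
proof -
  have t0: "0 \<le> t" using st by simp
  have CM: "C \<in> events" using C YA_sub by (auto simp: subalgebra_def)
  have cyl: "cylinder M (N_up k) ps \<in> events" using ps by (intro cylinder_sets N_up_M) auto
  have Nm: "(\<lambda>\<omega>. real (N_up k r \<omega>)) \<in> borel_measurable M" if "0 \<le> r" for r
    by (rule measurable_compose[OF N_up_M[OF that]]) simp
  have fM: "?f \<in> borel_measurable M"
    by (intro borel_measurable_times borel_measurable_diff borel_measurable_indicator sets.Int cyl CM Nm st t0)
  show gM: "?g \<in> borel_measurable M"
    by (intro borel_measurable_times borel_measurable_diff borel_measurable_indicator borel_measurable_const
        sets.Int cyl CM dyadic_up_Y_M st t0)
  have bd: "AE \<omega> in M. 0 \<le> ?f \<omega> \<and> 0 \<le> ?g \<omega> \<and> ?g \<omega> \<le> lam * (Y t \<omega> + 1)"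
    using AE_paths
  proof eventually_elim
    case (elim \<omega>)
    then have l: "clock_path (\<lambda>s. L s \<omega>)" and n: "counting_path (\<lambda>t. N t \<omega>)" by auto
    have 1: "N_up k s \<omega> \<le> N_up k t \<omega>" by (rule N_up_order[OF l n st(2)])
    have 2: "dyadic_up k (Y s \<omega>) \<le> dyadic_up k (Y t \<omega>)" by (rule dyadic_up_mono[OF Y_mono[OF l st(2)]])
    have "1 / 2 ^ k \<le> (1 :: real)" by simp
    then have "dyadic_up k (Y t \<omega>) \<le> Y t \<omega> + 1" using dyadic_up_bounds(2)[OF Y_nonneg[OF l], of k t] by linarith
    moreover have "0 \<le> dyadic_up k (Y s \<omega>)" using dyadic_up_bounds(1)[OF Y_nonneg[OF l], of s k] Y_nonneg[OF l, of s] by linarith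
    ultimately have 3: "dyadic_up k (Y t \<omega>) - dyadic_up k (Y s \<omega>) \<le> Y t \<omega> + 1" by linarith
    then have "lam * (dyadic_up k (Y t \<omega>) - dyadic_up k (Y s \<omega>)) \<le> lam * (Y t \<omega> + 1)"
      using lam by (intro mult_left_mono) auto
    moreover have "0 \<le> lam * (Y t \<omega> + 1)" using lam Y_nonneg[OF l, of t] by simp
    ultimately show ?case using 1 2 lam by (auto simp: indicator_def)
  qed
  show "AE \<omega> in M. \<bar>?g \<omega>\<bar> \<le> lam * (Y t \<omega> + 1)" using bd by eventually_elim simp
  have f0: "AE \<omega> in M. 0 \<le> ?f \<omega>" and g0: "AE \<omega> in M. 0 \<le> ?g \<omega>" and g1: "AE \<omega> in M. norm (?g \<omega>) \<le> norm (lam * (Y t \<omega> + 1))"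
    using bd by (eventually_elim, auto)+
  show "expectation ?f = expectation ?g"
    unfolding integral_eq_nn_integral[OF fM f0] integral_eq_nn_integral[OF gM g0] dyadic_clock_mixing[OF st ps C] ..
  have "integrable M ?g"
    by (rule Bochner_Integration.integrable_bound[OF _ gM g1]) (use Y_int[OF t0] in auto)
  then have "(\<integral>\<^sup>+\<omega>. ennreal (?g \<omega>) \<partial>M) < \<infinity>"
    using g0 by (subst nn_integral_eq_integral) auto
  then show "integrable M ?f"
    using fM f0 by (intro integrableI_nonneg) (simp_all add: dyadic_clock_mixing[OF st ps C])
qed

lemma space_in_YA: "space M \<in> sets YA"
  using sets.top[of YA] by (simp add: space_YA)

lemma N_int: "0 \<le> t \<Longrightarrow> integrable M (\<lambda>\<omega>. real (N t \<omega>))"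
proof -
  assume t: "0 \<le> t"
  have m: "(\<lambda>\<omega>. real (N u \<omega>)) \<in> borel_measurable M" if "0 \<le> u" for u
    by (rule measurable_compose[OF N_M[OF that]]) simp
  have "AE \<omega> in M. real (N t \<omega>) = real (N t \<omega>) - real (N 0 \<omega>)"
    using AE_paths by eventually_elim (simp add: counting_path_def)
  then show ?thesis
    using N_increment(1)[OF order_refl t] m[OF t]
    by (subst integrable_cong_AE[where g="\<lambda>\<omega>. real (N t \<omega>) - real (N 0 \<omega>)"]) (auto intro: borel_measurable_integrable)
qed

text \<open>At level \<open>0\<close> the initial clock value \<open>0\<close> is rounded up to
  \<open>1\<close>. The increment from time \<open>0\<close> therefore lacks \<open>N 1\<close>,
  which is added back.\<close>

lemma N_up_int:
  assumes t: "0 \<le> t"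
  shows "integrable M (\<lambda>\<omega>. real (N_up 0 t \<omega>))"
proof -
  have m: "(\<lambda>\<omega>. real (N_up 0 r \<omega>)) \<in> borel_measurable M" if "0 \<le> r" for r
    by (rule measurable_compose[OF N_up_M[OF that]]) simp
  have "integrable M (\<lambda>\<omega>. (real (N_up 0 t \<omega>) - real (N_up 0 0 \<omega>)) * indicator (cylinder M (N_up 0) [] \<inter> space M) \<omega>)"
    by (rule dyadic_clock_expectation(2)[OF order_refl t _ space_in_YA]) simp
  then have i: "integrable M (\<lambda>\<omega>. (real (N_up 0 t \<omega>) - real (N_up 0 0 \<omega>)) * indicator (cylinder M (N_up 0) [] \<inter> space M) \<omega> + real (N 1 \<omega>))"
    by (intro Bochner_Integration.integrable_add N_int) auto
  have "AE \<omega> in M. real (N_up 0 t \<omega>) = (real (N_up 0 t \<omega>) - real (N_up 0 0 \<omega>)) * indicator (cylinder M (N_up 0) [] \<inter> space M) \<omega> + real (N 1 \<omega>)"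
    using AE_paths AE_space
  proof eventually_elim
    case (elim \<omega>)
    then have "Y 0 \<omega> = 0" by (simp add: inverse_subordinator_eq path_inverse_0)
    then have "N_up 0 0 \<omega> = N 1 \<omega>" by (simp add: N_up_def dyadic_up_def dyadic_num_def)
    then show ?case using elim by (simp add: cylinder_def)
  qed
  then show ?thesis
    using i by (subst integrable_cong_AE[OF m[OF t]]) (auto intro: borel_measurable_integrable)
qed

lemma N_up_eventually:
  assumes r: "0 \<le> r"
  shows "AE \<omega> in M. \<forall>\<^sub>F k in sequentially. N_up k r \<omega> = X r \<omega>"
  using AE_paths
proof eventually_elim
  case (elim \<omega>)
  have "\<forall>\<^sub>F k in sequentially. N (dyadic_up k (Y r \<omega>)) \<omega> = N (Y r \<omega>) \<omega>"
    using dyadic_up_counting[of "\<lambda>t. N t \<omega>" "Y r \<omega>"] elim Y_nonneg by blast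
  then show ?case using elim r by (simp add: N_up_def)
qed

lemma X_real_M: "0 \<le> t \<Longrightarrow> (\<lambda>\<omega>. real (X t \<omega>)) \<in> borel_measurable M"
  by (rule measurable_compose[OF X_M]) auto

text \<open>Rounding the clock up can only increase \<open>N\<close>, so \<open>X t\<close> is
  dominated by the integrable \<open>N_up 0 t\<close>.\<close>

lemma X_int:
  assumes t: "0 \<le> t"
  shows "integrable M (\<lambda>\<omega>. real (X t \<omega>))"
proof (rule Bochner_Integration.integrable_bound[OF N_up_int[OF t] X_real_M[OF t]])
  show "AE \<omega> in M. norm (real (X t \<omega>)) \<le> norm (real (N_up 0 t \<omega>))"
    using AE_paths
  proof eventually_elim
    case (elim \<omega>)
    have "N (Y t \<omega>) \<omega> \<le> N_up 0 t \<omega>"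
      unfolding N_up_def using elim Y_nonneg dyadic_up_bounds(1)[of "Y t \<omega>" 0] by (intro counting_path_mono[of "\<lambda>t. N t \<omega>"]) (auto intro: less_imp_le)
    then show ?case using elim t by simp
  qed
qed

text \<open>Finitely many times occur, so from some level on \<open>N_up k\<close> agrees with
  \<open>X\<close> at all of them and the cylinder indicators coincide. Level \<open>0\<close>
  dominates the increments of \<open>N_up\<close>, and \<open>lam * (Y t + 1)\<close> those of the
  rounded clock.\<close>

lemma cylinder_compensated:
  assumes st: "0 \<le> s" "s \<le> t" and ps: "\<forall>p\<in>set ps. 0 \<le> fst p \<and> fst p \<le> s" and C: "C \<in> sets YA"
  shows "expectation (\<lambda>\<omega>. (real (X t \<omega>) - real (X s \<omega>)) * indicator (cylinder M X ps \<inter> C) \<omega>) =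
    expectation (\<lambda>\<omega>. lam * (Y t \<omega> - Y s \<omega>) * indicator (cylinder M X ps \<inter> C) \<omega>)"
    (is "expectation ?f = expectation ?g")
proof -
  have t0: "0 \<le> t" using st by simp
  have CM: "C \<in> events" using C YA_sub by (auto simp: subalgebra_def)
  have cyl: "cylinder M X ps \<in> events" using ps by (intro cylinder_sets X_M) auto
  define f where "f k \<omega> = (real (N_up k t \<omega>) - real (N_up k s \<omega>)) * indicator (cylinder M (N_up k) ps \<inter> C) \<omega>" for k \<omega>
  define g where "g k \<omega> = lam * (dyadic_up k (Y t \<omega>) - dyadic_up k (Y s \<omega>)) * indicator (cylinder M (N_up k) ps \<inter> C) \<omega>" for k \<omega>
  have eq: "expectation (f k) = expectation (g k)" for k
    unfolding f_def g_def by (rule dyadic_clock_expectation(1)[OF st ps C])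
  have fM: "f k \<in> borel_measurable M" for k
    unfolding f_def by (rule borel_measurable_integrable[OF dyadic_clock_expectation(2)[OF st ps C]])
  have gM: "g k \<in> borel_measurable M" for k
    unfolding g_def by (rule dyadic_clock_expectation(3)[OF st ps C])
  have FM: "?f \<in> borel_measurable M"
    by (intro borel_measurable_times borel_measurable_diff borel_measurable_indicator sets.Int cyl CM X_real_M st t0)
  have GM: "?g \<in> borel_measurable M"
    by (intro borel_measurable_times borel_measurable_diff borel_measurable_indicator borel_measurable_const
        sets.Int cyl CM Y_M st t0)
  have "AE \<omega> in M. \<forall>r\<in>set (t # s # map fst ps). \<forall>\<^sub>F k in sequentially. N_up k r \<omega> = X r \<omega>"
    by (rule AE_finite_allI) (use st t0 ps in \<open>auto intro!: N_up_eventually\<close>)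
  then have ev: "AE \<omega> in M. \<forall>\<^sub>F k in sequentially. N_up k t \<omega> = X t \<omega> \<and> N_up k s \<omega> = X s \<omega> \<and>
      indicator (cylinder M (N_up k) ps \<inter> C) \<omega> = indicat_real (cylinder M X ps \<inter> C) \<omega>"
  proof eventually_elim
    case (elim \<omega>)
    then have "\<forall>\<^sub>F k in sequentially. \<forall>r\<in>set (t # s # map fst ps). N_up k r \<omega> = X r \<omega>"
      by (intro eventually_ball_finite) auto
    then show ?case by eventually_elim (simp add: cylinder_def indicator_def)
  qed
  have "(\<lambda>k. expectation (f k)) \<longlonglongrightarrow> expectation ?f"
  proof (rule integral_dominated_convergence[OF FM fM N_up_int[OF t0]])
    show "AE \<omega> in M. (\<lambda>k. f k \<omega>) \<longlonglongrightarrow> ?f \<omega>"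
      using ev
    proof eventually_elim
      case (elim \<omega>)
      then have "\<forall>\<^sub>F k in sequentially. f k \<omega> = ?f \<omega>" by eventually_elim (simp add: f_def)
      then show ?case by (rule tendsto_eventually)
    qed
    show "AE \<omega> in M. norm (f k \<omega>) \<le> real (N_up 0 t \<omega>)" for k
      using AE_paths
    proof eventually_elim
      case (elim \<omega>)
      then have "N_up k s \<omega> \<le> N_up k t \<omega>" "N_up k t \<omega> \<le> N_up 0 t \<omega>" using N_up_order[of \<omega> s t k] st by auto
      then show ?case by (auto simp: f_def indicator_def)
    qed
  qed
  moreover have "(\<lambda>k. expectation (g k)) \<longlonglongrightarrow> expectation ?g"
  proof (rule integral_dominated_convergence[OF GM gM])
    show "integrable M (\<lambda>\<omega>. lam * (Y t \<omega> + 1))" using Y_int[OF t0] by auto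
    show "AE \<omega> in M. norm (g k \<omega>) \<le> lam * (Y t \<omega> + 1)" for k
      unfolding g_def real_norm_def by (rule dyadic_clock_expectation(4)[OF st ps C])
    show "AE \<omega> in M. (\<lambda>k. g k \<omega>) \<longlonglongrightarrow> ?g \<omega>"
      using ev AE_paths
    proof eventually_elim
      case (elim \<omega>)
      have i: "(\<lambda>k. indicator (cylinder M (N_up k) ps \<inter> C) \<omega> :: real) \<longlonglongrightarrow> indicator (cylinder M X ps \<inter> C) \<omega>"
        by (rule tendsto_eventually) (use elim(1) in eventually_elim, simp)
      have y: "0 \<le> Y r \<omega>" for r using elim(2) Y_nonneg by blast
      show ?case
        unfolding g_def by (intro tendsto_mult tendsto_diff tendsto_const dyadic_up_tendsto y i)
    qed
  qed
  ultimately show ?thesis using eq by (intro LIMSEQ_unique[of "\<lambda>k. expectation (f k)"]) auto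
qed

section \<open>The compensated process in the filtration of \<open>X\<close> and the clock\<close>

abbreviation F :: "ennreal \<Rightarrow> 'w measure" where "F \<equiv> fpp_filtration M X Y"

lemma F_sub: "subalgebra M (F t)"
  by (rule fpp_filtration_subalgebra[OF X_M Y_M])

text \<open>Past cylinders intersected with clock events form an intersection-stable family
  \<open>E\<close> that contains the generators of \<open>F s\<close>: a constraint on
  \<open>X\<close> is a cylinder of length one, a constraint on \<open>Y\<close> comes with the
  empty list.\<close>

lemma compensated_on_F:
  assumes st: "0 \<le> s" "s \<le> t" and A: "A \<in> sets (F (ennreal s))"
  shows "(\<integral>\<omega>\<in>A. ((real (X t \<omega>) - real (X s \<omega>)) - lam * (Y t \<omega> - Y s \<omega>)) \<partial>M) = 0"
proof -
  have t0: "0 \<le> t" using st by simp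
  define E where "E = {cylinder M X ps \<inter> C | ps C. (\<forall>p\<in>set ps. 0 \<le> fst p \<and> fst p \<le> s) \<and> C \<in> sets YA}"
  let ?d = "\<lambda>\<omega>. real (X t \<omega>) - real (X s \<omega>)" and ?e = "\<lambda>\<omega>. lam * (Y t \<omega> - Y s \<omega>)"
  have di: "integrable M ?d" and ei: "integrable M ?e"
    using X_int[OF t0] X_int[OF st(1)] Y_int[OF t0] Y_int[OF st(1)] by auto
  have EM: "E \<subseteq> events"
    unfolding E_def using YA_sub by (auto simp: subalgebra_def intro!: cylinder_sets X_M)
  have EI: "cylinder M X ps \<inter> C \<in> E" if "\<forall>p\<in>set ps. 0 \<le> fst p \<and> fst p \<le> s" "C \<in> sets YA" for ps C
    using that unfolding E_def by blast
  have Esp: "space M \<in> E" using EI[of "[]" "space M"] space_in_YA by (simp add: cylinder_def)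
  show ?thesis
  proof (rule integral_zero_on_generated[of E])
    show "Int_stable E"
      unfolding Int_stable_def
    proof (intro ballI)
      fix a b assume "a \<in> E" "b \<in> E"
      then obtain ps C qs D where *: "a = cylinder M X ps \<inter> C" "\<forall>p\<in>set ps. 0 \<le> fst p \<and> fst p \<le> s" "C \<in> sets YA"
        "b = cylinder M X qs \<inter> D" "\<forall>p\<in>set qs. 0 \<le> fst p \<and> fst p \<le> s" "D \<in> sets YA" unfolding E_def by blast
      have "a \<inter> b = cylinder M X (ps @ qs) \<inter> (C \<inter> D)" unfolding * by (auto simp: cylinder_def)
      also have "\<dots> \<in> E" using * by (intro EI sets.Int) auto
      finally show "a \<inter> b \<in> E" .
    qed
    show "integrable M (\<lambda>\<omega>. ?d \<omega> - ?e \<omega>)" using di ei by (rule Bochner_Integration.integrable_diff)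
    fix B assume "B \<in> E"
    then obtain ps C where B: "B = cylinder M X ps \<inter> C" "\<forall>p\<in>set ps. 0 \<le> fst p \<and> fst p \<le> s" "C \<in> sets YA"
      unfolding E_def by blast
    have BM: "B \<in> events" using \<open>B \<in> E\<close> EM by blast
    have "(\<integral>\<omega>\<in>B. (?d \<omega> - ?e \<omega>) \<partial>M) = expectation (\<lambda>\<omega>. ?d \<omega> * indicator B \<omega> - ?e \<omega> * indicator B \<omega>)"
      unfolding set_lebesgue_integral_def
      by (intro Bochner_Integration.integral_cong) (simp_all add: algebra_simps)
    also have "\<dots> = expectation (\<lambda>\<omega>. ?d \<omega> * indicator B \<omega>) - expectation (\<lambda>\<omega>. ?e \<omega> * indicator B \<omega>)"
      by (rule Bochner_Integration.integral_diff[OF integrable_real_mult_indicator[OF BM di] integrable_real_mult_indicator[OF BM ei]])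
    also have "\<dots> = 0" unfolding B(1) using cylinder_compensated[OF st B(2,3)] by simp
    finally show "(\<integral>\<omega>\<in>B. (?d \<omega> - ?e \<omega>) \<partial>M) = 0" .
  next
    have gen: "{X r -` A \<inter> space M | r A. 0 \<le> r \<and> ennreal r \<le> ennreal s} \<union> {Y r -` B \<inter> space M | r B. 0 \<le> r \<and> B \<in> sets borel} \<subseteq> E"
    proof (intro Un_least subsetI)
      fix a assume "a \<in> {X r -` A \<inter> space M | r A. 0 \<le> r \<and> ennreal r \<le> ennreal s}"
      then obtain r A where a: "a = X r -` A \<inter> space M" "0 \<le> r" "ennreal r \<le> ennreal s" by blast
      have "r \<le> s" using a(3) st(1) by (simp add: ennreal_le_iff)
      then have "cylinder M X [(r, A)] \<inter> space M \<in> E" using a(2) by (intro EI space_in_YA) auto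
      also have "cylinder M X [(r, A)] \<inter> space M = a" unfolding a(1) by (auto simp: cylinder_def)
      finally show "a \<in> E" .
    next
      fix a assume "a \<in> {Y r -` B \<inter> space M | r B. 0 \<le> r \<and> B \<in> sets borel}"
      then obtain r B where a: "a = Y r -` B \<inter> space M" "0 \<le> r" "B \<in> sets borel" by blast
      have "a \<in> sets YA" using measurable_sets[OF Y_YA[OF a(2)] a(3)] by (simp add: a(1) space_YA)
      then have "cylinder M X [] \<inter> a \<in> E" by (intro EI) auto
      also have "cylinder M X [] \<inter> a = a" unfolding a(1) by (auto simp: cylinder_def)
      finally show "a \<in> E" .
    qed
    show "A \<in> sigma_sets (space M) E"
      using A sigma_sets_mono'[OF gen] unfolding sets_fpp_filtration by blast
  qed (use EM Esp in auto)
qed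

text \<open>The conditional expectation is characterised by its integrals over the sets of
  \<open>F s\<close>, which reduces the martingale property to
  \<open>compensated_on_F\<close>.\<close>

lemma compensated_martingale: "martingale M F (\<lambda>t \<omega>. real (X t \<omega>) - lam * Y t \<omega>)"
  unfolding martingale_def
proof (intro conjI allI impI)
  show "filtration (space M) F"
    by (rule filtration.intro) (simp_all add: space_fpp_filtration fpp_filtration_mono)
  show "subalgebra M (F t)" for t by (rule F_sub)
  have Xm: "(\<lambda>\<omega>. real (X t \<omega>)) \<in> borel_measurable (F (ennreal t))" if "0 \<le> t" for t
    by (rule measurable_compose[OF fpp_filtration_X]) (use that in auto)
  show m: "(\<lambda>\<omega>. real (X t \<omega>) - lam * Y t \<omega>) \<in> borel_measurable (F (ennreal t))" if "0 \<le> t" for t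
    using that by (intro borel_measurable_diff borel_measurable_times borel_measurable_const Xm fpp_filtration_Y)
  show i: "integrable M (\<lambda>\<omega>. real (X t \<omega>) - lam * Y t \<omega>)" if "0 \<le> t" for t
    using X_int[OF that] Y_int[OF that] by auto
  fix s t :: real assume st: "0 \<le> s" "s \<le> t"
  then have t0: "0 \<le> t" by simp
  interpret finite_measure_subalgebra M "F (ennreal s)" using F_sub by unfold_locales
  show "AE \<omega> in M. real_cond_exp M (F (ennreal s)) (\<lambda>\<omega>. real (X t \<omega>) - lam * Y t \<omega>) \<omega> = real (X s \<omega>) - lam * Y s \<omega>"
  proof (rule real_cond_exp_charact[OF _ i[OF t0] i[OF st(1)] m[OF st(1)]])
    fix A assume A: "A \<in> sets (F (ennreal s))"
    then have AM: "A \<in> events" using F_sub[of "ennreal s"] by (auto simp: subalgebra_def)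
    have si: "set_integrable M A (\<lambda>\<omega>. real (X u \<omega>) - lam * Y u \<omega>)" if "0 \<le> u" for u
      unfolding set_integrable_def by (rule integrable_mult_indicator[OF AM i[OF that]])
    have "(\<integral>\<omega>\<in>A. (real (X t \<omega>) - lam * Y t \<omega>) \<partial>M) - (\<integral>\<omega>\<in>A. (real (X s \<omega>) - lam * Y s \<omega>) \<partial>M) =
        (\<integral>\<omega>\<in>A. ((real (X t \<omega>) - lam * Y t \<omega>) - (real (X s \<omega>) - lam * Y s \<omega>)) \<partial>M)"
      by (rule set_integral_diff(2)[OF si[OF t0] si[OF st(1)], symmetric])
    also have "\<dots> = (\<integral>\<omega>\<in>A. ((real (X t \<omega>) - real (X s \<omega>)) - lam * (Y t \<omega> - Y s \<omega>)) \<partial>M)"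
      unfolding set_lebesgue_integral_def
      by (intro Bochner_Integration.integral_cong) (simp_all add: algebra_simps)
    also have "\<dots> = 0" by (rule compensated_on_F[OF st A])
    finally show "(\<integral>\<omega>\<in>A. (real (X t \<omega>) - lam * Y t \<omega>) \<partial>M) = (\<integral>\<omega>\<in>A. (real (X s \<omega>) - lam * Y s \<omega>) \<partial>M)" by simp
  qed
qed

lemma compensated_right_continuous: "right_continuous_process M (\<lambda>t \<omega>. real (X t \<omega>) - lam * Y t \<omega>)"
  unfolding right_continuous_process_def
  using X_counting AE_paths
proof eventually_elim
  case (elim \<omega>)
  show ?case
  proof (intro allI impI)
    fix t :: real assume t: "0 \<le> t"
    have "((\<lambda>u. X u \<omega>) \<longlongrightarrow> X t \<omega>) (at_right t)"
      using elim(1) t by (auto simp: counting_path_def continuous_within)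
    then have "\<forall>\<^sub>F u in at_right t. real (X u \<omega>) = real (X t \<omega>)"
      using discrete_tendsto_eventually by (fastforce elim: eventually_mono)
    then have 1: "((\<lambda>u. real (X u \<omega>)) \<longlongrightarrow> real (X t \<omega>)) (at_right t)" by (rule tendsto_eventually)
    have "isCont (\<lambda>u. Y u \<omega>) t"
      using path_inverse_isCont[of "\<lambda>s. L s \<omega>" t] elim(2) by (simp add: inverse_subordinator_eq)
    then have 2: "((\<lambda>u. Y u \<omega>) \<longlongrightarrow> Y t \<omega>) (at_right t)"
      unfolding isCont_def by (rule tendsto_within_subset) simp
    show "continuous (at_right t) (\<lambda>u. real (X u \<omega>) - lam * Y u \<omega>)"
      unfolding continuous_within using 1 2 by (intro tendsto_intros)
  qed
qed

text \<open>Measurability of a stopped value takes more work than its domination: rounding the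
  stopping time up to dyadic numbers gives measurable approximations, which converge almost surely
  by right continuity, and completeness does the rest.\<close>

lemma stopped_values_uniformly_integrable:
  assumes complete: "complete_measure M" and T: "0 \<le> T"
  shows "uniformly_integrable M
    {stopped_value (\<lambda>t \<omega>. real (X t \<omega>) - lam * Y t \<omega>) \<tau> | \<tau>. \<tau> \<in> bounded_clock_stopping_times M F Y T}"
proof (rule uniformly_integrable_dominated)
  show "integrable M (\<lambda>\<omega>. real (N T \<omega>) + lam * T)" using N_int[OF T] by auto
  fix f assume "f \<in> {stopped_value (\<lambda>t \<omega>. real (X t \<omega>) - lam * Y t \<omega>) \<tau> | \<tau>. \<tau> \<in> bounded_clock_stopping_times M F Y T}"
  then obtain \<tau> where f: "f = stopped_value (\<lambda>t \<omega>. real (X t \<omega>) - lam * Y t \<omega>) \<tau>"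
    and \<tau>: "stopping_time F \<tau>" "AE \<omega> in M. \<tau> \<omega> < \<infinity> \<and> stopped_value Y \<tau> \<omega> \<le> T"
    unfolding bounded_clock_stopping_times_def by blast
  \<comment> \<open>\<open>enn2real\<close> sends \<open>\<infinity>\<close> to \<open>0\<close>, so
    \<open>\<rho>\<close> is a nonnegative real everywhere; the times in question are almost surely
    finite.\<close>
  define \<rho> where "\<rho> \<omega> = enn2real (\<tau> \<omega>)" for \<omega>
  have \<rho>0: "0 \<le> \<rho> \<omega>" for \<omega> by (simp add: \<rho>_def)
  have f_eq: "f \<omega> = real (X (\<rho> \<omega>) \<omega>) - lam * Y (\<rho> \<omega>) \<omega>" for \<omega>
    by (simp add: f stopped_value_def \<rho>_def)
  have "\<tau> \<in> borel_measurable M"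
  proof (rule borel_measurableI_le)
    fix y
    have "{\<omega> \<in> space (F y). \<tau> \<omega> \<le> y} \<in> sets (F y)"
      using stopping_timeD[OF \<tau>(1), of y] by (simp add: pred_def)
    then show "{\<omega> \<in> space M. \<tau> \<omega> \<le> y} \<in> events"
      using F_sub[of y] by (auto simp: subalgebra_def space_fpp_filtration)
  qed
  then have \<rho>M: "\<rho> \<in> borel_measurable M" unfolding \<rho>_def[abs_def] by measurable
  show "f \<in> borel_measurable M"
  proof (rule complete_measure.measurable_of_AE_limit[OF complete])
    show "(\<lambda>\<omega>. real (X (dyadic_up k (\<rho> \<omega>)) \<omega>) - lam * Y (dyadic_up k (\<rho> \<omega>)) \<omega>) \<in> borel_measurable M" for k
      by (intro borel_measurable_diff borel_measurable_times borel_measurable_const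
          measurable_at_dyadic_up[OF \<rho>M, of "\<lambda>u \<omega>. real (X u \<omega>)"] measurable_at_dyadic_up[OF \<rho>M, of Y] X_real_M Y_M)
    show "AE \<omega> in M. (\<lambda>k. real (X (dyadic_up k (\<rho> \<omega>)) \<omega>) - lam * Y (dyadic_up k (\<rho> \<omega>)) \<omega>) \<longlonglongrightarrow> f \<omega>"
      using X_counting AE_paths
    proof eventually_elim
      case (elim \<omega>)
      have "\<forall>\<^sub>F k in sequentially. real (X (dyadic_up k (\<rho> \<omega>)) \<omega>) = real (X (\<rho> \<omega>) \<omega>)"
        using dyadic_up_counting[OF elim(1) \<rho>0] by eventually_elim simp
      then have 1: "(\<lambda>k. real (X (dyadic_up k (\<rho> \<omega>)) \<omega>)) \<longlonglongrightarrow> real (X (\<rho> \<omega>) \<omega>)" by (rule tendsto_eventually)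
      have "isCont (\<lambda>u. Y u \<omega>) (\<rho> \<omega>)"
        using path_inverse_isCont[of "\<lambda>s. L s \<omega>"] elim(2) by (simp add: inverse_subordinator_eq)
      then have 2: "(\<lambda>k. Y (dyadic_up k (\<rho> \<omega>)) \<omega>) \<longlonglongrightarrow> Y (\<rho> \<omega>) \<omega>"
        by (rule isCont_tendsto_compose[OF _ dyadic_up_tendsto[OF \<rho>0]])
      show ?case unfolding f_eq by (intro tendsto_diff tendsto_mult tendsto_const 1 2)
    qed
  qed
  show "AE \<omega> in M. \<bar>f \<omega>\<bar> \<le> real (N T \<omega>) + lam * T"
    using \<tau>(2) AE_paths
  proof eventually_elim
    case (elim \<omega>)
    have y: "0 \<le> Y (\<rho> \<omega>) \<omega>" "Y (\<rho> \<omega>) \<omega> \<le> T"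
      using elim Y_nonneg by (auto simp: stopped_value_def \<rho>_def)
    have "N (Y (\<rho> \<omega>) \<omega>) \<omega> \<le> N T \<omega>" using elim(2) y counting_path_mono[of "\<lambda>t. N t \<omega>"] by blast
    then have "X (\<rho> \<omega>) \<omega> \<le> N T \<omega>" using elim(2) \<rho>0 by simp
    moreover have "0 \<le> lam * Y (\<rho> \<omega>) \<omega>" "lam * Y (\<rho> \<omega>) \<omega> \<le> lam * T"
      using y lam by (auto intro: mult_left_mono)
    ultimately show ?case unfolding f_eq by (simp add: abs_le_iff)
  qed
qed

end

theorem theorem2p2:
  fixes P :: "'w measure" and X :: "real \<Rightarrow> 'w \<Rightarrow> nat"
  assumes "prob_space P" and "complete_measure P"
    and "simple_locally_finite_point_process P X"
  shows "fractional_poisson_process P X \<longleftrightarrow>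
    (\<exists>lam>0. \<exists>\<alpha> L. 0 < \<alpha> \<and> \<alpha> < 1 \<and> stable_subordinator P \<alpha> L \<and>
      (let Y = inverse_subordinator L;
           F = fpp_filtration P X Y;
           M = (\<lambda>t \<omega>. real (X t \<omega>) - lam * Y t \<omega>)
       in martingale P F M \<and> right_continuous_process P M \<and>
          (\<forall>T>0. uniformly_integrable P
             {stopped_value M \<tau> | \<tau>. \<tau> \<in> bounded_clock_stopping_times P F Y T})))"
proof
  assume "fractional_poisson_process P X"
  then obtain \<alpha> lam N L where *: "0 < \<alpha>" "\<alpha> < 1" "0 < lam" "poisson_process P lam N" "stable_subordinator P \<alpha> L"
    "independent_processes P (\<lambda>t \<omega>. real (N t \<omega>)) (inverse_subordinator L)"
    "AE \<omega> in P. \<forall>t\<ge>0. X t \<omega> = N (inverse_subordinator L t \<omega>) \<omega>"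
    unfolding fractional_poisson_process_def fractional_poisson_process_with_def by blast
  have Xm: "X t \<in> measurable P (count_space UNIV)" if "0 \<le> t" for t
    using assms(3) that by (simp add: simple_locally_finite_point_process_def point_process_def)
  have Xc: "AE \<omega> in P. counting_path (\<lambda>t. X t \<omega>)"
    using assms(3) by (simp add: simple_locally_finite_point_process_def point_process_def)
  interpret subordinated_poisson P N L X \<alpha> lam
    by (rule subordinated_poisson.intro[OF assms(1) subordinated_poisson_axioms.intro[OF *(3,1,4,5,6,7) Xm Xc]])
  show "\<exists>lam>0. \<exists>\<alpha> L. 0 < \<alpha> \<and> \<alpha> < 1 \<and> stable_subordinator P \<alpha> L \<and>
      (let Y = inverse_subordinator L;
           F = fpp_filtration P X Y;
           M = (\<lambda>t \<omega>. real (X t \<omega>) - lam * Y t \<omega>)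
       in martingale P F M \<and> right_continuous_process P M \<and>
          (\<forall>T>0. uniformly_integrable P
             {stopped_value M \<tau> | \<tau>. \<tau> \<in> bounded_clock_stopping_times P F Y T}))"
    unfolding Let_def
    by (intro exI[of _ lam] exI[of _ \<alpha>] exI[of _ L] conjI allI impI * compensated_martingale
        compensated_right_continuous stopped_values_uniformly_integrable[OF assms(2)] less_imp_le)
next
  interpret prob_space P by fact
  show "fractional_poisson_process P X"
    if "\<exists>lam>0. \<exists>\<alpha> L. 0 < \<alpha> \<and> \<alpha> < 1 \<and> stable_subordinator P \<alpha> L \<and>
      (let Y = inverse_subordinator L;
           F = fpp_filtration P X Y;
           M = (\<lambda>t \<omega>. real (X t \<omega>) - lam * Y t \<omega>)
       in martingale P F M \<and> right_continuous_process P M \<and>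
          (\<forall>T>0. uniformly_integrable P
             {stopped_value M \<tau> | \<tau>. \<tau> \<in> bounded_clock_stopping_times P F Y T}))"
    using that unfolding Let_def by (elim exE conjE) (rule fractional_poisson_of_martingale[OF assms(3)])
qed

end
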